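(* Let $\Omega\subset\mathbb{R}^d$ be a bounded domain, let $m>0$, and let $\psi:\mathbb{R}\to[0,\infty]$ be a convex lower semicontinuous function such that $D(\psi)=\{s\in\mathbb{R}:\psi(s)<\infty\}$ has nonempty interior and $\lim_{|s|\to+\infty}\psi(s)=+\infty$. Let $$J(f)=\int_\Omega j(x,u_f,f)\,dx,$$ where $u_f$ is the solution of $-\Delta u=f$ in $\Omega$, $u=0$ on $\partial\Omega$. Suppose that the functional $J$ is weakly* lower semicontinuous in the space $\mathcal{M}(\Omega)$ of finite Radon measures on $\Omega$, and that the integrand $j$ satisfies the growth condition $$-c|s|^p-a(x)\le j(x,s,z),\qquad\text{for some } c>0,\ a\in L^1(\Omega),\ p<\frac{d}{d-2}.$$ If, in addition, $\psi$ satisfies the linear growth condition $$c_0|s|-a_0\le\psi(s)\quad\text{for all } s\in\mathbb{R},\qquad\text{for some constants } c_0>0,\ a_0\in\mathbb{R},$$ then the optimization problem $$\min\Big\{J(f)\ :\ f\in\mathcal{M}(\Omega),\ \int_\Omega\psi(f)\le m\Big\}$$ admits at least one optimal solution $f_{opt}$, which is a measure with finite total variation.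
   Context: $\mathcal{M}(\Omega)$ is the space of bounded Borel (signed) measures on $\Omega$. A measure is decomposed as $f=f^a\,dx+f^s$ into its absolutely continuous and singular parts, and $f^s_+$, $f^s_-$ are the positive and negative parts of $f^s$. With the recession limits $c^\pm(\psi)=\lim_{s\to\pm\infty}\psi(s)/s$, the constraint integral is interpreted in the sense of measures: $$\int_\Omega\psi(f)=\int_\Omega\psi(f^a(x))\,dx+c^+(\psi)\int df^s_+-c^-(\psi)\int df^s_-,$$ with the convention $\infty\cdot 0=0$. For $f\in\mathcal{M}(\Omega)$ the solution $u_f$ of $-\Delta u=f$ with zero boundary values belongs to $W^{1,q}_0(\Omega)$ for every $q<d/(d-1)$, hence to $L^p(\Omega)$ for every $p<d/(d-2)$. The functional $J$ is understood as defined on $\mathcal{M}(\Omega)$. When $d=2$, $d/(d-2)$ is read as $+\infty$.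
   Formalization: It is additionally assumed that at least one measure f satisfies the constraint ∫ψ(f) ≤ m; otherwise the claim fails, e.g. for ψ(s)=|s|+K with K|Ω|>m, where no measure is admissible. *)

theory Defs
  imports "HOL-Analysis.Analysis"
begin

section \<open>Finite signed measures\<close>

text \<open>
  A finite signed measure is a real-valued countably additive set function. The value outside
  the \<open>\<sigma>\<close>-algebra is fixed to be 0, so that equality of measures is equality of functions.
\<close>

definition signed_measures :: "'a measure \<Rightarrow> ('a set \<Rightarrow> real) set" where
  "signed_measures M = {\<nu>.
     (\<forall>A. A \<notin> sets M \<longrightarrow> \<nu> A = 0) \<and>
     (\<forall>A :: nat \<Rightarrow> 'a set. range A \<subseteq> sets M \<longrightarrow> disjoint_family A \<longrightarrow>
        (\<lambda>i. \<nu> (A i)) sums \<nu> (\<Union>i. A i))}"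

definition pos_part :: "'a measure \<Rightarrow> ('a set \<Rightarrow> real) \<Rightarrow> 'a measure" where
  "pos_part M \<nu> =
     measure_of (space M) (sets M) (\<lambda>A. SUP B\<in>{B \<in> sets M. B \<subseteq> A}. ennreal (\<nu> B))"

definition neg_part :: "'a measure \<Rightarrow> ('a set \<Rightarrow> real) \<Rightarrow> 'a measure" where
  "neg_part M \<nu> = pos_part M (\<lambda>A. - \<nu> A)"

definition total_variation :: "'a measure \<Rightarrow> ('a set \<Rightarrow> real) \<Rightarrow> ennreal" where
  "total_variation M \<nu> = emeasure (pos_part M \<nu>) (space M) + emeasure (neg_part M \<nu>) (space M)"

definition signed_integral :: "'a measure \<Rightarrow> ('a set \<Rightarrow> real) \<Rightarrow> ('a \<Rightarrow> real) \<Rightarrow> real" where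
  "signed_integral M \<nu> \<phi> = integral\<^sup>L (pos_part M \<nu>) \<phi> - integral\<^sup>L (neg_part M \<nu>) \<phi>"

abbreviation borel_on :: "'a::euclidean_space set \<Rightarrow> 'a measure" where
  "borel_on \<Omega> \<equiv> restrict_space borel \<Omega>"

abbreviation measures_on :: "'a::euclidean_space set \<Rightarrow> ('a set \<Rightarrow> real) set" where
  "measures_on \<Omega> \<equiv> signed_measures (borel_on \<Omega>)"

text \<open>\<open>f = g dx + s\<close> on \<open>\<Omega>\<close> with \<open>s\<close> concentrated on a Lebesgue-null set.\<close>

definition lebesgue_decomposition ::
  "'a::euclidean_space set \<Rightarrow> ('a set \<Rightarrow> real) \<Rightarrow> ('a \<Rightarrow> real) \<Rightarrow> ('a set \<Rightarrow> real) \<Rightarrow> bool" where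
  "lebesgue_decomposition \<Omega> f g s \<longleftrightarrow>
     integrable (lebesgue_on \<Omega>) g \<and> s \<in> measures_on \<Omega> \<and>
     (\<exists>N\<in>null_sets lborel. \<forall>A\<in>sets (borel_on \<Omega>). A \<inter> N = {} \<longrightarrow> s A = 0) \<and>
     (\<forall>A\<in>sets (borel_on \<Omega>). f A = (LINT x:A|lebesgue. g x) + s A)"

text \<open>The density is determined up to Lebesgue-null sets, the singular part is unique.\<close>

definition ac_density :: "'a::euclidean_space set \<Rightarrow> ('a set \<Rightarrow> real) \<Rightarrow> 'a \<Rightarrow> real" where
  "ac_density \<Omega> f = (SOME g. \<exists>s. lebesgue_decomposition \<Omega> f g s)"

definition sing_part :: "'a::euclidean_space set \<Rightarrow> ('a set \<Rightarrow> real) \<Rightarrow> 'a set \<Rightarrow> real" where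
  "sing_part \<Omega> f = (THE s. \<exists>g. lebesgue_decomposition \<Omega> f g s)"

section \<open>Weak* convergence\<close>

text \<open>The finite signed measures on \<open>\<Omega>\<close> are regarded as the dual of \<open>C\<^sub>0(\<Omega>)\<close>.\<close>

definition C0 :: "'a::euclidean_space set \<Rightarrow> ('a \<Rightarrow> real) set" where
  "C0 \<Omega> = {\<phi>. continuous_on \<Omega> \<phi> \<and> (\<forall>\<epsilon>>0. compact {x\<in>\<Omega>. \<bar>\<phi> x\<bar> \<ge> \<epsilon>})}"

definition weakstar_conv ::
  "'a::euclidean_space set \<Rightarrow> (nat \<Rightarrow> 'a set \<Rightarrow> real) \<Rightarrow> ('a set \<Rightarrow> real) \<Rightarrow> bool" where
  "weakstar_conv \<Omega> F f \<longleftrightarrow>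
     (\<forall>\<phi>\<in>C0 \<Omega>. (\<lambda>n. signed_integral (borel_on \<Omega>) (F n) \<phi>)
        \<longlonglongrightarrow> signed_integral (borel_on \<Omega>) f \<phi>)"

text \<open>
  Sequential lower semicontinuity. As a hypothesis it is implied by lower semicontinuity for
  the weak* topology.
\<close>

definition weakstar_lsc ::
  "'a::euclidean_space set \<Rightarrow> (('a set \<Rightarrow> real) \<Rightarrow> ereal) \<Rightarrow> bool" where
  "weakstar_lsc \<Omega> J \<longleftrightarrow>
     (\<forall>F f. (\<forall>n. F n \<in> measures_on \<Omega>) \<longrightarrow> f \<in> measures_on \<Omega> \<longrightarrow> weakstar_conv \<Omega> F f \<longrightarrow>
        J f \<le> liminf (\<lambda>n. J (F n)))"

section \<open>Integrals of extended real functions and the constraint\<close>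

text \<open>Only meaningful if one of the two integrals is finite.\<close>

definition ereal_integral :: "'a measure \<Rightarrow> ('a \<Rightarrow> ereal) \<Rightarrow> ereal" where
  "ereal_integral M h =
     enn2ereal (\<integral>\<^sup>+x. e2ennreal (h x) \<partial>M) - enn2ereal (\<integral>\<^sup>+x. e2ennreal (- h x) \<partial>M)"

definition ereal_convex :: "(real \<Rightarrow> ereal) \<Rightarrow> bool" where
  "ereal_convex \<psi> \<longleftrightarrow> (\<forall>x y. \<forall>u\<ge>0. \<forall>v\<ge>0. u + v = 1 \<longrightarrow>
     \<psi> (u * x + v * y) \<le> ereal u * \<psi> x + ereal v * \<psi> y)"

definition ereal_lsc :: "(real \<Rightarrow> ereal) \<Rightarrow> bool" where
  "ereal_lsc \<psi> \<longleftrightarrow> (\<forall>x. \<psi> x \<le> Liminf (at x) \<psi>)"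

definition recession_pos :: "(real \<Rightarrow> ereal) \<Rightarrow> ereal" where
  "recession_pos \<psi> = Lim at_top (\<lambda>s. \<psi> s / ereal s)"

definition recession_neg :: "(real \<Rightarrow> ereal) \<Rightarrow> ereal" where
  "recession_neg \<psi> = Lim at_bot (\<lambda>s. \<psi> s / ereal s)"

text \<open>In \<^typ>\<open>ereal\<close>, \<open>\<infinity> * 0 = 0\<close>; for \<open>\<psi> \<ge> 0\<close> all three contributions are nonnegative.\<close>

definition constraint_integral ::
  "'a::euclidean_space set \<Rightarrow> (real \<Rightarrow> ereal) \<Rightarrow> ('a set \<Rightarrow> real) \<Rightarrow> ereal" where
  "constraint_integral \<Omega> \<psi> f =
     ereal_integral (lebesgue_on \<Omega>) (\<lambda>x. \<psi> (ac_density \<Omega> f x))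
     + recession_pos \<psi> * enn2ereal (emeasure (pos_part (borel_on \<Omega>) (sing_part \<Omega> f)) \<Omega>)
     - recession_neg \<psi> * enn2ereal (emeasure (neg_part (borel_on \<Omega>) (sing_part \<Omega> f)) \<Omega>)"

section \<open>The Dirichlet problem with measure data\<close>

definition partial_deriv :: "'a::euclidean_space \<Rightarrow> ('a \<Rightarrow> real) \<Rightarrow> 'a \<Rightarrow> real" where
  "partial_deriv i \<phi> x = frechet_derivative \<phi> (at x) i"

definition gradient :: "('a::euclidean_space \<Rightarrow> real) \<Rightarrow> 'a \<Rightarrow> 'a" where
  "gradient \<phi> x = (\<Sum>i\<in>Basis. partial_deriv i \<phi> x *\<^sub>R i)"

definition laplacian :: "('a::euclidean_space \<Rightarrow> real) \<Rightarrow> 'a \<Rightarrow> real" where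
  "laplacian \<phi> x = (\<Sum>i\<in>Basis. partial_deriv i (partial_deriv i \<phi>) x)"

primrec Ck :: "nat \<Rightarrow> ('a::euclidean_space \<Rightarrow> real) \<Rightarrow> bool" where
  "Ck 0 \<phi> \<longleftrightarrow> continuous_on UNIV \<phi>"
| "Ck (Suc k) \<phi> \<longleftrightarrow> (\<forall>x. \<phi> differentiable at x) \<and> (\<forall>i\<in>Basis. Ck k (partial_deriv i \<phi>))"

definition test_functions :: "'a::euclidean_space set \<Rightarrow> ('a \<Rightarrow> real) set" where
  "test_functions \<Omega> = {\<phi>. (\<forall>k. Ck k \<phi>) \<and> (\<exists>K\<subseteq>\<Omega>. compact K \<and> (\<forall>x. x \<notin> K \<longrightarrow> \<phi> x = 0))}"

text \<open>
  \<open>W\<^sub>0\<^sup>1\<^sup>,\<^sup>q(\<Omega>)\<close>: the closure of the test functions in \<open>W\<^sup>1\<^sup>,\<^sup>q(\<Omega>)\<close>. The \<open>L\<^sup>q\<close>-limit \<open>G\<close> of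
  the gradients is then the weak gradient of \<open>u\<close>.
\<close>

definition W10 :: "real \<Rightarrow> 'a::euclidean_space set \<Rightarrow> ('a \<Rightarrow> real) set" where
  "W10 q \<Omega> = {u. u \<in> borel_measurable (lebesgue_on \<Omega>) \<and>
     (\<exists>G\<in>borel_measurable (lebesgue_on \<Omega>). \<exists>\<phi>::nat \<Rightarrow> 'a \<Rightarrow> real.
        (\<forall>n. \<phi> n \<in> test_functions \<Omega>) \<and>
        (\<lambda>n. \<integral>\<^sup>+x. ennreal (\<bar>\<phi> n x - u x\<bar> powr q) \<partial>lebesgue_on \<Omega>) \<longlonglongrightarrow> 0 \<and>
        (\<lambda>n. \<integral>\<^sup>+x. ennreal (norm (gradient (\<phi> n) x - G x) powr q) \<partial>lebesgue_on \<Omega>) \<longlonglongrightarrow> 0)}"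

text \<open>
  Admissible \<open>v\<close> in Stampacchia's duality: \<open>v \<in> H\<^sub>0\<^sup>1(\<Omega>)\<close> and \<open>-\<Delta>v = g\<close> in the distributional
  sense with \<open>g \<in> L\<^sup>\<infinity>(\<Omega>)\<close>; \<open>v\<close> is taken to be its continuous bounded representative.
\<close>

definition regular_dirichlet_solution ::
  "'a::euclidean_space set \<Rightarrow> ('a \<Rightarrow> real) \<Rightarrow> ('a \<Rightarrow> real) \<Rightarrow> bool" where
  "regular_dirichlet_solution \<Omega> g v \<longleftrightarrow>
     g \<in> borel_measurable (lebesgue_on \<Omega>) \<and> (\<exists>C. AE x in lebesgue_on \<Omega>. \<bar>g x\<bar> \<le> C) \<and>
     v \<in> W10 2 \<Omega> \<and> continuous_on \<Omega> v \<and> bounded (v ` \<Omega>) \<and>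
     (\<forall>\<phi>\<in>test_functions \<Omega>.
        (LINT x|lebesgue_on \<Omega>. v x * (- laplacian \<phi> x)) = (LINT x|lebesgue_on \<Omega>. g x * \<phi> x))"

text \<open>
  The solution of \<open>-\<Delta>u = f\<close>, \<open>u = 0\<close> on the boundary, for a measure \<open>f\<close>. Testing with
  \<open>v \<in> C\<^sub>c\<^sup>\<infinity>(\<Omega>)\<close> gives the equation in the distributional sense. No regularity of the boundary
  is assumed, and then testing only with \<open>C\<^sub>c\<^sup>\<infinity>(\<Omega>)\<close> would not determine \<open>u\<close>: on the punctured
  unit ball in dimension \<open>d > 2\<close>, \<open>\<bar>x\<bar>\<^sup>2\<^sup>-\<^sup>d - 1\<close> is harmonic and lies in \<open>W\<^sub>0\<^sup>1\<^sup>,\<^sup>q\<close> for all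
  \<open>q < d/(d-1)\<close>. The duality formulation determines \<open>u\<close> almost everywhere on every bounded
  domain.
\<close>

definition dirichlet_solution ::
  "'a::euclidean_space set \<Rightarrow> ('a set \<Rightarrow> real) \<Rightarrow> ('a \<Rightarrow> real) \<Rightarrow> bool" where
  "dirichlet_solution \<Omega> f u \<longleftrightarrow>
     (\<forall>q. 1 \<le> q \<longrightarrow> q < DIM('a) / (DIM('a) - 1) \<longrightarrow> u \<in> W10 q \<Omega>) \<and>
     (\<forall>g v. regular_dirichlet_solution \<Omega> g v \<longrightarrow>
        (LINT x|lebesgue_on \<Omega>. u x * g x) = signed_integral (borel_on \<Omega>) f v)"

definition poisson_sol :: "'a::euclidean_space set \<Rightarrow> ('a set \<Rightarrow> real) \<Rightarrow> 'a \<Rightarrow> real" where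
  "poisson_sol \<Omega> f = (SOME u. dirichlet_solution \<Omega> f u)"

section \<open>The cost functional\<close>

text \<open>
  \<open>J\<close> is a functional on all finite signed measures given by \<open>J(f) = \<integral> j(x, u\<^sub>f, f) dx\<close>. The
  formula has a literal meaning when \<open>f\<close> is absolutely continuous, where it is imposed; how the
  integral is extended to measures with a singular part is left open, so that statements about
  all such \<open>J\<close> apply to every choice of extension.
\<close>

definition is_integral_cost ::
  "'a::euclidean_space set \<Rightarrow> ('a \<Rightarrow> real \<Rightarrow> real \<Rightarrow> ereal) \<Rightarrow> (('a set \<Rightarrow> real) \<Rightarrow> ereal) \<Rightarrow> bool"
  where
  "is_integral_cost \<Omega> j J \<longleftrightarrow>
     (\<forall>f\<in>measures_on \<Omega>. sing_part \<Omega> f = (\<lambda>_. 0) \<longrightarrow>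
        J f = ereal_integral (lebesgue_on \<Omega>) (\<lambda>x. j x (poisson_sol \<Omega> f x) (ac_density \<Omega> f x)))"

definition feasible ::
  "'a::euclidean_space set \<Rightarrow> (real \<Rightarrow> ereal) \<Rightarrow> real \<Rightarrow> ('a set \<Rightarrow> real) set" where
  "feasible \<Omega> \<psi> m = {f \<in> measures_on \<Omega>. constraint_integral \<Omega> \<psi> f \<le> ereal m}"

end

theory Submission
  imports Defs "HOL-Probability.Probability"
begin

text \<open>
  The proof is the direct method of the calculus of variations. A minimizing sequence of feasible
  measures has bounded total variation by the linear growth of \<open>\<psi>\<close>, so a subsequence converges
  weakly* to a finite measure; the constraint is weakly* closed, so the limit is feasible; and the
  lower semicontinuity of \<open>J\<close> makes the limit optimal. Three facts carry the argument.

  Duality. A convex lower semicontinuous \<open>\<psi> \<ge> 0\<close> is a supremum of countably many affine minorants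
  \<open>\<alpha> s + \<beta>\<close>, and its recession slopes are the extreme slopes of affine minorants. Therefore
  \<open>\<integral>\<psi>(f) \<le> m\<close> holds if and only if \<open>\<Sum>i. \<alpha> i * f (A i) + \<beta> i * \<bar>A i\<bar> \<le> m\<close> for all finite families of
  minorants and disjoint Borel sets. One direction, \<open>affine_test_le_constraint_integral\<close>, is
  proved with functions \<open>\<phi> i \<ge> 0\<close>, \<open>\<Sum>i. \<phi> i \<le> 1\<close>, in place of the sets; the other one is
  \<open>constraint_integral_le\<close>. The former also bounds the total variation.

  Closedness. For \<open>\<phi> i\<close> in \<open>C\<^sub>0(\<Omega>)\<close> the inequality with functions is preserved by weak* limits,
  and by inner regularity such functions suffice to recover the inequality with sets
  (\<open>constraint_weakstar_closed\<close>).

  Compactness. The bounded set \<open>\<Omega>\<close> lies in the image of a compact set of reals under a continuous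
  map \<open>h\<close>, which has a Borel section. Finite measures on \<open>\<Omega>\<close> are moved to the line along the section,
  where Helly's selection theorem provides a weak limit, and the limit is moved back by \<open>h\<close>
  (\<open>finite_measures_weakstar_compact\<close>). Signed measures are treated through their Jordan parts.
\<close>

section \<open>Jordan and Hahn decomposition of signed measures\<close>

lemma signed_measures_sums:
  assumes "\<nu> \<in> signed_measures M" "range A \<subseteq> sets M" "disjoint_family (A :: nat \<Rightarrow> _)"
  shows "(\<lambda>i. \<nu> (A i)) sums \<nu> (\<Union>i. A i)"
  using assms unfolding signed_measures_def by blast

lemma signed_measures_outside: "\<nu> \<in> signed_measures M \<Longrightarrow> A \<notin> sets M \<Longrightarrow> \<nu> A = 0"
  unfolding signed_measures_def by blast

lemma signed_measures_empty:
  assumes "\<nu> \<in> signed_measures M"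
  shows "\<nu> {} = 0"
proof -
  have "(\<lambda>i::nat. \<nu> {}) sums \<nu> (\<Union>i::nat. {})"
    by (rule signed_measures_sums[OF assms]) (auto simp: disjoint_family_on_def)
  then have "(\<lambda>i::nat. \<nu> {}) \<longlonglongrightarrow> 0" using summable_LIMSEQ_zero sums_summable by blast
  then show ?thesis using LIMSEQ_const_iff by blast
qed

lemma signed_measures_Un:
  assumes "\<nu> \<in> signed_measures M" "A \<in> sets M" "B \<in> sets M" "A \<inter> B = {}"
  shows "\<nu> (A \<union> B) = \<nu> A + \<nu> B"
proof -
  have "(\<lambda>i. \<nu> (binaryset A B i)) sums \<nu> (\<Union>i. binaryset A B i)"
    using assms by (intro signed_measures_sums[OF assms(1)])
      (auto simp: binaryset_def disjoint_family_on_def)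
  moreover have "(\<lambda>i. \<nu> (binaryset A B i)) sums (\<nu> A + \<nu> B)"
    using binaryset_sums[of \<nu> A B] signed_measures_empty[OF assms(1)] by simp
  ultimately show ?thesis using sums_unique2 by (metis UN_binaryset_eq)
qed

lemma signed_measures_Diff:
  assumes "\<nu> \<in> signed_measures M" "A \<in> sets M" "B \<in> sets M" "B \<subseteq> A"
  shows "\<nu> (A - B) = \<nu> A - \<nu> B"
proof -
  have "\<nu> ((A - B) \<union> B) = \<nu> (A - B) + \<nu> B" using assms by (intro signed_measures_Un) auto
  moreover have "(A - B) \<union> B = A" using assms by auto
  ultimately show ?thesis by simp
qed

lemma signed_measures_uminus:
  assumes "\<nu> \<in> signed_measures M"
  shows "(\<lambda>A. - \<nu> A) \<in> signed_measures M"
  using assms unfolding signed_measures_def by (auto intro: sums_minus)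

lemma signed_measures_diff_measure:
  assumes "finite_measure P" "finite_measure Q" "sets P = sets M" "sets Q = sets M"
  shows "(\<lambda>A. measure P A - measure Q A) \<in> signed_measures M"
  unfolding signed_measures_def
proof (safe, goal_cases)
  case (1 A)
  then show ?case using assms(3,4) by (simp add: measure_notin_sets)
next
  case (2 A)
  then show ?case using assms
    by (intro sums_diff finite_measure.finite_measure_UNION) auto
qed

lemma signed_measures_restrict:
  assumes "\<nu> \<in> signed_measures M" "S \<in> sets M"
  shows "(\<lambda>A. if A \<in> sets M then \<nu> (A \<inter> S) else 0) \<in> signed_measures M"
  unfolding signed_measures_def
proof (safe, goal_cases)
  case (2 A)
  have *: "A i \<in> sets M" for i using 2 by auto
  have "(\<lambda>i. \<nu> (A i \<inter> S)) sums \<nu> (\<Union>i. A i \<inter> S)"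
    using 2 * assms(2) by (intro signed_measures_sums[OF assms(1)]) (auto simp: disjoint_family_on_def)
  then show ?case using * by simp
qed simp

text \<open>
  If the values on the subsets of \<open>A\<close> were unbounded, splitting \<open>A\<close> along a subset of large
  value would leave a piece on which they are still unbounded and cut off one whose value is at
  least 1 in modulus; the pieces cut off successively contradict countable additivity.
\<close>

lemma signed_measures_bounded:
  assumes nu: "\<nu> \<in> signed_measures M"
  shows "\<exists>C. \<forall>B\<in>sets M. \<bar>\<nu> B\<bar> \<le> C"
proof (rule ccontr)
  define unb where "unb A \<longleftrightarrow> A \<in> sets M \<and> (\<forall>C. \<exists>B\<in>sets M. B \<subseteq> A \<and> \<bar>\<nu> B\<bar> > C)" for A
  assume "\<nexists>C. \<forall>B\<in>sets M. \<bar>\<nu> B\<bar> \<le> C"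
  then have unb0: "unb (space M)"
    unfolding unb_def by (metis not_le sets.sets_into_space sets.top)
  have split: "\<exists>A'. unb A' \<and> A' \<subseteq> A \<and> 1 \<le> \<bar>\<nu> (A - A')\<bar>" if "unb A" for A
  proof -
    have A: "A \<in> sets M" using that by (simp add: unb_def)
    obtain B where B: "B \<in> sets M" "B \<subseteq> A" "\<bar>\<nu> B\<bar> > \<bar>\<nu> A\<bar> + 1"
      using \<open>unb A\<close> unfolding unb_def by blast
    have d: "\<nu> (A - B) = \<nu> A - \<nu> B" using nu A B by (intro signed_measures_Diff)
    have "unb B \<or> unb (A - B)"
    proof (rule ccontr)
      assume "\<not> (unb B \<or> unb (A - B))"
      then obtain C1 C2 where C: "\<And>X. X \<in> sets M \<Longrightarrow> X \<subseteq> B \<Longrightarrow> \<bar>\<nu> X\<bar> \<le> C1"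
          "\<And>X. X \<in> sets M \<Longrightarrow> X \<subseteq> A - B \<Longrightarrow> \<bar>\<nu> X\<bar> \<le> C2"
        using A B unfolding unb_def by (metis not_le sets.Diff)
      obtain X where X: "X \<in> sets M" "X \<subseteq> A" "\<bar>\<nu> X\<bar> > C1 + C2"
        using \<open>unb A\<close> unfolding unb_def by blast
      have "\<nu> X = \<nu> (X \<inter> B) + \<nu> (X - B)"
        using signed_measures_Un[OF nu, of "X \<inter> B" "X - B"] X B by (auto simp: Int_Diff_Un)
      moreover have "\<bar>\<nu> (X \<inter> B)\<bar> \<le> C1" "\<bar>\<nu> (X - B)\<bar> \<le> C2" using X B by (auto intro!: C)
      ultimately show False using X(3) by linarith
    qed
    then show ?thesis
    proof
      assume "unb B"
      then show ?thesis using B d by (intro exI[of _ B]) auto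
    next
      assume "unb (A - B)"
      moreover have "A - (A - B) = B" using B by auto
      ultimately show ?thesis using B by (intro exI[of _ "A - B"]) auto
    qed
  qed
  then obtain h where h: "\<And>A. unb A \<Longrightarrow> unb (h A) \<and> h A \<subseteq> A \<and> 1 \<le> \<bar>\<nu> (A - h A)\<bar>"
    by metis
  define E where "E n = (h ^^ n) (space M)" for n
  have E: "unb (E n)" for n by (induction n) (auto simp: E_def unb0 h)
  have ES: "E (Suc n) = h (E n)" for n by (simp add: E_def)
  have dec: "decseq E" using h E ES by (intro decseq_SucI) auto
  have "(\<lambda>i. \<nu> (E i - E (Suc i))) sums \<nu> (\<Union>i. E i - E (Suc i))"
  proof (intro signed_measures_sums[OF nu])
    show "range (\<lambda>i. E i - E (Suc i)) \<subseteq> sets M" using E unfolding unb_def by auto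
    have "(E i - E (Suc i)) \<inter> (E j - E (Suc j)) = {}" if "i < j" for i j
      using decseqD[OF dec, of "Suc i" j] that by auto
    then show "disjoint_family (\<lambda>i. E i - E (Suc i))"
      unfolding disjoint_family_on_def by (metis inf_commute nat_neq_iff)
  qed
  then have "(\<lambda>i. \<nu> (E i - E (Suc i))) \<longlonglongrightarrow> 0" by (simp add: sums_summable summable_LIMSEQ_zero)
  then have "\<forall>\<^sub>F i in sequentially. \<bar>\<nu> (E i - E (Suc i))\<bar> < 1"
    by (drule_tac tendstoD[of _ 0 sequentially 1]) (simp_all add: dist_real_def)
  then show False using h E ES by (auto simp: eventually_sequentially not_less[symmetric])
qed

lemma ennreal_sums_le_suminf:
  assumes "f sums (x::real)"
  shows "ennreal x \<le> (\<Sum>i. ennreal (f i))"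
proof -
  have "ennreal (\<Sum>i<n. f i) \<le> (\<Sum>i. ennreal (f i))" for n
  proof -
    have "ennreal (\<Sum>i<n. f i) \<le> ennreal (\<Sum>i<n. max 0 (f i))"
      by (intro ennreal_leI sum_mono) auto
    also have "\<dots> = (\<Sum>i<n. ennreal (max 0 (f i)))" by (rule sum_ennreal[symmetric]) auto
    also have "\<dots> = (\<Sum>i<n. ennreal (f i))" by (intro sum.cong) simp_all
    also have "\<dots> \<le> (\<Sum>i. ennreal (f i))" by (intro sum_le_suminf) auto
    finally show ?thesis .
  qed
  moreover have "(\<lambda>n. ennreal (\<Sum>i<n. f i)) \<longlonglongrightarrow> ennreal x"
    using assms by (intro tendsto_ennrealI) (simp add: sums_def)
  ultimately show ?thesis by (intro LIMSEQ_le_const2[of _ "ennreal x"]) auto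
qed

lemma sets_pos_part [simp]: "sets (pos_part M \<nu>) = sets M"
  and space_pos_part [simp]: "space (pos_part M \<nu>) = space M"
  by (auto simp: pos_part_def)

lemma sets_neg_part [simp]: "sets (neg_part M \<nu>) = sets M"
  and space_neg_part [simp]: "space (neg_part M \<nu>) = space M"
  by (auto simp: neg_part_def)

text \<open>
  Countable additivity of the supremum: it is superadditive on disjoint unions because subsets
  can be chosen independently, and a subset \<open>B\<close> of \<open>\<Union>i. A i\<close> is cut into the pieces \<open>B \<inter> A i\<close>.
\<close>

lemma emeasure_pos_part:
  assumes nu: "\<nu> \<in> signed_measures M" and A: "A \<in> sets M"
  shows "emeasure (pos_part M \<nu>) A = (SUP B\<in>{B \<in> sets M. B \<subseteq> A}. ennreal (\<nu> B))"
proof -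
  define p where "p A = (SUP B\<in>{B \<in> sets M. B \<subseteq> A}. ennreal (\<nu> B))" for A
  have p_upper: "ennreal (\<nu> B) \<le> p A" if "B \<in> sets M" "B \<subseteq> A" for A B
    unfolding p_def using that by (intro SUP_upper) auto
  have p_mono: "p A \<le> p B" if "A \<subseteq> B" for A B
    unfolding p_def using that by (intro SUP_subset_mono) auto
  have super: "p A + p B \<le> p (A \<union> B)" if AB: "A \<inter> B = {}" for A B
  proof -
    have ne: "{C \<in> sets M. C \<subseteq> X} \<noteq> {}" for X by (auto intro!: exI[of _ "{}"])
    have 1: "ennreal (\<nu> C) + ennreal (\<nu> D) \<le> p (A \<union> B)"
      if C: "C \<in> sets M" "C \<subseteq> A" and D: "D \<in> sets M" "D \<subseteq> B" for C D
    proof (cases "\<nu> C \<ge> 0 \<and> \<nu> D \<ge> 0")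
      case True
      have "\<nu> (C \<union> D) = \<nu> C + \<nu> D" using C D AB nu by (intro signed_measures_Un) auto
      then have "ennreal (\<nu> C) + ennreal (\<nu> D) = ennreal (\<nu> (C \<union> D))"
        using True by (simp add: ennreal_plus)
      also have "\<dots> \<le> p (A \<union> B)" using C D by (intro p_upper) auto
      finally show ?thesis .
    next
      case False
      then show ?thesis
        using p_upper[of C "A \<union> B"] p_upper[of D "A \<union> B"] C D le_supI1[of C A B] le_supI2[of D B A]
        by (auto simp: not_le ennreal_neg)
    qed
    have "ennreal (\<nu> C) + p B \<le> p (A \<union> B)" if "C \<in> sets M" "C \<subseteq> A" for C
      unfolding p_def[of B] using 1 that
      by (subst ennreal_SUP_add_right) (auto intro!: SUP_least simp: ne)
    then show ?thesis
      unfolding p_def[of A]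
      by (subst ennreal_SUP_add_left[symmetric]) (auto intro!: SUP_least simp: ne)
  qed
  have "countably_additive (sets M) p"
  proof (rule countably_additiveI)
    fix A :: "nat \<Rightarrow> 'a set"
    assume A: "range A \<subseteq> sets M" "disjoint_family A"
    show "(\<Sum>i. p (A i)) = p (\<Union>i. A i)"
    proof (rule antisym)
      have "(\<Sum>i<n. p (A i)) \<le> p (\<Union>i<n. A i)" for n
      proof (induction n)
        case (Suc n)
        have "(\<Sum>i<Suc n. p (A i)) \<le> p (\<Union>i<n. A i) + p (A n)" using Suc by (simp add: add_right_mono)
        also have "\<dots> \<le> p ((\<Union>i<n. A i) \<union> A n)"
        proof (rule super)
          have "A i \<inter> A n = {}" if "i < n" for i
            using A(2) that by (simp add: disjoint_family_on_def)
          then show "(\<Union>i<n. A i) \<inter> A n = {}" by blast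
        qed
        also have "(\<Union>i<n. A i) \<union> A n = (\<Union>i<Suc n. A i)" by (auto simp: lessThan_Suc)
        finally show ?case .
      qed simp
      then have "(\<Sum>i<n. p (A i)) \<le> p (\<Union>i. A i)" for n
        using p_mono[of "\<Union>i<n. A i" "\<Union>i. A i"] order_trans by blast
      then show "(\<Sum>i. p (A i)) \<le> p (\<Union>i. A i)" by (intro suminf_le_const) auto
    next
      show "p (\<Union>i. A i) \<le> (\<Sum>i. p (A i))"
        unfolding p_def[of "\<Union>i. A i"]
      proof (rule SUP_least)
        fix B assume B: "B \<in> {B \<in> sets M. B \<subseteq> (\<Union>i. A i)}"
        have "(\<lambda>i. \<nu> (B \<inter> A i)) sums \<nu> (\<Union>i. B \<inter> A i)"
          using A B by (intro signed_measures_sums[OF nu]) (auto simp: disjoint_family_on_def)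
        moreover have "(\<Union>i. B \<inter> A i) = B" using B by auto
        ultimately have "ennreal (\<nu> B) \<le> (\<Sum>i. ennreal (\<nu> (B \<inter> A i)))"
          using ennreal_sums_le_suminf by metis
        also have "\<dots> \<le> (\<Sum>i. p (A i))"
          using A B by (intro suminf_le p_upper) auto
        finally show "ennreal (\<nu> B) \<le> (\<Sum>i. p (A i))" .
      qed
    qed
  qed
  moreover have "positive (sets M) p"
  proof -
    have "{B \<in> sets M. B \<subseteq> {}} = {{}}" by auto
    then show ?thesis by (simp add: positive_def p_def signed_measures_empty[OF nu])
  qed
  ultimately have "emeasure (measure_of (space M) (sets M) p) A = p A"
    using A by (intro emeasure_measure_of_sigma) (auto simp: sets.sigma_algebra_axioms)
  then show ?thesis unfolding pos_part_def p_def .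
qed

lemma finite_measure_pos_part:
  assumes nu: "\<nu> \<in> signed_measures M"
  shows "finite_measure (pos_part M \<nu>)"
proof (rule finite_measureI)
  obtain C where C: "\<And>B. B \<in> sets M \<Longrightarrow> \<bar>\<nu> B\<bar> \<le> C" using signed_measures_bounded[OF nu] by blast
  have "emeasure (pos_part M \<nu>) (space M) \<le> ennreal C"
    by (subst emeasure_pos_part[OF nu])
      (auto intro!: SUP_least ennreal_leI order_trans[OF abs_ge_self C])
  then show "emeasure (pos_part M \<nu>) (space (pos_part M \<nu>)) \<noteq> \<infinity>"
    by (metis ennreal_less_top infinity_ennreal_def leD space_pos_part)
qed

lemma finite_measure_neg_part:
  "\<nu> \<in> signed_measures M \<Longrightarrow> finite_measure (neg_part M \<nu>)"
  unfolding neg_part_def by (intro finite_measure_pos_part signed_measures_uminus)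

text \<open>
  Passing from \<open>B \<subseteq> A\<close> to \<open>A - B\<close> turns the supremum of \<open>\<nu> B\<close> into \<open>\<nu> A\<close> plus the supremum
  of \<open>- \<nu> B\<close>.
\<close>

lemma jordan_decomposition:
  assumes nu: "\<nu> \<in> signed_measures M"
  shows "\<nu> A = measure (pos_part M \<nu>) A - measure (neg_part M \<nu>) A"
proof (cases "A \<in> sets M")
  case A: True
  have half: "measure (pos_part M \<mu>) A \<le> \<mu> A + measure (neg_part M \<mu>) A"
    if mu: "\<mu> \<in> signed_measures M" for \<mu>
  proof -
    interpret P: finite_measure "pos_part M \<mu>" using mu by (rule finite_measure_pos_part)
    interpret N: finite_measure "neg_part M \<mu>" using mu by (rule finite_measure_neg_part)
    have neg: "- \<mu> B \<le> measure (neg_part M \<mu>) A" if "B \<in> sets M" "B \<subseteq> A" for B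
    proof -
      have "ennreal (- \<mu> B) \<le> emeasure (neg_part M \<mu>) A"
        unfolding neg_part_def using that
        by (subst emeasure_pos_part[OF signed_measures_uminus[OF mu] A]) (auto intro!: SUP_upper)
      then show ?thesis by (simp add: N.emeasure_eq_measure)
    qed
    have pos: "0 \<le> \<mu> A + measure (neg_part M \<mu>) A" using neg[of A] A by simp
    have "ennreal (measure (pos_part M \<mu>) A) \<le> ennreal (\<mu> A + measure (neg_part M \<mu>) A)"
      unfolding P.emeasure_eq_measure[symmetric]
    proof (subst emeasure_pos_part[OF mu A], intro SUP_least ennreal_leI)
      fix B assume "B \<in> {B \<in> sets M. B \<subseteq> A}"
      then show "\<mu> B \<le> \<mu> A + measure (neg_part M \<mu>) A"
        using neg[of "A - B"] signed_measures_Diff[OF mu A, of B] A by auto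
    qed
    then show ?thesis using pos by simp
  qed
  show ?thesis
    using half[OF nu] half[OF signed_measures_uminus[OF nu]] by (simp add: neg_part_def)
next
  case False
  then show ?thesis by (simp add: signed_measures_outside[OF nu] measure_notin_sets)
qed

text \<open>A set on which one Jordan part dominates the other also separates the signs of \<open>\<nu>\<close>.\<close>

lemma hahn_decomposition:
  assumes nu: "\<nu> \<in> signed_measures M"
  obtains H where "H \<in> sets M"
    "\<And>A. A \<in> sets M \<Longrightarrow> A \<subseteq> H \<Longrightarrow> 0 \<le> \<nu> A" "\<And>A. A \<in> sets M \<Longrightarrow> A \<inter> H = {} \<Longrightarrow> \<nu> A \<le> 0"
    "measure (pos_part M \<nu>) (space M) = \<nu> H"
    "measure (neg_part M \<nu>) (space M) = - \<nu> (space M - H)"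
proof -
  interpret P: finite_measure "pos_part M \<nu>" using nu by (rule finite_measure_pos_part)
  interpret N: finite_measure "neg_part M \<nu>" using nu by (rule finite_measure_neg_part)
  obtain H where H: "H \<in> sets M"
    and H1: "\<And>X. X \<in> sets M \<Longrightarrow> X \<subseteq> H \<Longrightarrow> emeasure (neg_part M \<nu>) X \<le> emeasure (pos_part M \<nu>) X"
    and H2: "\<And>X. X \<in> sets M \<Longrightarrow> X \<inter> H = {} \<Longrightarrow> emeasure (pos_part M \<nu>) X \<le> emeasure (neg_part M \<nu>) X"
    using finite_unsigned_Hahn_decomposition[OF P.finite_measure_axioms N.finite_measure_axioms] by auto
  have pos: "0 \<le> \<nu> A" if "A \<in> sets M" "A \<subseteq> H" for A
    using H1[OF that] jordan_decomposition[OF nu, of A]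
    by (simp add: P.emeasure_eq_measure N.emeasure_eq_measure)
  have neg: "\<nu> A \<le> 0" if "A \<in> sets M" "A \<inter> H = {}" for A
    using H2[OF that] jordan_decomposition[OF nu, of A]
    by (simp add: P.emeasure_eq_measure N.emeasure_eq_measure)
  have "emeasure (pos_part M \<nu>) (space M) = ennreal (\<nu> H)"
  proof (subst emeasure_pos_part[OF nu sets.top], intro antisym SUP_least SUP_upper ennreal_leI)
    fix B assume "B \<in> {B \<in> sets M. B \<subseteq> space M}"
    then have B: "B \<in> sets M" by simp
    have "\<nu> B = \<nu> (B \<inter> H) + \<nu> (B - H)"
      using signed_measures_Un[OF nu, of "B \<inter> H" "B - H"] B H by (auto simp: Int_Diff_Un)
    moreover have "\<nu> H = \<nu> (B \<inter> H) + \<nu> (H - B)"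
      using signed_measures_Un[OF nu, of "B \<inter> H" "H - B"] B H
      by (metis Diff_disjoint Int_Diff_Un inf_assoc inf_commute inf_bot_right sets.Diff sets.Int)
    moreover have "\<nu> (B - H) \<le> 0" "0 \<le> \<nu> (H - B)" using B H
      by (auto intro!: pos neg)
    ultimately show "\<nu> B \<le> \<nu> H" by linarith
  qed (use H sets.sets_into_space in auto)
  then have m: "measure (pos_part M \<nu>) (space M) = \<nu> H"
    using pos[OF H] by (simp add: P.emeasure_eq_measure)
  have "\<nu> (space M - H) = \<nu> (space M) - \<nu> H"
    using H sets.sets_into_space by (intro signed_measures_Diff[OF nu]) auto
  then have "measure (neg_part M \<nu>) (space M) = - \<nu> (space M - H)"
    using m jordan_decomposition[OF nu, of "space M"] by simp
  with that[OF H pos neg m] show thesis by blast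
qed

section \<open>Integration against a signed measure\<close>

definition bounded_measurable :: "'a measure \<Rightarrow> ('a \<Rightarrow> real) set" where
  "bounded_measurable M = {\<phi> \<in> borel_measurable M. \<exists>B. \<forall>x\<in>space M. \<bar>\<phi> x\<bar> \<le> B}"

lemma bounded_measurableI:
  "\<phi> \<in> borel_measurable M \<Longrightarrow> (\<And>x. x \<in> space M \<Longrightarrow> \<bar>\<phi> x\<bar> \<le> B) \<Longrightarrow> \<phi> \<in> bounded_measurable M"
  unfolding bounded_measurable_def by blast

lemma bounded_measurable_add:
  assumes "\<phi> \<in> bounded_measurable M" "\<eta> \<in> bounded_measurable M"
  shows "(\<lambda>x. \<phi> x + \<eta> x) \<in> bounded_measurable M"
proof -
  obtain B C where "\<forall>x\<in>space M. \<bar>\<phi> x\<bar> \<le> B" "\<forall>x\<in>space M. \<bar>\<eta> x\<bar> \<le> C"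
    using assms unfolding bounded_measurable_def by blast
  then have "\<bar>\<phi> x + \<eta> x\<bar> \<le> B + C" if "x \<in> space M" for x
    using that abs_triangle_ineq[of "\<phi> x" "\<eta> x"] by (meson add_mono order_trans)
  then show ?thesis
    using assms by (intro bounded_measurableI[where B="B + C"]) (auto simp: bounded_measurable_def)
qed

lemma bounded_measurable_cmult:
  assumes "\<phi> \<in> bounded_measurable M"
  shows "(\<lambda>x. c * \<phi> x) \<in> bounded_measurable M"
proof -
  obtain B where "\<forall>x\<in>space M. \<bar>\<phi> x\<bar> \<le> B" using assms unfolding bounded_measurable_def by blast
  then show ?thesis
    using assms by (intro bounded_measurableI[where B="\<bar>c\<bar> * B"])
      (auto simp: bounded_measurable_def abs_mult intro!: mult_left_mono)
qed

lemma bounded_measurable_indicator: "A \<in> sets M \<Longrightarrow> indicator A \<in> bounded_measurable M"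
  by (intro bounded_measurableI[where B=1]) (auto simp: indicator_def)

lemma bounded_measurable_sum:
  assumes "\<And>i. i \<in> I \<Longrightarrow> \<phi> i \<in> bounded_measurable M"
  shows "(\<lambda>x. \<Sum>i\<in>I. \<phi> i x) \<in> bounded_measurable M"
  using assms
proof (induction I rule: infinite_finite_induct)
  case (insert i I)
  then show ?case by (simp add: bounded_measurable_add)
qed (auto intro!: bounded_measurableI[where B=0])

lemma bounded_measurable_integrable:
  assumes "finite_measure P" "sets P = sets M" "\<phi> \<in> bounded_measurable M"
  shows "integrable P \<phi>"
proof -
  interpret finite_measure P by fact
  obtain B where B: "\<forall>x\<in>space M. \<bar>\<phi> x\<bar> \<le> B"
    using assms(3) unfolding bounded_measurable_def by blast
  have "\<phi> \<in> borel_measurable P"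
    using assms(2,3) measurable_cong_sets[OF assms(2) refl] unfolding bounded_measurable_def by auto
  then show ?thesis
    using B sets_eq_imp_space_eq[OF assms(2)] by (intro integrable_const_bound[where B=B]) auto
qed

text \<open>
  A signed measure is integrated in several ways: through its Jordan parts, through a Lebesgue
  decomposition, or as a difference of two other positive measures. All of these are linear and
  continuous for uniform convergence on the bounded measurable functions, hence determined by
  the values on indicators, and this makes them comparable.
\<close>

definition integration_functional ::
  "'a measure \<Rightarrow> ('a set \<Rightarrow> real) \<Rightarrow> (('a \<Rightarrow> real) \<Rightarrow> real) \<Rightarrow> bool" where
  "integration_functional M f L \<longleftrightarrow>
     (\<forall>\<phi>\<in>bounded_measurable M. \<forall>\<eta>\<in>bounded_measurable M. L (\<lambda>x. \<phi> x + \<eta> x) = L \<phi> + L \<eta>) \<and>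
     (\<forall>\<phi>\<in>bounded_measurable M. \<forall>c. L (\<lambda>x. c * \<phi> x) = c * L \<phi>) \<and>
     (\<exists>C\<ge>0. \<forall>\<phi>\<in>bounded_measurable M. \<forall>B. (\<forall>x\<in>space M. \<bar>\<phi> x\<bar> \<le> B) \<longrightarrow> \<bar>L \<phi>\<bar> \<le> C * B) \<and>
     (\<forall>A\<in>sets M. L (indicator A) = f A)"

lemma integration_functional_add:
  assumes "integration_functional M f L" "integration_functional M g K"
  shows "integration_functional M (\<lambda>A. f A + g A) (\<lambda>\<phi>. L \<phi> + K \<phi>)"
proof -
  obtain C where C: "C \<ge> 0" "\<And>\<phi> B. \<phi> \<in> bounded_measurable M \<Longrightarrow> \<forall>x\<in>space M. \<bar>\<phi> x\<bar> \<le> B \<Longrightarrow> \<bar>L \<phi>\<bar> \<le> C * B"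
    using assms(1) unfolding integration_functional_def by blast
  obtain D where D: "D \<ge> 0" "\<And>\<phi> B. \<phi> \<in> bounded_measurable M \<Longrightarrow> \<forall>x\<in>space M. \<bar>\<phi> x\<bar> \<le> B \<Longrightarrow> \<bar>K \<phi>\<bar> \<le> D * B"
    using assms(2) unfolding integration_functional_def by blast
  have "\<bar>L \<phi> + K \<phi>\<bar> \<le> (C + D) * B"
    if "\<phi> \<in> bounded_measurable M" "\<forall>x\<in>space M. \<bar>\<phi> x\<bar> \<le> B" for \<phi> B
    using C(2)[OF that] D(2)[OF that] by (simp add: algebra_simps)
  then have "\<exists>E\<ge>0. \<forall>\<phi>\<in>bounded_measurable M. \<forall>B. (\<forall>x\<in>space M. \<bar>\<phi> x\<bar> \<le> B) \<longrightarrow> \<bar>L \<phi> + K \<phi>\<bar> \<le> E * B"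
    using C(1) D(1) by (intro exI[of _ "C + D"]) auto
  then show ?thesis
    using assms unfolding integration_functional_def by (simp add: algebra_simps)
qed

lemma integration_functional_uminus:
  "integration_functional M f L \<Longrightarrow> integration_functional M (\<lambda>A. - f A) (\<lambda>\<phi>. - L \<phi>)"
  unfolding integration_functional_def by simp

lemma integration_functional_diff:
  assumes "integration_functional M f L" "integration_functional M g K"
  shows "integration_functional M (\<lambda>A. f A - g A) (\<lambda>\<phi>. L \<phi> - K \<phi>)"
  using integration_functional_add[OF assms(1) integration_functional_uminus[OF assms(2)]] by simp

lemma integration_functional_plus:
  assumes "integration_functional M f L" "\<phi> \<in> bounded_measurable M" "\<eta> \<in> bounded_measurable M"
  shows "L (\<lambda>x. \<phi> x + \<eta> x) = L \<phi> + L \<eta>"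
  using assms unfolding integration_functional_def by blast

lemma integration_functional_sum:
  assumes L: "integration_functional M f L" and I: "finite I"
    and phi: "\<And>i. i \<in> I \<Longrightarrow> \<phi> i \<in> bounded_measurable M"
  shows "L (\<lambda>x. \<Sum>i\<in>I. c i * \<phi> i x) = (\<Sum>i\<in>I. c i * L (\<phi> i))"
  using I phi
proof (induction I)
  case empty
  have "indicator {} \<in> bounded_measurable M" by (intro bounded_measurable_indicator) simp
  then have "L (\<lambda>x. 0 * indicator {} x) = 0"
    using L unfolding integration_functional_def by (metis mult_zero_left)
  then show ?case by simp
next
  case (insert i I)
  then have "(\<lambda>x. c i * \<phi> i x) \<in> bounded_measurable M" "(\<lambda>x. \<Sum>i\<in>I. c i * \<phi> i x) \<in> bounded_measurable M"
    by (auto intro!: bounded_measurable_cmult bounded_measurable_sum)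
  then have "L (\<lambda>x. c i * \<phi> i x + (\<Sum>i\<in>I. c i * \<phi> i x)) = L (\<lambda>x. c i * \<phi> i x) + L (\<lambda>x. \<Sum>i\<in>I. c i * \<phi> i x)"
    by (rule integration_functional_plus[OF L])
  moreover have "L (\<lambda>x. c i * \<phi> i x) = c i * L (\<phi> i)"
    using L insert unfolding integration_functional_def by auto
  ultimately show ?case using insert by simp
qed

text \<open>Rounding down to multiples of \<open>1/n\<close> approximates a bounded function uniformly by simple ones.\<close>

lemma integration_functional_zero:
  assumes L: "integration_functional M (\<lambda>_. 0) L" and phi: "\<phi> \<in> bounded_measurable M"
  shows "L \<phi> = 0"
proof -
  obtain C where C: "C \<ge> 0"
    "\<And>\<phi> B. \<phi> \<in> bounded_measurable M \<Longrightarrow> \<forall>x\<in>space M. \<bar>\<phi> x\<bar> \<le> B \<Longrightarrow> \<bar>L \<phi>\<bar> \<le> C * B"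
    using L unfolding integration_functional_def by blast
  obtain B where B: "\<And>x. x \<in> space M \<Longrightarrow> \<bar>\<phi> x\<bar> \<le> B"
    using phi unfolding bounded_measurable_def by blast
  have [measurable]: "\<phi> \<in> borel_measurable M" using phi unfolding bounded_measurable_def by blast
  have "\<bar>L \<phi>\<bar> \<le> C * (1 / real (Suc n))" for n
  proof -
    define N where "N = real (Suc n)"
    have N: "N > 0" by (simp add: N_def)
    define K where "K = {\<lfloor>- N * B\<rfloor>..\<lfloor>N * B\<rfloor>}"
    define E where "E k = {x \<in> space M. \<lfloor>N * \<phi> x\<rfloor> = k}" for k
    have E: "E k \<in> sets M" for k unfolding E_def by measurable
    define \<sigma> where "\<sigma> x = (\<Sum>k\<in>K. (of_int k / N) * indicator (E k) x)" for x
    have bmE: "indicator (E k) \<in> bounded_measurable M" for k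
      using E by (intro bounded_measurable_indicator)
    have bms: "\<sigma> \<in> bounded_measurable M"
      unfolding \<sigma>_def using bmE by (intro bounded_measurable_sum bounded_measurable_cmult)
    have "L \<sigma> = (\<Sum>k\<in>K. (of_int k / N) * L (indicator (E k)))"
      unfolding \<sigma>_def using bmE by (intro integration_functional_sum[OF L]) (auto simp: K_def)
    also have "\<dots> = 0" using L E unfolding integration_functional_def by simp
    finally have Ls: "L \<sigma> = 0" .
    have close: "\<bar>\<phi> x + (-1) * \<sigma> x\<bar> \<le> 1 / N" if x: "x \<in> space M" for x
    proof -
      have "- N * B \<le> N * \<phi> x" "N * \<phi> x \<le> N * B"
        using B[OF x] mult_left_mono[of "- B" "\<phi> x" N] N by (auto simp: abs_le_iff)
      then have k: "\<lfloor>N * \<phi> x\<rfloor> \<in> K" unfolding K_def by (auto intro: floor_mono)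
      have "\<sigma> x = (\<Sum>k\<in>K. if k = \<lfloor>N * \<phi> x\<rfloor> then of_int k / N else 0)"
        unfolding \<sigma>_def using x by (intro sum.cong) (auto simp: E_def indicator_def)
      also have "\<dots> = of_int \<lfloor>N * \<phi> x\<rfloor> / N" using k by (simp add: K_def)
      finally have s: "N * (\<phi> x + (-1) * \<sigma> x) = N * \<phi> x - of_int \<lfloor>N * \<phi> x\<rfloor>"
        using N by (simp add: field_simps)
      have "\<bar>N * (\<phi> x + (-1) * \<sigma> x)\<bar> \<le> 1" unfolding s by linarith
      then have "N * \<bar>\<phi> x + (-1) * \<sigma> x\<bar> \<le> 1" using N by (simp add: abs_mult del: mult_minus1)
      then show ?thesis using N by (simp add: field_simps)
    qed
    have "L (\<lambda>x. \<phi> x + (-1) * \<sigma> x) = L \<phi> + L (\<lambda>x. (-1) * \<sigma> x)"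
      by (rule integration_functional_plus[OF L phi bounded_measurable_cmult[OF bms]])
    also have "L (\<lambda>x. (-1) * \<sigma> x) = (-1) * L \<sigma>"
      using L bms unfolding integration_functional_def by blast
    finally have "L (\<lambda>x. \<phi> x + (-1) * \<sigma> x) = L \<phi>" using Ls by simp
    then show ?thesis
      using C(2)[OF bounded_measurable_add[OF phi bounded_measurable_cmult[OF bms]]] close
      unfolding N_def by metis
  qed
  moreover have "(\<lambda>n. C * (1 / real (Suc n))) \<longlonglongrightarrow> C * 0"
    by (intro tendsto_intros LIMSEQ_Suc[OF lim_1_over_n])
  ultimately have "\<bar>L \<phi>\<bar> \<le> C * 0" by (intro LIMSEQ_le_const[of _ "C * 0"]) auto
  then show ?thesis by simp
qed

lemma integration_functional_unique:
  assumes "integration_functional M f L" "integration_functional M f K" "\<phi> \<in> bounded_measurable M"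
  shows "L \<phi> = K \<phi>"
proof -
  have "integration_functional M (\<lambda>_. 0) (\<lambda>\<phi>. L \<phi> - K \<phi>)"
    using integration_functional_diff[OF assms(1,2)] by simp
  from integration_functional_zero[OF this assms(3)] show ?thesis by simp
qed

lemma integration_functional_measure:
  assumes P: "finite_measure P" "sets P = sets M"
  shows "integration_functional M (measure P) (integral\<^sup>L P)"
proof -
  interpret finite_measure P by fact
  have sp: "space P = space M" by (rule sets_eq_imp_space_eq[OF P(2)])
  note int = bounded_measurable_integrable[OF P]
  have "\<bar>integral\<^sup>L P \<phi>\<bar> \<le> measure P (space P) * B"
    if \<phi>: "\<phi> \<in> bounded_measurable M" and B: "\<forall>x\<in>space M. \<bar>\<phi> x\<bar> \<le> B" for \<phi> B
  proof -
    have "\<bar>integral\<^sup>L P \<phi>\<bar> \<le> (LINT x|P. \<bar>\<phi> x\<bar>)" by (rule integral_abs_bound)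
    also have "\<dots> \<le> (LINT x|P. B)"
      using int[OF \<phi>] B sp by (intro integral_mono) auto
    finally show ?thesis by (simp add: mult.commute)
  qed
  then have "\<exists>C\<ge>0. \<forall>\<phi>\<in>bounded_measurable M. \<forall>B. (\<forall>x\<in>space M. \<bar>\<phi> x\<bar> \<le> B) \<longrightarrow> \<bar>integral\<^sup>L P \<phi>\<bar> \<le> C * B"
    by (intro exI[of _ "measure P (space P)"]) auto
  then show ?thesis unfolding integration_functional_def using int P(2) sets.sets_into_space
    by (auto simp: Int_absorb1 sp Int_absorb2)
qed

lemma integration_functional_signed:
  assumes "f \<in> signed_measures M"
  shows "integration_functional M f (signed_integral M f)"
proof -
  have "integration_functional M (\<lambda>A. measure (pos_part M f) A - measure (neg_part M f) A)
     (\<lambda>\<phi>. integral\<^sup>L (pos_part M f) \<phi> - integral\<^sup>L (neg_part M f) \<phi>)"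
    using assms by (intro integration_functional_diff integration_functional_measure
        finite_measure_pos_part finite_measure_neg_part) auto
  moreover have "f = (\<lambda>A. measure (pos_part M f) A - measure (neg_part M f) A)"
    using jordan_decomposition[OF assms] by (intro ext)
  moreover have "signed_integral M f = (\<lambda>\<phi>. integral\<^sup>L (pos_part M f) \<phi> - integral\<^sup>L (neg_part M f) \<phi>)"
    unfolding signed_integral_def[abs_def] ..
  ultimately show ?thesis by simp
qed

lemma sets_borel_on_lebesgue_on:
  "A \<in> sets (borel_on \<Omega>) \<Longrightarrow> A \<in> sets (lebesgue_on \<Omega>)"
  by (auto simp: sets_restrict_space)

lemma borel_on_measurable_lebesgue_on:
  fixes \<Omega> :: "'a::euclidean_space set" and \<phi> :: "'a \<Rightarrow> real"
  assumes "\<phi> \<in> borel_measurable (borel_on \<Omega>)"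
  shows "\<phi> \<in> borel_measurable (lebesgue_on \<Omega>)"
proof (rule measurableI)
  fix A :: "real set" assume "A \<in> sets borel"
  then show "\<phi> -` A \<inter> space (lebesgue_on \<Omega>) \<in> sets (lebesgue_on \<Omega>)"
    using measurable_sets[OF assms] sets_borel_on_lebesgue_on
    by (fastforce simp: space_restrict_space)
qed simp

lemma integrable_bounded_mult:
  fixes \<Omega> :: "'a::euclidean_space set"
  assumes "integrable (lebesgue_on \<Omega>) g" "\<phi> \<in> bounded_measurable (borel_on \<Omega>)"
  shows "integrable (lebesgue_on \<Omega>) (\<lambda>x. \<phi> x * g x)"
proof -
  obtain B where B: "\<forall>x\<in>\<Omega>. \<bar>\<phi> x\<bar> \<le> B"
    using assms unfolding bounded_measurable_def by (auto simp: space_restrict_space)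
  have "integrable (lebesgue_on \<Omega>) (\<lambda>x. B * g x)" using assms by simp
  then show ?thesis
  proof (rule Bochner_Integration.integrable_bound)
    show "(\<lambda>x. \<phi> x * g x) \<in> borel_measurable (lebesgue_on \<Omega>)"
    proof (rule borel_measurable_times)
      show "\<phi> \<in> borel_measurable (lebesgue_on \<Omega>)"
        using assms(2) unfolding bounded_measurable_def by (blast intro: borel_on_measurable_lebesgue_on)
    qed (use assms(1) in auto)
    show "AE x in lebesgue_on \<Omega>. norm (\<phi> x * g x) \<le> norm (B * g x)"
      using B by (intro AE_I2) (auto simp: space_restrict_space abs_mult intro!: mult_right_mono)
  qed
qed

lemma set_integral_lebesgue_on:
  fixes \<Omega> :: "'a::euclidean_space set" and g :: "'a \<Rightarrow> real"
  assumes "\<Omega> \<in> sets borel" "A \<in> sets (borel_on \<Omega>)"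
  shows "(LINT x:A|lebesgue. g x) = (LINT x|lebesgue_on \<Omega>. indicator A x * g x)"
proof -
  have "(LINT x|lebesgue_on \<Omega>. indicator A x * g x)
      = (LINT x|lebesgue. indicator \<Omega> x *\<^sub>R (indicator A x * g x))"
    using assms(1) by (intro integral_restrict_space) auto
  also have "\<dots> = (LINT x:A|lebesgue. g x)"
    unfolding set_lebesgue_integral_def using assms(2)
    by (intro Bochner_Integration.integral_cong) (auto simp: sets_restrict_space indicator_def)
  finally show ?thesis by simp
qed

lemma integration_functional_density:
  fixes \<Omega> :: "'a::euclidean_space set"
  assumes g: "integrable (lebesgue_on \<Omega>) g" and Om: "\<Omega> \<in> sets borel"
  shows "integration_functional (borel_on \<Omega>) (\<lambda>A. LINT x:A|lebesgue. g x)
     (\<lambda>\<phi>. LINT x|lebesgue_on \<Omega>. \<phi> x * g x)"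
proof -
  note int = integrable_bounded_mult[OF g]
  have "\<bar>LINT x|lebesgue_on \<Omega>. \<phi> x * g x\<bar> \<le> (LINT x|lebesgue_on \<Omega>. \<bar>g x\<bar>) * B"
    if \<phi>: "\<phi> \<in> bounded_measurable (borel_on \<Omega>)" and B: "\<forall>x\<in>space (borel_on \<Omega>). \<bar>\<phi> x\<bar> \<le> B" for \<phi> B
  proof -
    have "\<bar>LINT x|lebesgue_on \<Omega>. \<phi> x * g x\<bar> \<le> (LINT x|lebesgue_on \<Omega>. \<bar>\<phi> x * g x\<bar>)"
      by (rule integral_abs_bound)
    also have "\<dots> \<le> (LINT x|lebesgue_on \<Omega>. \<bar>g x\<bar> * B)"
    proof (rule integral_mono)
      show "\<bar>\<phi> x * g x\<bar> \<le> \<bar>g x\<bar> * B" if "x \<in> space (lebesgue_on \<Omega>)" for x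
        using B that
        by (subst mult.commute[of _ B]) (auto simp: space_restrict_space abs_mult intro!: mult_right_mono)
    qed (use int[OF \<phi>] g in auto)
    finally show ?thesis by simp
  qed
  then have "\<exists>C\<ge>0. \<forall>\<phi>\<in>bounded_measurable (borel_on \<Omega>). \<forall>B. (\<forall>x\<in>space (borel_on \<Omega>). \<bar>\<phi> x\<bar> \<le> B) \<longrightarrow>
      \<bar>LINT x|lebesgue_on \<Omega>. \<phi> x * g x\<bar> \<le> C * B"
    by (intro exI[of _ "LINT x|lebesgue_on \<Omega>. \<bar>g x\<bar>"]) auto
  then show ?thesis
    unfolding integration_functional_def
    using int set_integral_lebesgue_on[OF Om, of _ g] by (simp add: algebra_simps mult.assoc)
qed

section \<open>Lebesgue decomposition\<close>

lemma ac_measure_has_density: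
  fixes \<Omega> :: "'a::euclidean_space set"
  assumes fin: "finite_measure \<mu>" and sets: "sets \<mu> = sets (borel_on \<Omega>)" and Om: "\<Omega> \<in> sets borel"
    and ac: "\<And>A. A \<in> sets \<mu> \<Longrightarrow> A \<in> null_sets lborel \<Longrightarrow> measure \<mu> A = 0"
  obtains D :: "'a \<Rightarrow> real" where "integrable lborel D"
    "\<And>A. A \<in> sets (borel_on \<Omega>) \<Longrightarrow> measure \<mu> A = (LINT x|lborel. indicator A x * D x)"
proof -
  interpret \<mu>: finite_measure \<mu> by fact
  have sp: "space \<mu> = \<Omega>" using sets_eq_imp_space_eq[OF sets] by (simp add: space_restrict_space)
  have setsI: "A \<inter> \<Omega> \<in> sets \<mu>" if "A \<in> sets borel" for A
    using that sets by (auto simp: sets_restrict_space)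
  have id: "(\<lambda>x. x) \<in> measurable \<mu> borel"
    using setsI by (intro measurableI) (auto simp: sp)
  define \<nu> where "\<nu> = distr \<mu> borel (\<lambda>x. x)"
  have nu_eq: "emeasure \<nu> A = emeasure \<mu> (A \<inter> \<Omega>)" if "A \<in> sets borel" for A
    using that id by (simp add: \<nu>_def emeasure_distr sp)
  have sets_nu: "sets \<nu> = sets lborel" by (simp add: \<nu>_def)
  have "finite_measure \<nu>" unfolding \<nu>_def using id by (rule \<mu>.finite_measure_distr)
  then interpret \<nu>: finite_measure \<nu> .
  have "absolutely_continuous lborel \<nu>"
    unfolding absolutely_continuous_def
  proof
    fix A :: "'a set" assume A: "A \<in> null_sets lborel"
    then have A': "A \<in> sets borel" by auto
    have "A \<inter> \<Omega> \<in> null_sets lborel" using A Om by (metis null_set_Int2 sets_lborel)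
    then have "measure \<mu> (A \<inter> \<Omega>) = 0" using ac setsI[OF A'] by blast
    then have "emeasure \<nu> A = 0" using nu_eq[OF A'] by (simp add: \<mu>.emeasure_eq_measure)
    then show "A \<in> null_sets \<nu>" using A' sets_nu by auto
  qed
  note ac_nu = this
  obtain D where D: "D \<in> borel_measurable lborel"
    "AE x in lborel. RN_deriv lborel \<nu> x = ennreal (D x)" "\<And>x. 0 \<le> D x"
    using sigma_finite_measure.real_RN_deriv[OF sigma_finite_lborel \<nu>.finite_measure_axioms ac_nu sets_nu] by metis
  have dens: "emeasure \<nu> A = (\<integral>\<^sup>+x. ennreal (indicator A x * D x) \<partial>lborel)" if A: "A \<in> sets borel" for A
  proof -
    have "emeasure \<nu> A = emeasure (density lborel (RN_deriv lborel \<nu>)) A"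
      using sigma_finite_measure.density_RN_deriv[OF sigma_finite_lborel ac_nu sets_nu] by simp
    also have "\<dots> = (\<integral>\<^sup>+x. RN_deriv lborel \<nu> x * indicator A x \<partial>lborel)"
      using A by (intro emeasure_density) auto
    also have "\<dots> = (\<integral>\<^sup>+x. ennreal (indicator A x * D x) \<partial>lborel)"
      using D(2) by (intro nn_integral_cong_AE) (auto split: split_indicator)
    finally show ?thesis .
  qed
  have "integrable lborel D"
  proof (rule integrableI_nonneg)
    have "(\<integral>\<^sup>+x. ennreal (D x) \<partial>lborel) = emeasure \<nu> UNIV" using dens[of UNIV] by simp
    then show "(\<integral>\<^sup>+x. ennreal (D x) \<partial>lborel) < \<infinity>"
      by (simp add: \<nu>.emeasure_eq_measure)
  qed (use D in auto)
  moreover have "measure \<mu> A = (LINT x|lborel. indicator A x * D x)" if A: "A \<in> sets (borel_on \<Omega>)" for A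
  proof -
    have A': "A \<in> sets borel" "A \<inter> \<Omega> = A" using A Om by (auto simp: sets_restrict_space)
    have "(LINT x|lborel. indicator A x * D x) = enn2real (emeasure \<nu> A)"
      using D A' dens[OF A'(1)] by (subst integral_eq_nn_integral) auto
    then show ?thesis using nu_eq[OF A'(1)] A'(2) by (simp add: measure_def)
  qed
  ultimately show thesis by (rule that)
qed

text \<open>
  The masses of Lebesgue-null sets have a supremum, which is attained by the union of a
  maximizing sequence; outside of this union no null set has mass any more.
\<close>

lemma null_set_carrying_singular_part:
  fixes \<Omega> :: "'a::euclidean_space set"
  assumes fin: "finite_measure \<mu>" and sets: "sets \<mu> = sets (borel_on \<Omega>)" and Om: "\<Omega> \<in> sets borel"
  obtains Z where "Z \<in> null_sets lborel"
    "\<And>A. A \<in> sets \<mu> \<Longrightarrow> A \<in> null_sets lborel \<Longrightarrow> measure \<mu> (A - Z) = 0"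
proof -
  interpret \<mu>: finite_measure \<mu> by fact
  define \<A> where "\<A> = {A \<in> sets \<mu>. A \<in> null_sets lborel}"
  define S where "S = (SUP A\<in>\<A>. measure \<mu> A)"
  have ne: "\<A> \<noteq> {}" by (auto simp: \<A>_def intro!: exI[of _ "{}"])
  have bdd: "bdd_above (measure \<mu> ` \<A>)"
    by (intro bdd_aboveI[where M="measure \<mu> (space \<mu>)"]) (auto intro: \<mu>.bounded_measure)
  have "\<exists>A\<in>\<A>. S - 1 / real (Suc n) < measure \<mu> A" for n
  proof -
    have "S - 1 / real (Suc n) < S" by simp
    then show ?thesis unfolding S_def using less_cSUP_iff[OF ne bdd] by blast
  qed
  then obtain A where A: "\<And>n. A n \<in> \<A>" "\<And>n. S - 1 / real (Suc n) < measure \<mu> (A n)" by metis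
  define Z where "Z = (\<Union>n. A n)"
  have Z: "Z \<in> \<A>" using A(1) by (auto simp: \<A>_def Z_def)
  have SZ: "S \<le> measure \<mu> Z"
  proof (rule LIMSEQ_le_const2)
    show "(\<lambda>n. S - 1 / real (Suc n)) \<longlonglongrightarrow> S"
      using tendsto_diff[OF tendsto_const LIMSEQ_Suc[OF lim_1_over_n]] by fastforce
    have "measure \<mu> (A n) \<le> measure \<mu> Z" for n
      using Z by (intro \<mu>.finite_measure_mono) (auto simp: Z_def \<A>_def)
    then show "\<exists>N. \<forall>n\<ge>N. S - 1 / real (Suc n) \<le> measure \<mu> Z"
      using A(2) by (meson less_le_trans less_imp_le)
  qed
  show thesis
  proof (rule that)
    show "Z \<in> null_sets lborel" using Z by (simp add: \<A>_def)
    fix B assume B: "B \<in> sets \<mu>" "B \<in> null_sets lborel"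
    have "Z \<union> B \<in> \<A>" using Z B by (auto simp: \<A>_def)
    then have "measure \<mu> (Z \<union> B) \<le> S" unfolding S_def using bdd by (intro cSUP_upper)
    moreover have "measure \<mu> (Z \<union> B) = measure \<mu> Z + measure \<mu> (B - Z)"
      using Z B \<mu>.finite_measure_Union[of Z "B - Z"] by (simp add: \<A>_def sets.Diff)
    ultimately show "measure \<mu> (B - Z) = 0" using SZ measure_nonneg[of \<mu> "B - Z"] by linarith
  qed
qed

lemma integrable_lborel_lebesgue_on:
  fixes \<Omega> :: "'a::euclidean_space set" and g :: "'a \<Rightarrow> real"
  assumes "integrable lborel g" "\<Omega> \<in> sets borel"
  shows "integrable (lebesgue_on \<Omega>) g"
proof -
  have "integrable (completion lborel) (\<lambda>x. indicator \<Omega> x *\<^sub>R g x)"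
    using assms by (subst integrable_completion) (auto intro!: integrable_mult_indicator simp del: real_scaleR_def)
  then show ?thesis using assms(2) by (subst integrable_restrict_space) auto
qed

text \<open>
  A single null set carries the singular parts of both Jordan parts, since a null set that
  carries the singular part of a measure may be enlarged to another null set.
\<close>

lemma lebesgue_decomposition_exists:
  fixes \<Omega> :: "'a::euclidean_space set"
  assumes f: "f \<in> measures_on \<Omega>" and Om: "\<Omega> \<in> sets borel"
  shows "\<exists>g s. lebesgue_decomposition \<Omega> f g s"
proof -
  let ?M = "borel_on \<Omega>"
  define P where "P = pos_part ?M f"
  define N where "N = neg_part ?M f"
  have P: "finite_measure P" "sets P = sets ?M" and N: "finite_measure N" "sets N = sets ?M"
    using f by (auto simp: P_def N_def finite_measure_pos_part finite_measure_neg_part)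
  obtain Z1 where Z1: "Z1 \<in> null_sets lborel"
    "\<And>A. A \<in> sets P \<Longrightarrow> A \<in> null_sets lborel \<Longrightarrow> measure P (A - Z1) = 0"
    using null_set_carrying_singular_part[OF P Om] by blast
  obtain Z2 where Z2: "Z2 \<in> null_sets lborel"
    "\<And>A. A \<in> sets N \<Longrightarrow> A \<in> null_sets lborel \<Longrightarrow> measure N (A - Z2) = 0"
    using null_set_carrying_singular_part[OF N Om] by blast
  define Z where "Z = Z1 \<union> Z2"
  have Z: "Z \<in> null_sets lborel" using Z1 Z2 by (auto simp: Z_def)
  have ZO: "\<Omega> \<inter> Z \<in> sets ?M" using Z Om by (auto simp: sets_restrict_space)
  have AZ: "A - Z \<in> sets ?M" "A \<inter> Z \<in> sets ?M" "A \<subseteq> \<Omega>" if "A \<in> sets ?M" for A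
  proof -
    show "A \<subseteq> \<Omega>" using sets.sets_into_space[OF that] by (simp add: space_restrict_space)
    then have "A - Z = A - (\<Omega> \<inter> Z)" "A \<inter> Z = A \<inter> (\<Omega> \<inter> Z)" by auto
    then show "A - Z \<in> sets ?M" "A \<inter> Z \<in> sets ?M" using that ZO by (metis sets.Diff, metis sets.Int)
  qed
  have ac: "\<exists>D. integrable lborel D \<and>
      (\<forall>A\<in>sets ?M. measure Q (A - Z) = (LINT x|lborel. indicator A x * (D x::real)))"
    if Q: "finite_measure Q" "sets Q = sets ?M"
      and 0: "\<And>A. A \<in> sets Q \<Longrightarrow> A \<in> null_sets lborel \<Longrightarrow> measure Q (A - Z) = 0" for Q
  proof -
    interpret Q: finite_measure Q by fact
    have spQ: "space Q = \<Omega>" using sets_eq_imp_space_eq[OF Q(2)] by (simp add: space_restrict_space)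
    have C: "\<Omega> - Z \<in> sets Q" using AZ(1)[of \<Omega>] Q(2) sets.top[of ?M] by (simp add: space_restrict_space)
    define R where "R = density Q (indicator (\<Omega> - Z))"
    have eR: "emeasure R A = emeasure Q (A - Z)" if A: "A \<in> sets ?M" for A
    proof -
      have "emeasure R A = emeasure Q ((\<Omega> - Z) \<inter> A)"
        unfolding R_def using C A Q(2) by (subst emeasure_density) (auto simp: nn_integral_indicator simp flip: indicator_inter_arith)
      also have "(\<Omega> - Z) \<inter> A = A - Z" using AZ(3)[OF A] by auto
      finally show ?thesis .
    qed
    have sR: "sets R = sets ?M" by (simp add: R_def Q)
    have "finite_measure R"
      using eR[of \<Omega>] sets.top[of ?M]
      by (intro finite_measureI) (simp add: R_def spQ space_restrict_space Q.emeasure_eq_measure)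
    moreover have "measure R A = 0" if "A \<in> sets R" "A \<in> null_sets lborel" for A
      using 0 that eR sR Q(2) by (simp add: measure_def)
    ultimately obtain D where "integrable lborel D"
      "\<And>A. A \<in> sets ?M \<Longrightarrow> measure R A = (LINT x|lborel. indicator A x * D x)"
      using ac_measure_has_density[OF _ sR Om] by blast
    then show ?thesis using eR by (intro exI[of _ D]) (simp add: measure_def)
  qed
  have small: "measure Q (A - Z) = 0"
    if "finite_measure Q" "sets Q = sets ?M" "A \<in> sets Q" "W \<subseteq> Z" "W \<in> null_sets lborel"
      "measure Q (A - W) = 0" for Q A W
  proof -
    have WO: "A - W \<in> sets ?M"
    proof -
      have "\<Omega> \<inter> W \<in> sets ?M" using that Om by (auto simp: sets_restrict_space)
      moreover have "A - W = A - (\<Omega> \<inter> W)" using AZ(3)[of A] that by auto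
      ultimately show ?thesis using that by (metis sets.Diff)
    qed
    have "measure Q (A - Z) \<le> measure Q (A - W)"
      using that WO AZ by (intro finite_measure.finite_measure_mono) auto
    then show ?thesis using that by (simp add: antisym)
  qed
  have "measure P (A - Z) = 0" if "A \<in> sets P" "A \<in> null_sets lborel" for A
    using small[OF P, of A Z1] Z1 that by (simp add: Z_def)
  with ac[OF P] obtain D where D: "integrable lborel D"
    "\<And>A. A \<in> sets ?M \<Longrightarrow> measure P (A - Z) = (LINT x|lborel. indicator A x * (D x::real))" by blast
  have "measure N (A - Z) = 0" if "A \<in> sets N" "A \<in> null_sets lborel" for A
    using small[OF N, of A Z2] Z2 that by (simp add: Z_def)
  with ac[OF N] obtain E where E: "integrable lborel E"
    "\<And>A. A \<in> sets ?M \<Longrightarrow> measure N (A - Z) = (LINT x|lborel. indicator A x * (E x::real))" by blast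
  define g where "g x = D x - E x" for x
  define s where "s A = (if A \<in> sets ?M then f (A \<inter> (\<Omega> \<inter> Z)) else 0)" for A
  have g: "integrable lborel g" unfolding g_def using D(1) E(1) by simp
  have "f A = (LINT x:A|lebesgue. g x) + s A" if A: "A \<in> sets ?M" for A
  proof -
    have Ab: "A \<in> sets borel" using A Om by (auto simp: sets_restrict_space)
    have "f (A - Z) = measure P (A - Z) - measure N (A - Z)"
      unfolding P_def N_def by (rule jordan_decomposition[OF f])
    also have "\<dots> = (LINT x|lborel. indicator A x * D x) - (LINT x|lborel. indicator A x * E x)"
      using D(2)[OF A] E(2)[OF A] by simp
    also have "\<dots> = (LINT x|lborel. indicator A x * D x - indicator A x * E x)"
      using integrable_mult_indicator[of A lborel D] integrable_mult_indicator[of A lborel E] D(1) E(1) Ab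
      by (subst Bochner_Integration.integral_diff) simp_all
    also have "\<dots> = (LINT x|lborel. indicator A x * g x)" by (simp add: g_def right_diff_distrib)
    also have "\<dots> = (LINT x:A|lebesgue. g x)"
      unfolding set_lebesgue_integral_def using g Ab by (subst integral_completion) simp_all
    finally have "f (A - Z) = (LINT x:A|lebesgue. g x)" .
    moreover have "A \<inter> (\<Omega> \<inter> Z) = A \<inter> Z" using AZ(3)[OF A] by auto
    moreover have "f ((A - Z) \<union> (A \<inter> Z)) = f (A - Z) + f (A \<inter> Z)"
      using AZ[OF A] by (intro signed_measures_Un[OF f]) auto
    moreover have "(A - Z) \<union> (A \<inter> Z) = A" by auto
    ultimately show ?thesis using A by (simp add: s_def)
  qed
  moreover have "s \<in> measures_on \<Omega>"
    unfolding s_def by (rule signed_measures_restrict[OF f ZO])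
  moreover have "s A = 0" if "A \<inter> Z = {}" for A
  proof -
    have "A \<inter> (\<Omega> \<inter> Z) = {}" using that by auto
    then show ?thesis by (simp add: s_def signed_measures_empty[OF f])
  qed
  ultimately have "lebesgue_decomposition \<Omega> f g s"
    unfolding lebesgue_decomposition_def using Z integrable_lborel_lebesgue_on[OF g Om] by blast
  then show ?thesis by blast
qed

lemma set_integral_null_set:
  fixes g :: "'a::euclidean_space \<Rightarrow> real"
  assumes "A \<in> null_sets lborel"
  shows "(LINT x:A|lebesgue. g x) = 0"
proof -
  have "AE x in lebesgue. x \<notin> A" using assms by (intro AE_not_in null_sets_completionI)
  then have "AE x in lebesgue. indicator A x *\<^sub>R g x = 0" by eventually_elim simp
  then show ?thesis unfolding set_lebesgue_integral_def by (rule integral_eq_zero_AE)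
qed

text \<open>
  On the union of the two exceptional null sets the densities contribute nothing, and off it
  both singular parts vanish.
\<close>

lemma lebesgue_decomposition_unique:
  fixes \<Omega> :: "'a::euclidean_space set"
  assumes 1: "lebesgue_decomposition \<Omega> f g1 s1" and 2: "lebesgue_decomposition \<Omega> f g2 s2"
    and Om: "\<Omega> \<in> sets borel"
  shows "s1 = s2"
proof
  fix A
  obtain N1 where N1: "N1 \<in> null_sets lborel" "\<And>A. A \<in> sets (borel_on \<Omega>) \<Longrightarrow> A \<inter> N1 = {} \<Longrightarrow> s1 A = 0"
    using 1 unfolding lebesgue_decomposition_def by blast
  obtain N2 where N2: "N2 \<in> null_sets lborel" "\<And>A. A \<in> sets (borel_on \<Omega>) \<Longrightarrow> A \<inter> N2 = {} \<Longrightarrow> s2 A = 0"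
    using 2 unfolding lebesgue_decomposition_def by blast
  have s: "s1 \<in> measures_on \<Omega>" "s2 \<in> measures_on \<Omega>"
    using 1 2 unfolding lebesgue_decomposition_def by blast+
  define N where "N = \<Omega> \<inter> (N1 \<union> N2)"
  have N: "N \<in> null_sets lborel" unfolding N_def using N1 N2 Om by (intro null_set_Int1 null_sets.Un) auto
  then have N: "N \<in> sets borel" "N \<in> null_sets lborel" by auto
  show "s1 A = s2 A"
  proof (cases "A \<in> sets (borel_on \<Omega>)")
    case A: True
    then have Ab: "A \<in> sets borel" "A \<subseteq> \<Omega>" using Om by (auto simp: sets_restrict_space)
    have NA: "A \<inter> N \<in> sets (borel_on \<Omega>)" "A - N \<in> sets (borel_on \<Omega>)"
      using Ab N Om by (auto simp: sets_restrict_space_iff)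
    have null: "A \<inter> N \<in> null_sets lborel" using N Ab by (simp add: null_set_Int1)
    have "s A = s (A \<inter> N)" if "s \<in> measures_on \<Omega>" "s (A - N) = 0" for s
      using signed_measures_Un[OF that(1) NA] that(2) by (simp add: Int_Diff_Un Int_Diff_disjoint)
    moreover have "s1 (A - N) = 0" "s2 (A - N) = 0"
      using NA Ab by (auto intro!: N1(2) N2(2) simp: N_def)
    ultimately have "s1 A = s1 (A \<inter> N)" "s2 A = s2 (A \<inter> N)" using s by auto
    moreover have "f (A \<inter> N) = s1 (A \<inter> N)" "f (A \<inter> N) = s2 (A \<inter> N)"
      using 1 2 NA(1) set_integral_null_set[OF null]
      unfolding lebesgue_decomposition_def by auto
    ultimately show ?thesis by simp
  next
    case False
    then show ?thesis using s by (simp add: signed_measures_outside)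
  qed
qed

lemma lebesgue_decomposition_parts:
  fixes \<Omega> :: "'a::euclidean_space set"
  assumes f: "f \<in> measures_on \<Omega>" and Om: "\<Omega> \<in> sets borel"
  shows "lebesgue_decomposition \<Omega> f (ac_density \<Omega> f) (sing_part \<Omega> f)"
proof -
  have "\<exists>s. lebesgue_decomposition \<Omega> f (ac_density \<Omega> f) s"
    unfolding ac_density_def using lebesgue_decomposition_exists[OF assms] by (rule someI_ex)
  then obtain s where s: "lebesgue_decomposition \<Omega> f (ac_density \<Omega> f) s" by blast
  have "sing_part \<Omega> f = s"
    unfolding sing_part_def using s lebesgue_decomposition_unique[OF _ _ Om] by (intro the_equality) blast+
  with s show ?thesis by simp
qed

text \<open>A Borel representative of the density has Borel level sets, on which \<open>f\<close> can be evaluated.\<close>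

lemma borel_ac_density:
  fixes \<Omega> :: "'a::euclidean_space set"
  assumes f: "f \<in> measures_on \<Omega>" and Om: "\<Omega> \<in> sets borel"
  obtains g where "g \<in> borel_measurable borel" "AE x in lebesgue_on \<Omega>. ac_density \<Omega> f x = g x"
    "integrable (lebesgue_on \<Omega>) g"
    "\<And>A. A \<in> sets (borel_on \<Omega>) \<Longrightarrow>
      f A = (LINT x|lebesgue_on \<Omega>. indicator A x * g x) + sing_part \<Omega> f A"
proof -
  let ?h = "ac_density \<Omega> f"
  have dec: "lebesgue_decomposition \<Omega> f ?h (sing_part \<Omega> f)"
    by (rule lebesgue_decomposition_parts[OF assms])
  have h: "integrable (lebesgue_on \<Omega>) ?h" using dec unfolding lebesgue_decomposition_def by blast
  then have "(\<lambda>x. indicator \<Omega> x *\<^sub>R ?h x) \<in> borel_measurable (completion lborel)"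
    using Om by (subst (asm) integrable_restrict_space) auto
  then obtain g where g: "g \<in> borel_measurable lborel" "AE x in lborel. indicator \<Omega> x *\<^sub>R ?h x = g x"
    using completion_ex_borel_measurable_real by blast
  have "AE x in lebesgue. x \<in> \<Omega> \<longrightarrow> ?h x = g x"
    using AE_completion[OF g(2)] by eventually_elim (auto simp: indicator_def)
  then have ae: "AE x in lebesgue_on \<Omega>. ?h x = g x"
    using Om by (subst AE_restrict_space_iff) auto
  have gm: "g \<in> borel_measurable (lebesgue_on \<Omega>)"
    using g(1) by (intro measurable_restrict_space1 measurable_completion) auto
  have gi: "integrable (lebesgue_on \<Omega>) g"
    using h ae gm integrable_cong_AE[of ?h "lebesgue_on \<Omega>" g] by auto
  have "f A = (LINT x|lebesgue_on \<Omega>. indicator A x * g x) + sing_part \<Omega> f A"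
    if A: "A \<in> sets (borel_on \<Omega>)" for A
  proof -
    have "f A = (LINT x|lebesgue_on \<Omega>. indicator A x * ?h x) + sing_part \<Omega> f A"
      using dec A set_integral_lebesgue_on[OF Om A, of ?h] unfolding lebesgue_decomposition_def by simp
    also have "(LINT x|lebesgue_on \<Omega>. indicator A x * ?h x) = (LINT x|lebesgue_on \<Omega>. indicator A x * g x)"
    proof (rule integral_cong_AE)
      have "A \<in> sets (lebesgue_on \<Omega>)" using A by (rule sets_borel_on_lebesgue_on)
      then show "(\<lambda>x. indicator A x * ?h x) \<in> borel_measurable (lebesgue_on \<Omega>)"
        "(\<lambda>x. indicator A x * g x) \<in> borel_measurable (lebesgue_on \<Omega>)" using h gm by auto
      show "AE x in lebesgue_on \<Omega>. indicator A x * ?h x = indicator A x * g x"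
        using ae by eventually_elim simp
    qed
    finally show ?thesis .
  qed
  with that[OF _ ae gi] g(1) show thesis by simp
qed

section \<open>Affine minorants of the constraint integrand\<close>

definition affine_minorants :: "(real \<Rightarrow> ereal) \<Rightarrow> (real \<times> real) set" where
  "affine_minorants \<psi> = {(\<alpha>, \<beta>). \<forall>s. ereal (\<alpha> * s + \<beta>) \<le> \<psi> s}"

lemma affine_minorantsD: "(\<alpha>, \<beta>) \<in> affine_minorants \<psi> \<Longrightarrow> ereal (\<alpha> * s + \<beta>) \<le> \<psi> s"
  unfolding affine_minorants_def by blast

lemma zero_affine_minorant: "\<forall>s. \<psi> s \<ge> 0 \<Longrightarrow> (0, 0) \<in> affine_minorants \<psi>"
  by (simp add: affine_minorants_def zero_ereal_def[symmetric])

lemma convex_epigraph: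
  assumes "ereal_convex \<psi>"
  shows "convex {(x, r). \<psi> x \<le> ereal r}"
proof (rule convexI)
  fix p q and u v :: real
  assume pq: "p \<in> {(x, r). \<psi> x \<le> ereal r}" "q \<in> {(x, r). \<psi> x \<le> ereal r}"
    and uv: "0 \<le> u" "0 \<le> v" "u + v = 1"
  obtain x r y r' where p: "p = (x, r)" and q: "q = (y, r')" by (cases p, cases q)
  have "\<psi> (u * x + v * y) \<le> ereal u * \<psi> x + ereal v * \<psi> y"
    using assms uv unfolding ereal_convex_def by blast
  also have "\<dots> \<le> ereal u * ereal r + ereal v * ereal r'"
    using pq uv by (intro add_mono ereal_mult_left_mono) (auto simp: p q)
  finally show "u *\<^sub>R p + v *\<^sub>R q \<in> {(x, r). \<psi> x \<le> ereal r}" by (simp add: p q)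
qed

lemma closed_epigraph:
  assumes "ereal_lsc \<psi>"
  shows "closed {(x, r). \<psi> x \<le> ereal r}"
  unfolding closed_sequential_limits
proof (intro allI impI, elim conjE)
  fix z l assume z: "\<forall>n. z n \<in> {(x, r). \<psi> x \<le> ereal r}" "z \<longlonglongrightarrow> l"
  obtain x r where l: "l = (x, r)" by (cases l)
  have "\<psi> x \<le> ereal r"
  proof (rule ccontr)
    assume "\<not> \<psi> x \<le> ereal r"
    then have "ereal r < \<psi> x" by simp
    from ereal_dense2[OF this] obtain c where "ereal r < ereal c" "ereal c < \<psi> x" by blast
    then have c: "r < c" "ereal c < \<psi> x" by auto
    have "ereal c < Liminf (at x) \<psi>" using assms c(2) unfolding ereal_lsc_def by (metis less_le_trans)
    then have "eventually (\<lambda>y. ereal c < \<psi> y) (at x)" by (rule less_LiminfD)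
    then have 1: "eventually (\<lambda>y. ereal c < \<psi> y) (nhds x)"
      using c(2) unfolding eventually_at_filter eventually_nhds by auto
    have "(\<lambda>n. fst (z n)) \<longlonglongrightarrow> x" "(\<lambda>n. snd (z n)) \<longlonglongrightarrow> r"
      using tendsto_fst[OF z(2)] tendsto_snd[OF z(2)] l by auto
    then have "eventually (\<lambda>n. ereal c < \<psi> (fst (z n))) sequentially" "eventually (\<lambda>n. snd (z n) < c) sequentially"
      using eventually_compose_filterlim[OF 1, of "\<lambda>n. fst (z n)" sequentially] order_tendstoD(2)[OF _ c(1)]
      by blast+
    then have "eventually (\<lambda>n. False) sequentially"
    proof eventually_elim
      case (elim n)
      have "\<psi> (fst (z n)) \<le> ereal (snd (z n))" using z(1) by (auto simp: case_prod_beta)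
      then have "ereal c < ereal (snd (z n))" using elim(1) by (rule less_le_trans[rotated])
      then show ?case using elim(2) by simp
    qed
    then show False by simp
  qed
  then show "l \<in> {(x, r). \<psi> x \<le> ereal r}" by (simp add: l)
qed

text \<open>
  A point strictly below the graph is separated from the epigraph by a line. If the line is
  vertical, the point lies outside the effective domain, and large multiples of the separating
  functional are affine minorants because \<open>\<psi> \<ge> 0\<close>.
\<close>

lemma affine_minorant_above:
  assumes nonneg: "\<forall>s. \<psi> s \<ge> 0" and conv: "ereal_convex \<psi>" and lsc: "ereal_lsc \<psi>"
    and t: "ereal t < \<psi> s"
  shows "\<exists>\<alpha> \<beta>. (\<alpha>, \<beta>) \<in> affine_minorants \<psi> \<and> t < \<alpha> * s + \<beta>"
proof (cases "\<exists>x. \<psi> x < \<infinity>")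
  case False
  then have "(0, t + 1) \<in> affine_minorants \<psi>" by (auto simp: affine_minorants_def)
  then show ?thesis by (intro exI[of _ 0] exI[of _ "t + 1"]) auto
next
  case True
  then obtain x0 where "\<psi> x0 < \<infinity>" by blast
  with nonneg obtain y0 where x0: "\<psi> x0 = ereal y0" by (cases "\<psi> x0") (auto dest: spec[of _ x0])
  let ?E = "{(x, r). \<psi> x \<le> ereal r}"
  have "(s, t) \<notin> ?E" using t by auto
  then obtain z b where zb: "inner z (s, t) < b" "\<forall>p\<in>?E. inner z p > b"
    using separating_hyperplane_closed_point[OF convex_epigraph[OF conv] closed_epigraph[OF lsc]] by blast
  obtain p q where z: "z = (p, q)" by (cases z)
  have below: "p * s + q * t < b" using zb(1) by (simp add: z)
  have above: "b < p * x + q * r" if "\<psi> x \<le> ereal r" for x r using zb(2) that by (auto simp: z)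
  have q: "q \<ge> 0"
  proof (rule ccontr)
    assume "\<not> q \<ge> 0"
    then have q: "q < 0" by simp
    \<comment> \<open>A point of the epigraph so high that it lies on the wrong side of the line.\<close>
    define r where "r = max y0 ((b - p * x0) / q)"
    have "q * r \<le> q * ((b - p * x0) / q)" using q by (intro mult_left_mono_neg) (auto simp: r_def)
    then have "p * x0 + q * r \<le> b" using q by simp
    moreover have "\<psi> x0 \<le> ereal r" by (simp add: x0 r_def)
    ultimately show False using above by force
  qed
  show ?thesis
  proof (cases "q = 0")
    case True
    \<comment> \<open>The multiple for which the value at \<open>s\<close> exceeds \<open>t\<close>.\<close>
    define k where "k = (\<bar>t\<bar> + 1) / (b - p * s)"
    have d: "b - p * s > 0" using below True by simp
    have "(- k * p, k * b) \<in> affine_minorants \<psi>"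
      unfolding affine_minorants_def
    proof (clarify)
      fix x
      show "ereal (- k * p * x + k * b) \<le> \<psi> x"
      proof (cases "\<psi> x")
        case (real r)
        then have "b < p * x" using above[of x r] True by simp
        then have "k * (b - p * x) \<le> 0" using d by (intro mult_nonneg_nonpos) (auto simp: k_def)
        then have "- k * p * x + k * b \<le> 0" by (simp add: algebra_simps)
        then have "ereal (- k * p * x + k * b) \<le> 0" by simp
        also have "0 \<le> \<psi> x" using nonneg by simp
        finally show ?thesis .
      qed (use nonneg[rule_format, of x] in auto)
    qed
    moreover have "- k * p * s + k * b = \<bar>t\<bar> + 1"
    proof -
      have "- k * p * s + k * b = k * (b - p * s)" by (simp add: algebra_simps)
      then show ?thesis using d by (simp add: k_def)
    qed
    ultimately show ?thesis by (intro exI[of _ "- k * p"] exI[of _ "k * b"]) linarith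
  next
    case False
    then have q: "q > 0" using q by simp
    have "(- p / q, b / q) \<in> affine_minorants \<psi>"
      unfolding affine_minorants_def
    proof (clarify)
      fix x
      show "ereal (- p / q * x + b / q) \<le> \<psi> x"
      proof (cases "\<psi> x")
        case (real r)
        then have "b < p * x + q * r" using above[of x r] by simp
        then show ?thesis using q real by (simp add: field_simps)
      qed (use nonneg[rule_format, of x] in auto)
    qed
    moreover have "t < - p / q * s + b / q" using below q by (simp add: field_simps)
    ultimately show ?thesis by blast
  qed
qed

text \<open>
  The value of an affine function at \<open>s\<close> depends continuously on its two coefficients, so a
  countable dense set of minorants has the same supremum as all of them. The zero minorant is
  put first in order that the partial suprema be nonnegative.
\<close>

lemma convex_lsc_eq_countable_SUP_affine:
  assumes nonneg: "\<forall>s. \<psi> s \<ge> 0" and conv: "ereal_convex \<psi>" and lsc: "ereal_lsc \<psi>"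
  obtains \<alpha> \<beta> :: "nat \<Rightarrow> real" where "\<alpha> 0 = 0" "\<beta> 0 = 0" "\<And>n. (\<alpha> n, \<beta> n) \<in> affine_minorants \<psi>"
    "\<And>s. \<psi> s = (SUP n. ereal (\<alpha> n * s + \<beta> n))"
proof -
  obtain T where T: "countable T" "T \<subseteq> affine_minorants \<psi>" "affine_minorants \<psi> \<subseteq> closure T"
    by (rule separable)
  have ne: "T \<noteq> {}" using T zero_affine_minorant[OF nonneg] by auto
  define e where "e n = (case n of 0 \<Rightarrow> (0, 0) | Suc k \<Rightarrow> from_nat_into T k)" for n
  define \<alpha> where "\<alpha> n = fst (e n)" for n
  define \<beta> where "\<beta> n = snd (e n)" for n
  have e: "e n \<in> affine_minorants \<psi>" for n
    using zero_affine_minorant[OF nonneg] subsetD[OF T(2) from_nat_into[OF ne]]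
    unfolding e_def by (cases n) simp_all
  then have mem: "(\<alpha> n, \<beta> n) \<in> affine_minorants \<psi>" for n by (simp add: \<alpha>_def \<beta>_def)
  have "\<psi> s = (SUP n. ereal (\<alpha> n * s + \<beta> n))" for s
  proof (rule antisym)
    show "\<psi> s \<le> (SUP n. ereal (\<alpha> n * s + \<beta> n))"
    proof (rule ccontr)
      assume "\<not> \<psi> s \<le> (SUP n. ereal (\<alpha> n * s + \<beta> n))"
      then have "(SUP n. ereal (\<alpha> n * s + \<beta> n)) < \<psi> s" by (simp only: not_le)
      from ereal_dense2[OF this]
      obtain t where t: "(SUP n. ereal (\<alpha> n * s + \<beta> n)) < ereal t" "ereal t < \<psi> s" by blast
      obtain a b where ab: "(a, b) \<in> affine_minorants \<psi>" "t < a * s + b"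
        using affine_minorant_above[OF assms t(2)] by blast
      define U where "U = {z :: real \<times> real. t < fst z * s + snd z}"
      have "open U" unfolding U_def by (intro open_Collect_less continuous_intros)
      moreover have "(a, b) \<in> U" "(a, b) \<in> closure T" using ab T(3) by (auto simp: U_def)
      ultimately obtain z where z: "z \<in> T" "z \<in> U"
        using open_Int_closure_eq_empty[of U T] by blast
      obtain k where "from_nat_into T k = z" using from_nat_into_surj[OF T(1) z(1)] by blast
      then have "e (Suc k) = z" by (simp add: e_def)
      then have "ereal t < ereal (\<alpha> (Suc k) * s + \<beta> (Suc k))"
        using z(2) by (simp add: \<alpha>_def \<beta>_def U_def)
      also have "\<dots> \<le> (SUP n. ereal (\<alpha> n * s + \<beta> n))" by (intro SUP_upper) auto
      finally show False using t(1) by simp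
    qed
    show "(SUP n. ereal (\<alpha> n * s + \<beta> n)) \<le> \<psi> s"
      using affine_minorantsD[OF mem] by (intro SUP_least)
  qed
  moreover have "\<alpha> 0 = 0" "\<beta> 0 = 0" by (simp_all add: \<alpha>_def \<beta>_def e_def)
  ultimately show thesis using that mem by blast
qed

text \<open>
  The recession limit at \<open>+\<infinity>\<close>, in a form that interacts directly with affine minorants; the
  limit at \<open>-\<infinity>\<close> is obtained by reflecting \<open>\<psi>\<close>.
\<close>

definition sup_slope :: "(real \<Rightarrow> ereal) \<Rightarrow> ereal" where
  "sup_slope \<psi> = (SUP (\<alpha>, \<beta>)\<in>affine_minorants \<psi>. ereal \<alpha>)"

lemma affine_minorant_slope_le: "(\<alpha>, \<beta>) \<in> affine_minorants \<psi> \<Longrightarrow> ereal \<alpha> \<le> sup_slope \<psi>"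
  unfolding sup_slope_def by (rule SUP_upper2[where i="(\<alpha>, \<beta>)"]) auto

text \<open>
  If \<open>\<psi> s \<ge> t' s\<close> for arbitrarily large \<open>s\<close> and \<open>t < t'\<close>, then a chord of slope at least \<open>t\<close>
  starts at a point of the effective domain. By convexity the graph stays above its prolongation
  to the right, and to the left of its right endpoint \<open>\<psi> \<ge> 0\<close> suffices to make \<open>t\<close> the slope of
  an affine minorant.
\<close>

lemma recession_pos_eq_sup_slope:
  assumes nonneg: "\<forall>s. \<psi> s \<ge> 0" and conv: "ereal_convex \<psi>" and dom: "\<psi> x0 < \<infinity>"
  shows "((\<lambda>s. \<psi> s / ereal s) \<longlongrightarrow> sup_slope \<psi>) at_top" "recession_pos \<psi> = sup_slope \<psi>"
proof -
  obtain y0 where x0: "\<psi> x0 = ereal y0"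
    using dom nonneg[rule_format, of x0] by (cases "\<psi> x0") auto
  show lim: "((\<lambda>s. \<psi> s / ereal s) \<longlongrightarrow> sup_slope \<psi>) at_top"
  proof (rule order_tendstoI)
    fix a assume "a < sup_slope \<psi>"
    then obtain \<alpha> \<beta> where m: "(\<alpha>, \<beta>) \<in> affine_minorants \<psi>" "a < ereal \<alpha>"
      unfolding sup_slope_def less_SUP_iff by auto
    obtain a' where a': "a < ereal a'" "a' < \<alpha>" using ereal_dense2[OF m(2)] by auto
    have "((\<lambda>s. \<alpha> + \<beta> * inverse s) \<longlongrightarrow> \<alpha> + \<beta> * 0) at_top"
      by (intro tendsto_intros tendsto_inverse_0_at_top filterlim_ident)
    then have "eventually (\<lambda>s. a' < \<alpha> + \<beta> * inverse s) at_top" using a'(2) by (intro order_tendstoD) auto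
    then show "eventually (\<lambda>s. a < \<psi> s / ereal s) at_top"
      using eventually_gt_at_top[of 0]
    proof eventually_elim
      case (elim s)
      have "ereal a' < ereal (\<alpha> + \<beta> * inverse s)" using elim(1) by simp
      also have "\<dots> = ereal (\<alpha> * s + \<beta>) / ereal s" using elim(2) by (simp add: field_simps)
      also have "\<dots> \<le> \<psi> s / ereal s"
        using affine_minorantsD[OF m(1)] elim(2) by (intro ereal_divide_right_mono) auto
      finally show ?case using a'(1) by (rule less_trans[rotated])
    qed
  next
    fix a assume a: "sup_slope \<psi> < a"
    show "eventually (\<lambda>s. \<psi> s / ereal s < a) at_top"
    proof (rule ccontr)
      assume "\<not> ?thesis"
      then have freq: "\<exists>s\<ge>S. \<psi> s / ereal s \<ge> a" for S
        by (auto simp: eventually_at_top_linorder not_less)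
      obtain t' where t': "sup_slope \<psi> < ereal t'" "ereal t' < a" using ereal_dense2[OF a] by blast
      obtain t where t: "sup_slope \<psi> < ereal t" "t < t'" using ereal_dense2[OF t'(1)] by auto
      have "0 \<le> sup_slope \<psi>"
        using affine_minorant_slope_le[OF zero_affine_minorant[OF nonneg]] by (simp add: zero_ereal_def)
      then have t0: "t > 0" using t(1) by (metis ereal_less(2) le_less_trans)
      \<comment> \<open>Beyond \<open>S\<close> the value \<open>t' s\<close> lies above the line of slope \<open>t\<close> through \<open>(x0, y0)\<close>.\<close>
      define S where "S = Max {x0 + 1, 1, (y0 - t * x0) / (t' - t)}"
      obtain s1 where s1: "s1 \<ge> S" "\<psi> s1 / ereal s1 \<ge> a" using freq by blast
      have S: "s1 > x0" "s1 > 0" "s1 \<ge> (y0 - t * x0) / (t' - t)" using s1(1) by (auto simp: S_def)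
      have "ereal t' \<le> \<psi> s1 / ereal s1" using t'(2) s1(2) by simp
      then have "ereal (t' * s1) \<le> \<psi> s1" using S(2) by (simp add: ereal_le_divide_pos mult.commute)
      moreover have "y0 - t * x0 \<le> s1 * (t' - t)" using S(3) t(2) by (simp add: pos_divide_le_eq)
      then have "y0 + t * (s1 - x0) \<le> t' * s1" by (simp add: algebra_simps)
      ultimately have s1b: "ereal (y0 + t * (s1 - x0)) \<le> \<psi> s1" by (metis ereal_less_eq(3) order_trans)
      define \<beta> where "\<beta> = min (y0 - t * x0) (- t * s1)"
      have "(t, \<beta>) \<in> affine_minorants \<psi>"
        unfolding affine_minorants_def
      proof clarify
        fix s
        show "ereal (t * s + \<beta>) \<le> \<psi> s"
        proof (cases "s \<le> s1")
          case True
          then have "t * s \<le> t * s1" using t0 by simp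
          then have "t * s + \<beta> \<le> 0" by (simp add: \<beta>_def min_def)
          then have "ereal (t * s + \<beta>) \<le> 0" by simp
          also have "0 \<le> \<psi> s" using nonneg by simp
          finally show ?thesis .
        next
          case False
          then have ss: "x0 < s1" "s1 < s" using S by auto
          show ?thesis
          proof (cases "\<psi> s")
            case (real r)
            \<comment> \<open>The weight of \<open>s\<close> in the representation of \<open>s1\<close> as a convex combination of \<open>x0\<close> and \<open>s\<close>.\<close>
            define v where "v = (s1 - x0) / (s - x0)"
            have v: "0 < v" "v \<le> 1" "v * (s - x0) = s1 - x0" using ss by (auto simp: v_def)
            have "\<psi> ((1 - v) * x0 + v * s) \<le> ereal (1 - v) * \<psi> x0 + ereal v * \<psi> s"
              using conv v unfolding ereal_convex_def by (meson add.commute diff_add_cancel diff_ge_0_iff_ge less_imp_le)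
            moreover have "(1 - v) * x0 + v * s = s1" using v(3) by (simp add: algebra_simps)
            ultimately have "\<psi> s1 \<le> ereal ((1 - v) * y0 + v * r)" by (simp add: x0 real)
            then have "y0 + t * (s1 - x0) \<le> (1 - v) * y0 + v * r"
              using s1b by (metis ereal_less_eq(3) order_trans)
            then have "t * (v * (s - x0)) \<le> v * (r - y0)"
              unfolding v(3) by (simp add: algebra_simps)
            then have "v * (t * (s - x0)) \<le> v * (r - y0)" by (simp add: mult.left_commute)
            then have "t * (s - x0) \<le> r - y0" using v(1) by simp
            then show ?thesis by (simp add: real \<beta>_def min_def algebra_simps)
          qed (use nonneg[rule_format, of s] in auto)
        qed
      qed
      then have "ereal t \<le> sup_slope \<psi>" by (rule affine_minorant_slope_le)
      then show False using t(1) by simp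
    qed
  qed
  then show "recession_pos \<psi> = sup_slope \<psi>"
    unfolding recession_pos_def by (intro tendsto_Lim) auto
qed

lemma affine_minorants_reflect:
  "(\<alpha>, \<beta>) \<in> affine_minorants (\<lambda>s. \<psi> (- s)) \<longleftrightarrow> (- \<alpha>, \<beta>) \<in> affine_minorants \<psi>"
proof -
  have "(\<forall>s. ereal (\<alpha> * s + \<beta>) \<le> \<psi> (- s)) \<longleftrightarrow> (\<forall>s. ereal (\<alpha> * (- s) + \<beta>) \<le> \<psi> s)"
    by (metis minus_minus)
  then show ?thesis by (simp add: affine_minorants_def)
qed

lemma recession_neg_eq_sup_slope:
  assumes nonneg: "\<forall>s. \<psi> s \<ge> 0" and conv: "ereal_convex \<psi>" and dom: "\<psi> x0 < \<infinity>"
  shows "recession_neg \<psi> = - sup_slope (\<lambda>s. \<psi> (- s))"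
proof -
  let ?r = "\<lambda>s. \<psi> (- s)"
  have "ereal_convex ?r"
    unfolding ereal_convex_def
  proof (intro allI impI)
    fix x y u v :: real assume "0 \<le> u" "0 \<le> v" "u + v = 1"
    then have "\<psi> (u * (- x) + v * (- y)) \<le> ereal u * \<psi> (- x) + ereal v * \<psi> (- y)"
      using conv unfolding ereal_convex_def by blast
    then show "\<psi> (- (u * x + v * y)) \<le> ereal u * \<psi> (- x) + ereal v * \<psi> (- y)" by simp
  qed
  then have "((\<lambda>s. ?r s / ereal s) \<longlongrightarrow> sup_slope ?r) at_top"
    using nonneg dom by (intro recession_pos_eq_sup_slope(1)[of ?r "- x0"]) auto
  then have "((\<lambda>s. - (?r s / ereal s)) \<longlongrightarrow> - sup_slope ?r) at_top"
    by (rule tendsto_uminus_ereal)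
  moreover have "eventually (\<lambda>s. - (?r s / ereal s) = ?r s / ereal (- s)) at_top"
    using eventually_gt_at_top[of 0]
  proof eventually_elim
    case (elim s)
    then show ?case by (cases "?r s") (auto simp: divide_ereal_def)
  qed
  ultimately have "((\<lambda>s. ?r s / ereal (- s)) \<longlongrightarrow> - sup_slope ?r) at_top"
    by (rule Lim_transform_eventually)
  then have "((\<lambda>s. \<psi> s / ereal s) \<longlongrightarrow> - sup_slope ?r) at_bot"
    by (simp add: filterlim_at_bot_mirror)
  then show ?thesis unfolding recession_neg_def by (intro tendsto_Lim) auto
qed

section \<open>Duality between the constraint and affine test families\<close>

locale constraint_integrand =
  fixes \<psi> :: "real \<Rightarrow> ereal"
  assumes nonneg: "\<forall>s. \<psi> s \<ge> 0" and conv: "ereal_convex \<psi>" and lsc: "ereal_lsc \<psi>"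
    and dom: "\<exists>x. \<psi> x < \<infinity>"
begin

lemma sup_slope_nonneg: "0 \<le> sup_slope \<psi>" "0 \<le> sup_slope (\<lambda>s. \<psi> (- s))"
  using affine_minorant_slope_le[OF zero_affine_minorant[of \<psi>]]
    affine_minorant_slope_le[OF zero_affine_minorant[of "\<lambda>s. \<psi> (- s)"]] nonneg
  by (auto simp: zero_ereal_def)

text \<open>
  Reflection turns the recession slope at \<open>-\<infinity>\<close> into one at \<open>+\<infinity>\<close>, and the constraint becomes
  a sum of three nonnegative terms that can be estimated separately.
\<close>

lemma constraint_integral_eq:
  fixes \<Omega> :: "'a::euclidean_space set"
  assumes f: "f \<in> measures_on \<Omega>" and Om: "\<Omega> \<in> sets borel"
    and ae: "AE x in lebesgue_on \<Omega>. ac_density \<Omega> f x = g x"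
  shows "constraint_integral \<Omega> \<psi> f =
    enn2ereal (\<integral>\<^sup>+x. e2ennreal (\<psi> (g x)) \<partial>lebesgue_on \<Omega>)
    + sup_slope \<psi> * ereal (measure (pos_part (borel_on \<Omega>) (sing_part \<Omega> f)) \<Omega>)
    + sup_slope (\<lambda>s. \<psi> (- s)) * ereal (measure (neg_part (borel_on \<Omega>) (sing_part \<Omega> f)) \<Omega>)"
proof -
  obtain x0 where x0: "\<psi> x0 < \<infinity>" using dom by blast
  have s: "sing_part \<Omega> f \<in> measures_on \<Omega>"
    using lebesgue_decomposition_parts[OF f Om] unfolding lebesgue_decomposition_def by blast
  have 1: "(\<integral>\<^sup>+x. e2ennreal (\<psi> (ac_density \<Omega> f x)) \<partial>lebesgue_on \<Omega>)
      = (\<integral>\<^sup>+x. e2ennreal (\<psi> (g x)) \<partial>lebesgue_on \<Omega>)"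
    using ae by (intro nn_integral_cong_AE) auto
  have "- \<psi> y \<le> 0" for y using nonneg ereal_minus_le_minus[of "\<psi> y" 0] by simp
  then have 2: "e2ennreal (- \<psi> y) = 0" for y by (rule e2ennreal_neg)
  have 3: "enn2ereal (emeasure P \<Omega>) = ereal (measure P \<Omega>)" if "finite_measure P" for P :: "'a measure"
    using that by (simp add: finite_measure.emeasure_eq_measure enn2ereal_ennreal)
  show ?thesis
    unfolding constraint_integral_def ereal_integral_def 1 2
      recession_pos_eq_sup_slope(2)[OF nonneg conv x0] recession_neg_eq_sup_slope[OF nonneg conv x0]
      3[OF finite_measure_pos_part[OF s]] 3[OF finite_measure_neg_part[OF s]]
    by (simp add: minus_ereal_def zero_ennreal.rep_eq)
qed

end

text \<open>For \<open>C = \<infinity>\<close> and a vanishing measure, \<open>\<infinity> * 0 = 0\<close> is the value of the integral.\<close>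

lemma integral_le_bound_times_mass:
  assumes P: "finite_measure P" "sets P = sets M" and \<theta>: "\<theta> \<in> bounded_measurable M"
    and C: "\<And>x. x \<in> space M \<Longrightarrow> ereal (\<theta> x) \<le> C" "0 \<le> C"
  shows "ereal (integral\<^sup>L P \<theta>) \<le> C * ereal (measure P (space M))"
proof -
  interpret finite_measure P by fact
  have sp: "space P = space M" by (rule sets_eq_imp_space_eq[OF P(2)])
  have int: "integrable P \<theta>" by (rule bounded_measurable_integrable[OF P \<theta>])
  show ?thesis
  proof (cases C)
    case (real r)
    then have "integral\<^sup>L P \<theta> \<le> (LINT x|P. r)"
      using int C(1) sp by (intro integral_mono) auto
    then show ?thesis by (simp add: real sp mult.commute)
  next
    case PInf
    show ?thesis
    proof (cases "measure P (space M) = 0")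
      case True
      then have "emeasure P (space P) = 0" by (simp add: emeasure_eq_measure sp)
      then have "AE x in P. \<theta> x = 0" by (intro AE_I[where N="space P"]) auto
      then have "integral\<^sup>L P \<theta> = 0" by (rule integral_eq_zero_AE)
      then show ?thesis by (simp add: True flip: zero_ereal_def)
    next
      case False
      then have "measure P (space M) > 0" by (simp add: zero_less_measure_iff)
      then show ?thesis by (simp add: PInf)
    qed
  qed (use C in auto)
qed

lemma ereal_integral_le_nn_integral:
  assumes "integrable M h" "\<And>x. x \<in> space M \<Longrightarrow> ennreal (h x) \<le> k x"
  shows "ereal (integral\<^sup>L M h) \<le> enn2ereal (\<integral>\<^sup>+x. k x \<partial>M)"
proof -
  have "integral\<^sup>L M h \<le> (LINT x|M. max 0 (h x))" using assms(1) by (intro integral_mono) auto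
  then have "ereal (integral\<^sup>L M h) \<le> ereal (LINT x|M. max 0 (h x))" by simp
  also have "\<dots> = enn2ereal (ennreal (LINT x|M. max 0 (h x)))"
    by (subst enn2ereal_ennreal) (auto intro!: integral_nonneg_AE)
  also have "ennreal (LINT x|M. max 0 (h x)) = (\<integral>\<^sup>+x. ennreal (max 0 (h x)) \<partial>M)"
    using assms(1) by (intro nn_integral_eq_integral[symmetric]) auto
  also have "enn2ereal \<dots> \<le> enn2ereal (\<integral>\<^sup>+x. k x \<partial>M)"
    unfolding less_eq_ennreal.rep_eq[symmetric] using assms(2) by (intro nn_integral_mono) simp
  finally show ?thesis .
qed

lemma signed_integral_decomposition:
  fixes \<Omega> :: "'a::euclidean_space set"
  assumes f: "f \<in> measures_on \<Omega>" and s: "s \<in> measures_on \<Omega>" and Om: "\<Omega> \<in> sets borel"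
    and g: "integrable (lebesgue_on \<Omega>) g"
    and dec: "\<And>A. A \<in> sets (borel_on \<Omega>) \<Longrightarrow> f A = (LINT x|lebesgue_on \<Omega>. indicator A x * g x) + s A"
    and \<phi>: "\<phi> \<in> bounded_measurable (borel_on \<Omega>)"
  shows "signed_integral (borel_on \<Omega>) f \<phi> =
    (LINT x|lebesgue_on \<Omega>. \<phi> x * g x) + signed_integral (borel_on \<Omega>) s \<phi>"
proof -
  let ?L = "\<lambda>\<phi>. (LINT x|lebesgue_on \<Omega>. \<phi> x * g x) + signed_integral (borel_on \<Omega>) s \<phi>"
  have L: "integration_functional (borel_on \<Omega>) (\<lambda>A. (LINT x:A|lebesgue. g x) + s A) ?L"
    by (intro integration_functional_add integration_functional_density[OF g Om]
        integration_functional_signed s)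
  have "(LINT x:A|lebesgue. g x) + s A = f A" if "A \<in> sets (borel_on \<Omega>)" for A
    using dec[OF that] set_integral_lebesgue_on[OF Om that, of g] by simp
  then have "integration_functional (borel_on \<Omega>) f ?L"
    using L unfolding integration_functional_def by simp
  from integration_functional_unique[OF integration_functional_signed[OF f] this \<phi>] show ?thesis .
qed

lemma bounded_measurable_integrable_lebesgue_on:
  fixes \<Omega> :: "'a::euclidean_space set"
  assumes "\<Omega> \<in> lmeasurable" "\<phi> \<in> bounded_measurable (borel_on \<Omega>)"
  shows "integrable (lebesgue_on \<Omega>) \<phi>"
proof -
  interpret finite_measure "lebesgue_on \<Omega>" using assms(1) by (rule finite_measure_lebesgue_on)
  show ?thesis using integrable_bounded_mult[of \<Omega> "\<lambda>_. 1" \<phi>] assms(2) by simp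
qed

context constraint_integrand
begin

text \<open>
  Each affine minorant bounds \<open>\<psi>\<close> on the density from below and its slope lies between the
  two recession slopes; a sub-convex combination of minorants inherits both bounds.
\<close>

lemma affine_test_le_constraint_integral:
  fixes \<Omega> :: "'a::euclidean_space set" and \<phi> :: "'i \<Rightarrow> 'a \<Rightarrow> real"
  assumes f: "f \<in> measures_on \<Omega>" and Om: "\<Omega> \<in> sets borel" "\<Omega> \<in> lmeasurable"
    and min: "\<And>i. i \<in> I \<Longrightarrow> (\<alpha> i, \<beta> i) \<in> affine_minorants \<psi>" and I: "finite I"
    and \<phi>: "\<And>i. i \<in> I \<Longrightarrow> \<phi> i \<in> bounded_measurable (borel_on \<Omega>)"
    and \<phi>0: "\<And>i x. i \<in> I \<Longrightarrow> x \<in> \<Omega> \<Longrightarrow> 0 \<le> \<phi> i x"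
    and \<phi>1: "\<And>x. x \<in> \<Omega> \<Longrightarrow> (\<Sum>i\<in>I. \<phi> i x) \<le> 1"
  shows "ereal (\<Sum>i\<in>I. \<alpha> i * signed_integral (borel_on \<Omega>) f (\<phi> i) + \<beta> i * (LINT x|lebesgue_on \<Omega>. \<phi> i x))
    \<le> constraint_integral \<Omega> \<psi> f"
proof -
  let ?M = "borel_on \<Omega>" and ?L = "lebesgue_on \<Omega>"
  define s where "s = sing_part \<Omega> f"
  obtain g where g: "g \<in> borel_measurable borel" "AE x in ?L. ac_density \<Omega> f x = g x"
    "integrable ?L g" "\<And>A. A \<in> sets ?M \<Longrightarrow> f A = (LINT x|?L. indicator A x * g x) + s A"
    unfolding s_def by (rule borel_ac_density[OF f Om(1)]) blast
  have s: "s \<in> measures_on \<Omega>"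
    using lebesgue_decomposition_parts[OF f Om(1)] unfolding lebesgue_decomposition_def s_def by blast
  have sp: "space ?M = \<Omega>" "space ?L = \<Omega>" by (auto simp: space_restrict_space)
  define P N where "P = pos_part ?M s" and "N = neg_part ?M s"
  have P: "finite_measure P" "sets P = sets ?M" and N: "finite_measure N" "sets N = sets ?M"
    using s by (auto simp: P_def N_def finite_measure_pos_part finite_measure_neg_part)
  define \<theta> where "\<theta> x = (\<Sum>i\<in>I. \<alpha> i * \<phi> i x)" for x
  have \<theta>: "\<theta> \<in> bounded_measurable ?M"
    unfolding \<theta>_def using \<phi> by (intro bounded_measurable_sum bounded_measurable_cmult)
  have \<theta>': "(\<lambda>x. - \<theta> x) \<in> bounded_measurable ?M" using bounded_measurable_cmult[OF \<theta>, of "-1"] by simp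
  define h where "h x = (\<Sum>i\<in>I. \<alpha> i * (\<phi> i x * g x) + \<beta> i * \<phi> i x)" for x
  have inth: "integrable ?L h"
    unfolding h_def using \<phi> integrable_bounded_mult[OF g(3)] bounded_measurable_integrable_lebesgue_on[OF Om(2)]
    by (intro Bochner_Integration.integrable_sum Bochner_Integration.integrable_add integrable_mult_right) auto
  have SIs: "signed_integral ?M s \<theta> = (\<Sum>i\<in>I. \<alpha> i * signed_integral ?M s (\<phi> i))"
    unfolding \<theta>_def using \<phi> by (intro integration_functional_sum[OF integration_functional_signed[OF s] I])
  have Lh: "integral\<^sup>L ?L h = (\<Sum>i\<in>I. \<alpha> i * (LINT x|?L. \<phi> i x * g x) + \<beta> i * (LINT x|?L. \<phi> i x))"
  proof -
    have "integral\<^sup>L ?L h = (\<Sum>i\<in>I. LINT x|?L. \<alpha> i * (\<phi> i x * g x) + \<beta> i * \<phi> i x)"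
      unfolding h_def using \<phi> integrable_bounded_mult[OF g(3)] bounded_measurable_integrable_lebesgue_on[OF Om(2)]
      by (intro Bochner_Integration.integral_sum Bochner_Integration.integrable_add integrable_mult_right) auto
    also have "\<dots> = (\<Sum>i\<in>I. \<alpha> i * (LINT x|?L. \<phi> i x * g x) + \<beta> i * (LINT x|?L. \<phi> i x))"
    proof (intro sum.cong refl)
      fix i assume "i \<in> I"
      then have "integrable ?L (\<lambda>x. \<phi> i x * g x)" "integrable ?L (\<phi> i)"
        using \<phi> integrable_bounded_mult[OF g(3)] bounded_measurable_integrable_lebesgue_on[OF Om(2)] by auto
      then show "(LINT x|?L. \<alpha> i * (\<phi> i x * g x) + \<beta> i * \<phi> i x) = \<alpha> i * (LINT x|?L. \<phi> i x * g x) + \<beta> i * (LINT x|?L. \<phi> i x)"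
        by simp
    qed
    finally show ?thesis .
  qed
  have "(\<Sum>i\<in>I. \<alpha> i * signed_integral ?M f (\<phi> i) + \<beta> i * (LINT x|?L. \<phi> i x))
      = (\<Sum>i\<in>I. (\<alpha> i * (LINT x|?L. \<phi> i x * g x) + \<beta> i * (LINT x|?L. \<phi> i x)) + \<alpha> i * signed_integral ?M s (\<phi> i))"
    using signed_integral_decomposition[OF f s Om(1) g(3,4) \<phi>] by (intro sum.cong) (auto simp: algebra_simps)
  also have "\<dots> = integral\<^sup>L ?L h + signed_integral ?M s \<theta>"
    unfolding Lh SIs by (rule sum.distrib)
  also have "\<dots> = integral\<^sup>L ?L h + integral\<^sup>L P \<theta> + integral\<^sup>L N (\<lambda>x. - \<theta> x)"
    by (simp add: signed_integral_def P_def N_def)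
  finally have eq: "ereal (\<Sum>i\<in>I. \<alpha> i * signed_integral ?M f (\<phi> i) + \<beta> i * (LINT x|?L. \<phi> i x))
      = ereal (integral\<^sup>L ?L h) + ereal (integral\<^sup>L P \<theta>) + ereal (integral\<^sup>L N (\<lambda>x. - \<theta> x))" by simp
  have 1: "ereal (integral\<^sup>L ?L h) \<le> enn2ereal (\<integral>\<^sup>+x. e2ennreal (\<psi> (g x)) \<partial>?L)"
  proof (rule ereal_integral_le_nn_integral[OF inth])
    fix x assume "x \<in> space ?L"
    then have x: "x \<in> \<Omega>" by (simp add: sp)
    have "ereal (h x) \<le> \<psi> (g x)"
    proof (cases "\<psi> (g x)")
      case (real r)
      then have r: "r \<ge> 0" using nonneg[rule_format, of "g x"] by simp
      have "h x = (\<Sum>i\<in>I. \<phi> i x * (\<alpha> i * g x + \<beta> i))" by (simp add: h_def algebra_simps)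
      also have "\<dots> \<le> (\<Sum>i\<in>I. \<phi> i x * r)"
        using \<phi>0 x affine_minorantsD[OF min, of _ "g x"] real
        by (intro sum_mono mult_left_mono) auto
      also have "\<dots> \<le> 1 * r" unfolding sum_distrib_right[symmetric] using \<phi>1[OF x] r by (rule mult_right_mono)
      finally show ?thesis by (simp add: real)
    qed (use nonneg[rule_format, of "g x"] in auto)
    then show "ennreal (h x) \<le> e2ennreal (\<psi> (g x))"
      using e2ennreal_mono by (metis e2ennreal_ereal)
  qed
  have slope: "ereal (\<Sum>i\<in>I. a i * \<phi> i x) \<le> C"
    if x: "x \<in> \<Omega>" and C: "0 \<le> C" "\<And>i. i \<in> I \<Longrightarrow> ereal (a i) \<le> C" for a x C
  proof (cases C)
    case (real r)
    have "(\<Sum>i\<in>I. a i * \<phi> i x) \<le> (\<Sum>i\<in>I. r * \<phi> i x)"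
      using \<phi>0 x C(2) real by (intro sum_mono mult_right_mono) auto
    also have "\<dots> \<le> r * 1"
      unfolding sum_distrib_left[symmetric] using \<phi>1[OF x] C(1) real by (intro mult_left_mono) auto
    finally show ?thesis by (simp add: real)
  qed (use C in auto)
  have 2: "ereal (integral\<^sup>L P \<theta>) \<le> sup_slope \<psi> * ereal (measure P \<Omega>)"
    using integral_le_bound_times_mass[OF P \<theta>, of "sup_slope \<psi>"] slope[OF _ sup_slope_nonneg(1), of _ \<alpha>]
      affine_minorant_slope_le[OF min] sup_slope_nonneg(1)
    unfolding \<theta>_def by (simp add: sp)
  have "ereal (- \<alpha> i) \<le> sup_slope (\<lambda>s. \<psi> (- s))" if "i \<in> I" for i
    using min[OF that] affine_minorants_reflect[of "- \<alpha> i" "\<beta> i" \<psi>]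
    by (intro affine_minorant_slope_le[of _ "\<beta> i"]) simp
  then have "ereal (- \<theta> x) \<le> sup_slope (\<lambda>s. \<psi> (- s))" if "x \<in> \<Omega>" for x
    using slope[OF that sup_slope_nonneg(2), of "\<lambda>i. - \<alpha> i"] by (simp add: \<theta>_def sum_negf)
  then have 3: "ereal (integral\<^sup>L N (\<lambda>x. - \<theta> x)) \<le> sup_slope (\<lambda>s. \<psi> (- s)) * ereal (measure N \<Omega>)"
    using integral_le_bound_times_mass[OF N \<theta>', of "sup_slope (\<lambda>s. \<psi> (- s))"] sup_slope_nonneg(2)
    by (simp add: sp)
  show ?thesis
    unfolding eq constraint_integral_eq[OF f Om(1) g(2)] using 1 2 3
    unfolding P_def N_def s_def by (intro add_mono)
qed

end

lemma sup_slope_mult_le: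
  assumes nonneg: "\<forall>s. \<psi> s \<ge> (0::ereal)" and S: "S \<ge> 0"
    and le: "\<And>\<alpha> \<beta>. (\<alpha>, \<beta>) \<in> affine_minorants \<psi> \<Longrightarrow> \<alpha> * S \<le> c"
  shows "sup_slope \<psi> * ereal S \<le> ereal c"
proof (cases "S = 0")
  case True
  then show ?thesis
    using le[OF zero_affine_minorant[OF nonneg]] by (simp flip: zero_ereal_def)
next
  case False
  then have S: "S > 0" using S by simp
  have "sup_slope \<psi> \<le> ereal (c / S)"
    unfolding sup_slope_def using le S by (intro SUP_least) (auto simp: pos_le_divide_eq)
  then have "sup_slope \<psi> * ereal S \<le> ereal (c / S) * ereal S" using S by (intro ereal_mult_right_mono) auto
  then show ?thesis using S by simp
qed

context constraint_integrand
begin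

text \<open>
  Affine minorants tested on disjoint sets detect the whole constraint. Off the null set carrying
  the singular part, the space is partitioned according to which of finitely many minorants is
  largest at the density; on the null set only slopes matter, and it is split by a Hahn
  decomposition of the singular part.
\<close>

lemma constraint_integral_le:
  fixes \<Omega> :: "'a::euclidean_space set"
  assumes f: "f \<in> measures_on \<Omega>" and Om: "\<Omega> \<in> sets borel" "\<Omega> \<in> lmeasurable"
    and bound: "\<And>n \<alpha> \<beta> A. (\<And>i::nat. i < n \<Longrightarrow> (\<alpha> i, \<beta> i) \<in> affine_minorants \<psi>) \<Longrightarrow>
        (\<And>i. i < n \<Longrightarrow> A i \<in> sets (borel_on \<Omega>)) \<Longrightarrow> disjoint_family_on A {..<n} \<Longrightarrow>
        (\<Sum>i<n. \<alpha> i * f (A i) + \<beta> i * measure lborel (A i)) \<le> m"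
  shows "constraint_integral \<Omega> \<psi> f \<le> ereal m"
proof -
  let ?M = "borel_on \<Omega>" and ?L = "lebesgue_on \<Omega>"
  interpret L: finite_measure ?L using Om(2) by (rule finite_measure_lebesgue_on)
  define s where "s = sing_part \<Omega> f"
  obtain g where g: "g \<in> borel_measurable borel" "AE x in ?L. ac_density \<Omega> f x = g x"
    "integrable ?L g" "\<And>A. A \<in> sets ?M \<Longrightarrow> f A = (LINT x|?L. indicator A x * g x) + s A"
    unfolding s_def by (rule borel_ac_density[OF f Om(1)]) blast
  have dec: "lebesgue_decomposition \<Omega> f (ac_density \<Omega> f) s"
    using lebesgue_decomposition_parts[OF f Om(1)] unfolding s_def .
  then obtain Z where Z: "Z \<in> null_sets lborel" "\<And>A. A \<in> sets ?M \<Longrightarrow> A \<inter> Z = {} \<Longrightarrow> s A = 0"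
    and s: "s \<in> measures_on \<Omega>"
    unfolding lebesgue_decomposition_def by blast
  have sp: "space ?M = \<Omega>" "space ?L = \<Omega>" by (auto simp: space_restrict_space)
  have setsM: "A \<in> sets ?M \<longleftrightarrow> A \<subseteq> \<Omega> \<and> A \<in> sets borel" for A
    using Om(1) by (simp add: sets_restrict_space_iff)
  have Zb [measurable]: "Z \<in> sets borel" using Z by auto
  have Omb [measurable]: "\<Omega> \<in> sets borel" by (rule Om(1))
  have gb [measurable]: "g \<in> borel_measurable borel" by (rule g(1))
  obtain H where H: "H \<in> sets ?M" and SP: "measure (pos_part ?M s) (space ?M) = s H"
    and SN: "measure (neg_part ?M s) (space ?M) = - s (space ?M - H)"
    by (rule hahn_decomposition[OF s]) blast
  define Sp where "Sp = measure (pos_part ?M s) \<Omega>"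
  define Sn where "Sn = measure (neg_part ?M s) \<Omega>"
  have null: "f (A \<inter> Z) = s A \<and> measure lborel (A \<inter> Z) = 0" if A: "A \<in> sets ?M" for A
  proof -
    have AZ: "A \<inter> Z \<in> null_sets lborel" using null_set_Int1[OF Z(1), of A] A setsM[of A] by (simp add: Int_commute)
    have "A \<inter> Z \<in> sets ?M" "A - Z \<in> sets ?M" using A setsM Zb by auto
    moreover have "s (A \<inter> Z \<union> (A - Z)) = s (A \<inter> Z) + s (A - Z)"
      using calculation by (intro signed_measures_Un[OF s]) auto
    moreover have "A \<inter> Z \<union> (A - Z) = A" by auto
    moreover have "s (A - Z) = 0" using calculation by (intro Z(2)) auto
    moreover have "f (A \<inter> Z) = s (A \<inter> Z)"
      using g(4)[of "A \<inter> Z"] set_integral_lebesgue_on[OF Om(1), of "A \<inter> Z" g]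
        set_integral_null_set[OF AZ, of g] calculation by simp
    ultimately show ?thesis using AZ by (simp add: measure_eq_0_null_sets)
  qed
  obtain a b :: "nat \<Rightarrow> real" where ab: "a 0 = 0" "b 0 = 0" "\<And>n. (a n, b n) \<in> affine_minorants \<psi>"
    "\<And>s. \<psi> s = (SUP n. ereal (a n * s + b n))"
    by (rule convex_lsc_eq_countable_SUP_affine[OF nonneg conv lsc]) blast
  \<comment> \<open>\<open>k n y\<close> is the index at most \<open>n\<close> of a minorant that is largest at \<open>y\<close>.\<close>
  define k where "k = rec_nat (\<lambda>_. 0::nat)
    (\<lambda>n kn (y::real). if a (kn y) * y + b (kn y) < a (Suc n) * y + b (Suc n) then Suc n else kn y)"
  define u where "u n y = a (k n y) * y + b (k n y)" for n y
  have k0: "k 0 y = 0" and kS: "k (Suc n) y = (if u n y < a (Suc n) * y + b (Suc n) then Suc n else k n y)" for n y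
    by (simp_all add: k_def u_def)
  have k_le: "k n y \<le> n" for n y
    by (induction n) (auto simp: k0 kS intro: le_SucI)
  have k_meas: "k n \<in> measurable borel (count_space UNIV)" for n
  proof (induction n)
    case 0
    have "k 0 = (\<lambda>_. 0)" by (auto simp: k0)
    then show ?case by simp
  next
    case (Suc n)
    note [measurable] = Suc
    have "k (Suc n) = (\<lambda>y. if a (k n y) * y + b (k n y) < a (Suc n) * y + b (Suc n) then Suc n else k n y)"
      by (auto simp: kS u_def)
    then show ?case by simp
  qed
  note [measurable] = k_meas
  have u_meas [measurable]: "u n \<in> borel_measurable borel" for n
    unfolding u_def by measurable
  have u_SucI: "u (Suc n) y = max (u n y) (a (Suc n) * y + b (Suc n))" for n y
    by (auto simp: u_def[of "Suc n"] kS) (auto simp: u_def)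
  have u_mono: "incseq (\<lambda>n. u n y)" for y by (intro incseq_SucI) (simp add: u_SucI)
  have u0: "u 0 y = 0" for y by (simp add: u_def k0 ab)
  have u_nonneg: "0 \<le> u n y" for n y using incseqD[OF u_mono, of 0 n y] by (simp add: u0)
  have u_ge: "a n * y + b n \<le> u n y" for n y
    by (cases n) (simp_all add: u_SucI u0 ab)
  have u_SUP: "\<psi> y = (SUP n. ereal (u n y))" for y
    unfolding ab(4)
  proof (rule antisym)
    show "(SUP n. ereal (a n * y + b n)) \<le> (SUP n. ereal (u n y))"
      using u_ge by (intro SUP_mono) auto
    show "(SUP n. ereal (u n y)) \<le> (SUP n. ereal (a n * y + b n))"
      unfolding u_def by (intro SUP_least SUP_upper) auto
  qed
  define B where "B n i = {x \<in> \<Omega> - Z. k n (g x) = i}" for n i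
  have B: "B n i \<in> sets ?M" for n i
  proof -
    have "B n i \<in> sets borel" unfolding B_def by measurable
    then show ?thesis unfolding setsM by (auto simp: B_def)
  qed
  have AEZ: "AE x in ?L. x \<notin> Z"
  proof -
    have "AE x in lebesgue. x \<notin> Z" using Z(1) by (intro AE_not_in null_sets_completionI)
    then show ?thesis using Om(1) by (subst AE_restrict_space_iff) auto
  qed
  have int_ind: "integrable ?L (\<lambda>x. indicator (B n i) x * g x)" "integrable ?L (indicator (B n i) :: 'a \<Rightarrow> real)" for n i
    using integrable_bounded_mult[OF g(3) bounded_measurable_indicator[OF B]]
      bounded_measurable_integrable_lebesgue_on[OF Om(2) bounded_measurable_indicator[OF B]] by auto
  define U where "U n x = (\<Sum>i\<le>n. a i * (indicator (B n i) x * g x) + b i * indicator (B n i) x)" for n x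
  have U_eq: "U n x = u n (g x)" if "x \<in> \<Omega> - Z" for n x
  proof -
    have "U n x = (\<Sum>i\<le>n. if i = k n (g x) then a i * g x + b i else 0)"
      unfolding U_def using that by (intro sum.cong) (auto simp: B_def)
    also have "\<dots> = u n (g x)" using k_le by (simp add: u_def)
    finally show ?thesis .
  qed
  have U_int: "integrable ?L (U n)" for n
    unfolding U_def using int_ind
    by (intro Bochner_Integration.integrable_sum Bochner_Integration.integrable_add integrable_mult_right) auto
  have U_LINT: "integral\<^sup>L ?L (U n) = (\<Sum>i\<le>n. a i * f (B n i) + b i * measure lborel (B n i))" for n
  proof -
    have "integral\<^sup>L ?L (U n) = (\<Sum>i\<le>n. LINT x|?L. a i * (indicator (B n i) x * g x) + b i * indicator (B n i) x)"
      unfolding U_def using int_ind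
      by (intro Bochner_Integration.integral_sum Bochner_Integration.integrable_add integrable_mult_right) auto
    also have "\<dots> = (\<Sum>i\<le>n. a i * f (B n i) + b i * measure lborel (B n i))"
    proof (intro sum.cong refl)
      fix i
      have "s (B n i) = 0" using B by (intro Z(2)) (auto simp: B_def)
      then have 1: "f (B n i) = (LINT x|?L. indicator (B n i) x * g x)" using g(4)[OF B] by simp
      have "measure ?L (B n i) = measure lebesgue (B n i)"
        using B setsM Om by (intro measure_restrict_space) auto
      also have "\<dots> = measure lborel (B n i)" using B setsM by (intro measure_completion) auto
      finally have 2: "(LINT x|?L. indicator (B n i) x) = measure lborel (B n i)"
        using B setsM by (simp add: sp Int_absorb2 Int_absorb1)
      show "(LINT x|?L. a i * (indicator (B n i) x * g x) + b i * indicator (B n i) x)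
          = a i * f (B n i) + b i * measure lborel (B n i)"
        unfolding 1 2[symmetric] using int_ind by simp
    qed
    finally show ?thesis .
  qed
  \<comment> \<open>The two sets carrying the singular part are null, so the constants \<open>\<tau>\<close> and \<open>\<tau>'\<close> drop out.\<close>
  have main: "integral\<^sup>L ?L (U n) + t * Sp + t' * Sn \<le> m"
    if t: "(t, \<tau>) \<in> affine_minorants \<psi>" and t': "(- t', \<tau>') \<in> affine_minorants \<psi>" for n t \<tau> t' \<tau>'
  proof -
    define \<alpha> where "\<alpha> i = (if i \<le> n then a i else if i = n + 1 then t else - t')" for i
    define \<beta> where "\<beta> i = (if i \<le> n then b i else if i = n + 1 then \<tau> else \<tau>')" for i
    define A where "A i = (if i \<le> n then B n i else if i = n + 1 then H \<inter> Z else (\<Omega> - H) \<inter> Z)" for i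
    have HZ: "H \<inter> Z \<in> sets ?M" "(\<Omega> - H) \<inter> Z \<in> sets ?M" "\<Omega> - H \<in> sets ?M"
      using H setsM by auto
    have "(\<Sum>i<n+3. \<alpha> i * f (A i) + \<beta> i * measure lborel (A i)) \<le> m"
    proof (rule bound)
      show "(\<alpha> i, \<beta> i) \<in> affine_minorants \<psi>" for i using ab(3) t t' by (simp add: \<alpha>_def \<beta>_def)
      show "A i \<in> sets ?M" for i using B HZ by (simp add: A_def)
      show "disjoint_family_on A {..<n+3}"
        unfolding disjoint_family_on_def A_def B_def by auto
    qed
    also have "{..<n+3} = insert (n+2) (insert (n+1) {..n})" by auto
    also have "(\<Sum>i\<in>\<dots>. \<alpha> i * f (A i) + \<beta> i * measure lborel (A i))
        = (- t' * f ((\<Omega> - H) \<inter> Z) + \<tau>' * measure lborel ((\<Omega> - H) \<inter> Z))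
          + ((t * f (H \<inter> Z) + \<tau> * measure lborel (H \<inter> Z)) + (\<Sum>i\<le>n. a i * f (B n i) + b i * measure lborel (B n i)))"
      by (simp add: \<alpha>_def \<beta>_def A_def)
    finally show ?thesis
      using null[OF H] null[OF HZ(3)] SP SN unfolding U_LINT Sp_def Sn_def sp by simp
  qed
  define X where "X = (\<integral>\<^sup>+x. e2ennreal (\<psi> (g x)) \<partial>?L)"
  have X_SUP: "X = (SUP n. ennreal (integral\<^sup>L ?L (U n)))"
  proof -
    have nn: "(\<integral>\<^sup>+x. ennreal (u n (g x)) \<partial>?L) = ennreal (integral\<^sup>L ?L (U n))" for n
    proof -
      have ae: "AE x in ?L. U n x = u n (g x)"
        using AEZ AE_space[of ?L] by eventually_elim (auto simp: U_eq sp)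
      have "(\<integral>\<^sup>+x. ennreal (u n (g x)) \<partial>?L) = (\<integral>\<^sup>+x. ennreal (U n x) \<partial>?L)"
        using ae by (intro nn_integral_cong_AE) auto
      also have "\<dots> = ennreal (integral\<^sup>L ?L (U n))"
        using ae U_int u_nonneg by (intro nn_integral_eq_integral) auto
      finally show ?thesis .
    qed
    have "X = (\<integral>\<^sup>+x. (SUP n. ennreal (u n (g x))) \<partial>?L)"
      unfolding X_def
    proof (intro nn_integral_cong)
      fix x
      have inc: "incseq (\<lambda>n. ereal (u n (g x)))" "incseq (\<lambda>n. ennreal (u n (g x)))"
        using u_mono[of "g x"] by (auto simp: incseq_def intro: ennreal_leI)
      have "(\<lambda>n. e2ennreal (ereal (u n (g x)))) \<longlonglongrightarrow> e2ennreal (\<psi> (g x))"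
        unfolding u_SUP by (intro tendsto_e2ennrealI LIMSEQ_SUP inc)
      then show "e2ennreal (\<psi> (g x)) = (SUP n. ennreal (u n (g x)))"
        using LIMSEQ_SUP[OF inc(2)] LIMSEQ_unique by (simp add: e2ennreal_ereal)
    qed
    also have "\<dots> = (SUP n. \<integral>\<^sup>+x. ennreal (u n (g x)) \<partial>?L)"
    proof (rule nn_integral_monotone_convergence_SUP)
      show "incseq (\<lambda>n x. ennreal (u n (g x)))"
        using u_mono by (auto simp: incseq_def le_fun_def intro!: ennreal_leI)
      have "(\<lambda>x. u n (g x)) \<in> borel_measurable ?L" for n
        by (intro measurable_restrict_space1 measurable_completion) simp
      then show "(\<lambda>x. ennreal (u n (g x))) \<in> borel_measurable ?L" for n by simp
    qed
    also have "\<dots> = (SUP n. ennreal (integral\<^sup>L ?L (U n)))" by (simp only: nn)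
    finally show ?thesis .
  qed
  have z: "(0, 0) \<in> affine_minorants \<psi>" by (rule zero_affine_minorant[OF nonneg])
  have "X \<le> ennreal m"
    unfolding X_SUP using main[of 0 0 0 0] z by (intro SUP_least ennreal_leI) simp
  then have "X \<noteq> \<top>" by (metis ennreal_neq_top top.extremum_uniqueI)
  then obtain x where x: "X = ennreal x" "x \<ge> 0" by (cases X) auto
  have Sp: "Sp \<ge> 0" and Sn: "Sn \<ge> 0" by (simp_all add: Sp_def Sn_def)
  have main2: "x + t * Sp + t' * Sn \<le> m"
    if "(t, \<tau>) \<in> affine_minorants \<psi>" "(- t', \<tau>') \<in> affine_minorants \<psi>" for t \<tau> t' \<tau>'
  proof -
    have ub: "integral\<^sup>L ?L (U n) \<le> m - t * Sp - t' * Sn" for n using main[OF that, of n] by simp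
    have lb: "0 \<le> integral\<^sup>L ?L (U n)" for n
    proof (rule integral_nonneg_AE)
      show "AE x in ?L. 0 \<le> U n x"
        using AEZ AE_space[of ?L] by eventually_elim (auto simp: U_eq sp u_nonneg)
    qed
    have "X \<le> ennreal (m - t * Sp - t' * Sn)"
      unfolding X_SUP using ub by (intro SUP_least ennreal_leI)
    moreover have "0 \<le> m - t * Sp - t' * Sn" using ub[of 0] lb[of 0] by linarith
    ultimately show ?thesis using x by simp
  qed
  \<comment> \<open>The slopes \<open>t\<close> and \<open>t'\<close> are independent of each other: first \<open>t\<close>, then \<open>t'\<close> is optimized.\<close>
  have P1: "sup_slope \<psi> * ereal Sp \<le> ereal (m - x - t' * Sn)"
    if "(- t', \<tau>') \<in> affine_minorants \<psi>" for t' \<tau>'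
    using main2[OF _ that] by (intro sup_slope_mult_le[OF nonneg Sp]) (force simp: algebra_simps)
  have "0 \<le> sup_slope \<psi> * ereal Sp" using sup_slope_nonneg Sp by simp
  then obtain y where y: "sup_slope \<psi> * ereal Sp = ereal y"
    using P1[of 0 0] z by (cases "sup_slope \<psi> * ereal Sp") auto
  have "sup_slope (\<lambda>s. \<psi> (- s)) * ereal Sn \<le> ereal (m - x - y)"
    using P1 nonneg unfolding y affine_minorants_reflect[symmetric]
    by (intro sup_slope_mult_le Sn) (force simp: algebra_simps)+
  then have "ereal x + ereal y + sup_slope (\<lambda>s. \<psi> (- s)) * ereal Sn \<le> ereal x + ereal y + ereal (m - x - y)"
    by (intro add_left_mono)
  moreover have "enn2ereal X = ereal x" using x by (simp add: enn2ereal_ennreal)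
  ultimately show ?thesis
    unfolding constraint_integral_eq[OF f Om(1) g(2)] X_def[symmetric] s_def[symmetric]
      Sp_def[symmetric] Sn_def[symmetric] y by simp
qed

text \<open>The minorants \<open>c0 s - a0\<close> and \<open>- c0 s - a0\<close> are tested on the two halves of a Hahn decomposition.\<close>

lemma total_mass_le_constraint_integral:
  fixes \<Omega> :: "'a::euclidean_space set"
  assumes f: "f \<in> measures_on \<Omega>" and Om: "\<Omega> \<in> sets borel" "\<Omega> \<in> lmeasurable"
    and growth: "c0 > 0" "\<forall>s. ereal (c0 * \<bar>s\<bar> - a0) \<le> \<psi> s"
    and m: "constraint_integral \<Omega> \<psi> f \<le> ereal m"
  shows "measure (pos_part (borel_on \<Omega>) f) \<Omega> + measure (neg_part (borel_on \<Omega>) f) \<Omega>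
    \<le> (m + a0 * measure lebesgue \<Omega>) / c0"
proof -
  let ?M = "borel_on \<Omega>" and ?L = "lebesgue_on \<Omega>"
  interpret L: finite_measure ?L using Om(2) by (rule finite_measure_lebesgue_on)
  have sp: "space ?M = \<Omega>" "space ?L = \<Omega>" by (auto simp: space_restrict_space)
  obtain H where H: "H \<in> sets ?M" and P: "measure (pos_part ?M f) \<Omega> = f H"
    and N: "measure (neg_part ?M f) \<Omega> = - f (\<Omega> - H)"
    using hahn_decomposition[OF f] unfolding sp by metis
  have H': "\<Omega> - H \<in> sets ?M" "H \<subseteq> \<Omega>" using H sets.compl_sets[OF H] sets.sets_into_space[OF H] by (auto simp: sp)
  define \<alpha> where "\<alpha> i = (if i then c0 else - c0)" for i
  define \<phi> :: "bool \<Rightarrow> 'a \<Rightarrow> real" where "\<phi> i = (if i then indicator H else indicator (\<Omega> - H))" for i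
  have SI: "signed_integral ?M f (indicator A) = f A" if "A \<in> sets ?M" for A
    using integration_functional_signed[OF f] that unfolding integration_functional_def by blast
  have int: "integrable ?L (indicator A :: 'a \<Rightarrow> real)" if "A \<in> sets ?M" for A
    by (rule bounded_measurable_integrable_lebesgue_on[OF Om(2) bounded_measurable_indicator[OF that]])
  have "ereal (\<Sum>i\<in>UNIV. \<alpha> i * signed_integral ?M f (\<phi> i) + - a0 * (LINT x|?L. \<phi> i x)) \<le> constraint_integral \<Omega> \<psi> f"
  proof (rule affine_test_le_constraint_integral[OF f Om])
    fix i
    have "ereal (\<alpha> i * s + - a0) \<le> \<psi> s" for s
    proof -
      have "\<alpha> i * s \<le> c0 * \<bar>s\<bar>"
        using growth(1) mult_left_mono[of s "\<bar>s\<bar>" c0] mult_left_mono[of "- s" "\<bar>s\<bar>" c0] by (auto simp: \<alpha>_def)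
      then have "ereal (\<alpha> i * s + - a0) \<le> ereal (c0 * \<bar>s\<bar> - a0)" by simp
      then show ?thesis using growth(2) order_trans by blast
    qed
    then show "(\<alpha> i, - a0) \<in> affine_minorants \<psi>" unfolding affine_minorants_def by blast
    show "\<phi> i \<in> bounded_measurable ?M" using H H' by (auto simp: \<phi>_def bounded_measurable_indicator)
  qed (auto simp: \<phi>_def UNIV_bool indicator_def)
  also have "(\<Sum>i\<in>UNIV. \<alpha> i * signed_integral ?M f (\<phi> i) + - a0 * (LINT x|?L. \<phi> i x))
      = c0 * (f H - f (\<Omega> - H)) - a0 * ((LINT x|?L. indicator H x) + (LINT x|?L. indicator (\<Omega> - H) x))"
    using SI[OF H] SI[OF H'(1)] by (simp add: UNIV_bool \<alpha>_def \<phi>_def algebra_simps)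
  also have "(LINT x|?L. indicator H x) + (LINT x|?L. indicator (\<Omega> - H) x) = (LINT x|?L. indicator H x + indicator (\<Omega> - H) x :: real)"
    using int[OF H] int[OF H'(1)] by simp
  also have "\<dots> = (LINT x|?L. 1 :: real)" by (intro Bochner_Integration.integral_cong) (auto simp: sp indicator_def)
  also have "\<dots> = measure lebesgue \<Omega>" using Om by (simp add: sp measure_restrict_space)
  finally have "ereal (c0 * (f H - f (\<Omega> - H)) - a0 * measure lebesgue \<Omega>) \<le> ereal m" using m by (rule order_trans)
  then have "(f H - f (\<Omega> - H)) * c0 \<le> m + a0 * measure lebesgue \<Omega>" by (simp add: algebra_simps)
  then show ?thesis unfolding P N using growth(1) by (simp add: pos_le_divide_eq)
qed

end

section \<open>Weak* closedness of the constraint\<close>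

lemma inner_regular_borel_on:
  fixes \<Omega> :: "'a::euclidean_space set"
  assumes P: "finite_measure P" "sets P = sets (borel_on \<Omega>)" and Om: "\<Omega> \<in> sets borel"
    and A: "A \<in> sets (borel_on \<Omega>)" and e: "e > 0"
  obtains K where "compact K" "K \<subseteq> A" "measure P (A - K) < e"
proof -
  interpret P: finite_measure P by fact
  have sp: "space P = \<Omega>" using sets_eq_imp_space_eq[OF P(2)] by (simp add: space_restrict_space)
  have setsP: "B \<in> sets P \<longleftrightarrow> B \<subseteq> \<Omega> \<and> B \<in> sets borel" for B
    using Om P(2) by (simp add: sets_restrict_space_iff)
  have id: "(\<lambda>x. x) \<in> measurable P borel"
    using Om by (intro measurableI) (auto simp: sp setsP)
  define \<nu> where "\<nu> = distr P borel (\<lambda>x. x)"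
  have nu: "emeasure \<nu> B = emeasure P B" if "B \<in> sets P" for B
    using that id setsP by (auto simp: \<nu>_def emeasure_distr sp Int_absorb2)
  have "finite_measure \<nu>" unfolding \<nu>_def using id by (rule P.finite_measure_distr)
  then interpret N: finite_measure \<nu> .
  have AP: "A \<in> sets P" using A P by simp
  have "emeasure \<nu> A = (SUP K\<in>{K. K \<subseteq> A \<and> compact K}. emeasure \<nu> K)"
    using AP setsP N.emeasure_finite[of "space \<nu>"] by (intro inner_regular) (auto simp: \<nu>_def)
  then have SUP: "emeasure P A = (SUP K\<in>{K. K \<subseteq> A \<and> compact K}. emeasure \<nu> K)" using nu[OF AP] by simp
  show thesis
  proof (cases "measure P A < e")
    case True
    then show thesis by (intro that[of "{}"]) auto
  next
    case False
    have "ennreal (measure P A - e) < emeasure P A"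
      using e False by (simp add: P.emeasure_eq_measure ennreal_less_iff)
    then obtain K where K: "K \<subseteq> A" "compact K" "ennreal (measure P A - e) < emeasure \<nu> K"
      unfolding SUP less_SUP_iff by auto
    have KP: "K \<in> sets P" using K AP setsP by (auto intro: borel_compact)
    have "measure P A - e < measure P K"
      using K(3) False unfolding nu[OF KP] by (simp add: P.emeasure_eq_measure ennreal_less_iff)
    then have "measure P (A - K) < e" using P.finite_measure_Diff[OF AP KP K(1)] by simp
    then show thesis using that K by blast
  qed
qed

text \<open>
  As \<open>k\<close> grows these decrease to the indicator of a closed \<open>K\<close>. The empty set is exceptional
  because the distance to it is 0 by convention.
\<close>

definition bump :: "nat \<Rightarrow> 'a::metric_space set \<Rightarrow> 'a \<Rightarrow> real" where
  "bump k K x = (if K = {} then 0 else max 0 (1 - real k * infdist x K))"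

lemma continuous_on_bump: "continuous_on S (bump k K)"
  by (cases "K = {}") (auto simp: bump_def[abs_def] intro!: continuous_intros)

lemma bump_bounds: "0 \<le> bump k K x" "bump k K x \<le> 1"
  by (auto simp: bump_def infdist_nonneg)

lemma cutoff_tendsto:
  assumes "d \<ge> (0::real)"
  shows "(\<lambda>k. max 0 (1 - real k * d)) \<longlonglongrightarrow> (if d = 0 then 1 else 0)"
proof (cases "d = 0")
  case False
  then have d: "d > 0" using assms by simp
  have "eventually (\<lambda>k. 1 / d \<le> real k) sequentially"
    using filterlim_real_sequentially by (simp add: filterlim_at_top)
  then have "eventually (\<lambda>k. max 0 (1 - real k * d) = 0) sequentially"
    by eventually_elim (use d in \<open>simp add: pos_divide_le_eq\<close>)
  then show ?thesis using False by (simp add: tendsto_eventually)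
qed simp

lemma bump_tendsto:
  assumes "closed K"
  shows "(\<lambda>k. bump k K x) \<longlonglongrightarrow> indicator K x"
proof (cases "K = {}")
  case False
  then have "infdist x K = 0 \<longleftrightarrow> x \<in> K" using in_closed_iff_infdist_zero[OF assms] by simp
  then show ?thesis
    using cutoff_tendsto[of "infdist x K"] False
    by (cases "x \<in> K") (simp_all add: bump_def infdist_nonneg)
qed (simp add: bump_def)

text \<open>
  Dividing by \<open>max 1 (\<Sum> \<dots>)\<close> keeps the sum of the test functions at most 1, and the factor
  \<open>1 - bump k (- \<Omega>)\<close> makes them vanish outside of \<open>\<Omega>\<close>; in the limit both disappear
  when the sets are disjoint closed subsets of the open set \<open>\<Omega>\<close>.
\<close>

definition test_family :: "'a::metric_space set \<Rightarrow> nat \<Rightarrow> (nat \<Rightarrow> 'a set) \<Rightarrow> nat \<Rightarrow> nat \<Rightarrow> 'a \<Rightarrow> real" where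
  "test_family \<Omega> n K k i x =
     (1 - bump k (- \<Omega>) x) * (bump k (K i) x / max 1 (\<Sum>j<n. bump k (K j) x))"

lemma continuous_on_test_family: "continuous_on S (test_family \<Omega> n K k i)"
  unfolding test_family_def
  by (intro continuous_intros continuous_on_bump) (auto simp: max_def)

lemma test_family_nonneg: "0 \<le> test_family \<Omega> n K k i x"
  unfolding test_family_def using bump_bounds by (intro mult_nonneg_nonneg divide_nonneg_nonneg) auto

lemma test_family_sum_le: "(\<Sum>i<n. test_family \<Omega> n K k i x) \<le> 1"
proof -
  let ?S = "\<Sum>j<n. bump k (K j) x"
  have "(\<Sum>i<n. test_family \<Omega> n K k i x) = (1 - bump k (- \<Omega>) x) * (?S / max 1 ?S)"
    by (simp add: test_family_def sum_distrib_left sum_divide_distrib)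
  also have "\<dots> \<le> 1 * 1"
    using bump_bounds[of k "- \<Omega>" x] sum_nonneg[of "{..<n}" "\<lambda>j. bump k (K j) x"] bump_bounds(1)
    by (intro mult_mono) (auto simp: divide_simps max_def)
  finally show ?thesis by simp
qed

lemma test_family_le_1:
  assumes "i < n" shows "test_family \<Omega> n K k i x \<le> 1"
proof -
  have "test_family \<Omega> n K k i x \<le> (\<Sum>i<n. test_family \<Omega> n K k i x)"
    using assms test_family_nonneg by (intro member_le_sum) auto
  also have "\<dots> \<le> 1" by (rule test_family_sum_le)
  finally show ?thesis .
qed

lemma test_family_tendsto:
  assumes cl: "\<And>i. i < n \<Longrightarrow> closed (K i)" and disj: "disjoint_family_on K {..<n}"
    and Om: "open \<Omega>" and x: "x \<in> \<Omega>" and i: "i < n"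
  shows "(\<lambda>k. test_family \<Omega> n K k i x) \<longlonglongrightarrow> indicator (K i) x"
proof -
  have "(\<Sum>j<n. indicator (K j) x :: real) = indicator (\<Union>j<n. K j) x"
    using disj by (intro indicator_UN_disjoint[symmetric]) auto
  then have le: "(\<Sum>j<n. indicator (K j) x :: real) \<le> 1" by (simp add: indicator_def)
  have "(\<lambda>k. test_family \<Omega> n K k i x) \<longlonglongrightarrow>
      (1 - indicator (- \<Omega>) x) * (indicator (K i) x / max 1 (\<Sum>j<n. indicator (K j) x))"
    unfolding test_family_def using cl Om i
    by (intro tendsto_intros bump_tendsto) (auto simp: max_def)
  moreover have "max 1 (\<Sum>j<n. indicator (K j) x :: real) = 1" using le by simp
  ultimately show ?thesis using x by simp
qed

lemma test_family_C0:
  fixes \<Omega> :: "'a::euclidean_space set"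
  assumes Om: "open \<Omega>" "bounded \<Omega>"
  shows "test_family \<Omega> n K k i \<in> C0 \<Omega>"
proof -
  have ne: "- \<Omega> \<noteq> {}" using Om(2) not_bounded_UNIV by (metis Compl_empty_eq double_complement)
  have zero: "test_family \<Omega> n K k i x = 0" if "x \<notin> \<Omega>" for x
    using that ne by (simp add: test_family_def bump_def)
  have "compact {x \<in> \<Omega>. \<bar>test_family \<Omega> n K k i x\<bar> \<ge> \<epsilon>}" if "\<epsilon> > 0" for \<epsilon>
  proof -
    have "{x \<in> \<Omega>. \<bar>test_family \<Omega> n K k i x\<bar> \<ge> \<epsilon>} = {x. \<bar>test_family \<Omega> n K k i x\<bar> \<ge> \<epsilon>}"
      using zero that by fastforce
    moreover have "closed {x. \<bar>test_family \<Omega> n K k i x\<bar> \<ge> \<epsilon>}"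
      by (intro closed_Collect_le continuous_intros continuous_on_test_family)
    moreover have "bounded {x \<in> \<Omega>. \<bar>test_family \<Omega> n K k i x\<bar> \<ge> \<epsilon>}"
      using Om(2) by (rule bounded_subset) auto
    ultimately show ?thesis by (simp add: compact_eq_bounded_closed)
  qed
  then show ?thesis unfolding C0_def using continuous_on_test_family by blast
qed

lemma continuous_bounded_measurable:
  fixes \<Omega> :: "'a::euclidean_space set"
  assumes "continuous_on UNIV \<phi>" "\<And>x. x \<in> \<Omega> \<Longrightarrow> \<bar>\<phi> x\<bar> \<le> (B::real)"
  shows "\<phi> \<in> bounded_measurable (borel_on \<Omega>)"
  using assms by (intro bounded_measurableI[where B=B] measurable_restrict_space1 borel_measurable_continuous_onI)
    (auto simp: space_restrict_space)

context constraint_integrand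
begin

text \<open>
  The test functions lie in \<open>C\<^sub>0(\<Omega>)\<close>, so the affine tests pass to the weak* limit; letting the
  test functions decrease to indicators gives the affine tests of \<open>f\<close> on disjoint compact sets,
  and inner regularity gives them on disjoint Borel sets.
\<close>

lemma constraint_weakstar_closed:
  fixes \<Omega> :: "'a::euclidean_space set"
  assumes Om: "open \<Omega>" "bounded \<Omega>"
    and F: "\<And>N. F N \<in> measures_on \<Omega>" and f: "f \<in> measures_on \<Omega>" and conv: "weakstar_conv \<Omega> F f"
    and le: "\<And>N. constraint_integral \<Omega> \<psi> (F N) \<le> ereal m"
  shows "constraint_integral \<Omega> \<psi> f \<le> ereal m"
proof (rule constraint_integral_le[OF f])
  let ?M = "borel_on \<Omega>" and ?L = "lebesgue_on \<Omega>"
  show Omb: "\<Omega> \<in> sets borel" and Oml: "\<Omega> \<in> lmeasurable"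
    using Om by (auto intro: lmeasurable_open)
  have sp: "space ?M = \<Omega>" "space ?L = \<Omega>" by (auto simp: space_restrict_space)
  have setsM: "B \<in> sets ?M \<longleftrightarrow> B \<subseteq> \<Omega> \<and> B \<in> sets borel" for B
    using Omb by (simp add: sets_restrict_space_iff)
  interpret L: finite_measure ?L using Oml by (rule finite_measure_lebesgue_on)
  define P N where "P = pos_part ?M f" and "N = neg_part ?M f"
  have P: "finite_measure P" "sets P = sets ?M" and N: "finite_measure N" "sets N = sets ?M"
    using f by (auto simp: P_def N_def finite_measure_pos_part finite_measure_neg_part)
  define R where "R = restrict_space lborel \<Omega>"
  have "emeasure lborel \<Omega> < \<infinity>" using Om(2) by (rule emeasure_bounded_finite)
  then have R: "finite_measure R" "sets R = sets ?M"
    unfolding R_def using Omb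
    by (auto intro!: finite_measureI simp: emeasure_restrict_space space_restrict_space sets_restrict_space)
  have mR: "measure R B = measure lborel B" if "B \<in> sets ?M" for B
    unfolding R_def using that setsM Omb by (intro measure_restrict_space) auto
  have LINT_ind: "(LINT x|?L. indicator B x) = measure lborel B" if "B \<in> sets ?M" for B
  proof -
    have "(LINT x|?L. indicator B x) = measure ?L B"
      using that setsM by (simp add: sp Int_absorb2 Int_absorb1)
    also have "\<dots> = measure lebesgue B" using that setsM Omb by (intro measure_restrict_space) auto
    also have "\<dots> = measure lborel B" using that setsM by (intro measure_completion) auto
    finally show ?thesis .
  qed
  fix n :: nat and \<alpha> \<beta> A
  assume min: "\<And>i. i < n \<Longrightarrow> (\<alpha> i, \<beta> i) \<in> affine_minorants \<psi>"
    and A: "\<And>i. i < n \<Longrightarrow> A i \<in> sets ?M" and disj: "disjoint_family_on A {..<n}"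
  have compact_case: "(\<Sum>i<n. \<alpha> i * f (K i) + \<beta> i * measure lborel (K i)) \<le> m"
    if K: "\<And>i. i < n \<Longrightarrow> compact (K i)" "\<And>i. i < n \<Longrightarrow> K i \<subseteq> A i" for K
  proof -
    have Kcl: "closed (K i)" if "i < n" for i using K(1)[OF that] by (rule compact_imp_closed)
    have KM: "K i \<in> sets ?M" if "i < n" for i
      using Kcl[OF that] K(2)[OF that] A[OF that] setsM by auto
    have Kdisj: "disjoint_family_on K {..<n}"
      using disj K(2) unfolding disjoint_family_on_def by (meson disjoint_iff lessThan_iff subsetD)
    let ?\<phi> = "test_family \<Omega> n K"
    have bm: "?\<phi> k i \<in> bounded_measurable ?M" if "i < n" for k i
      using test_family_nonneg[of \<Omega> n K k i] test_family_le_1[OF that, of \<Omega> K k]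
      by (intro continuous_bounded_measurable[where B=1] continuous_on_test_family) (simp only: abs_of_nonneg)
    have step: "(\<Sum>i<n. \<alpha> i * signed_integral ?M f (?\<phi> k i) + \<beta> i * (LINT x|?L. ?\<phi> k i x)) \<le> m" for k
    proof (rule LIMSEQ_le_const2)
      show "(\<lambda>j. \<Sum>i<n. \<alpha> i * signed_integral ?M (F j) (?\<phi> k i) + \<beta> i * (LINT x|?L. ?\<phi> k i x))
        \<longlonglongrightarrow> (\<Sum>i<n. \<alpha> i * signed_integral ?M f (?\<phi> k i) + \<beta> i * (LINT x|?L. ?\<phi> k i x))"
        using conv test_family_C0[OF Om, of n K k] unfolding weakstar_conv_def by (intro tendsto_intros) blast
      have "ereal (\<Sum>i<n. \<alpha> i * signed_integral ?M (F j) (?\<phi> k i) + \<beta> i * (LINT x|?L. ?\<phi> k i x))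
        \<le> constraint_integral \<Omega> \<psi> (F j)" for j
        using min bm test_family_nonneg test_family_sum_le
        by (intro affine_test_le_constraint_integral[OF F Omb Oml]) auto
      then have "ereal (\<Sum>i<n. \<alpha> i * signed_integral ?M (F j) (?\<phi> k i) + \<beta> i * (LINT x|?L. ?\<phi> k i x)) \<le> ereal m" for j
        by (rule order_trans[OF _ le])
      then show "\<exists>J. \<forall>j\<ge>J. (\<Sum>i<n. \<alpha> i * signed_integral ?M (F j) (?\<phi> k i) + \<beta> i * (LINT x|?L. ?\<phi> k i x)) \<le> m"
        unfolding ereal_less_eq(3) by blast
    qed
    have lim: "(\<lambda>k. LINT x|Q. ?\<phi> k i x) \<longlonglongrightarrow> (LINT x|Q. indicator (K i) x)"
      if i: "i < n" and Q: "finite_measure Q" "space Q = \<Omega>" "\<And>k. ?\<phi> k i \<in> borel_measurable Q"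
        "K i \<in> sets Q" for i Q
    proof (rule integral_dominated_convergence[where w="\<lambda>_. 1"])
      interpret Q: finite_measure Q by fact
      show "integrable Q (\<lambda>_. 1)" by simp
      show "AE x in Q. (\<lambda>k. ?\<phi> k i x) \<longlonglongrightarrow> indicator (K i) x"
        using Q(2) by (intro AE_I2 test_family_tendsto Kcl Kdisj Om i) auto
      show "AE x in Q. norm (?\<phi> k i x) \<le> 1" for k
        using test_family_nonneg[of \<Omega> n K k i] test_family_le_1[OF i, of \<Omega> K k]
        by (intro AE_I2) simp
    qed (use Q in auto)
    have meas: "?\<phi> k i \<in> borel_measurable Q" if "i < n" "sets Q = sets ?M" for k i Q
      using bm[OF that(1), of k] measurable_cong_sets[OF that(2) refl] unfolding bounded_measurable_def by auto
    have limS: "(\<lambda>k. signed_integral ?M f (?\<phi> k i)) \<longlonglongrightarrow> f (K i)" if i: "i < n" for i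
    proof -
      have "(\<lambda>k. integral\<^sup>L P (?\<phi> k i) - integral\<^sup>L N (?\<phi> k i))
        \<longlonglongrightarrow> (LINT x|P. indicator (K i) x) - (LINT x|N. indicator (K i) x)"
        using KM[OF i] P N sets_eq_imp_space_eq[OF P(2)] sets_eq_imp_space_eq[OF N(2)]
        by (intro tendsto_diff lim[OF i] meas[OF i]) (auto simp: sp)
      moreover have "(LINT x|P. indicator (K i) x) - (LINT x|N. indicator (K i) x) = f (K i)"
        using jordan_decomposition[OF f, of "K i"] KM[OF i] P N
        using sets.sets_into_space[of "K i" P] sets.sets_into_space[of "K i" N]
        by (simp add: P_def N_def Int_absorb1 Int_absorb2)
      ultimately show ?thesis unfolding signed_integral_def P_def N_def by simp
    qed
    have limL: "(\<lambda>k. LINT x|?L. ?\<phi> k i x) \<longlonglongrightarrow> measure lborel (K i)" if i: "i < n" for i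
      unfolding LINT_ind[OF KM[OF i], symmetric]
      using bm[OF i] sets_borel_on_lebesgue_on[OF KM[OF i]]
      by (intro lim[OF i] L.finite_measure_axioms borel_on_measurable_lebesgue_on)
        (auto simp: sp bounded_measurable_def)
    have "(\<lambda>k. \<Sum>i<n. \<alpha> i * signed_integral ?M f (?\<phi> k i) + \<beta> i * (LINT x|?L. ?\<phi> k i x))
      \<longlonglongrightarrow> (\<Sum>i<n. \<alpha> i * f (K i) + \<beta> i * measure lborel (K i))"
      by (intro tendsto_intros limS limL) auto
    then show ?thesis using step by (intro LIMSEQ_le_const2) auto
  qed
  have "\<exists>K. compact K \<and> K \<subseteq> A i \<and> \<bar>f (A i) - f K\<bar> \<le> 2 * e \<and> \<bar>measure lborel (A i) - measure lborel K\<bar> \<le> e"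
    if i: "i < n" and e: "e > 0" for i e
  proof -
    note Ai = A[OF i]
    obtain K1 where K1: "compact K1" "K1 \<subseteq> A i" "measure P (A i - K1) < e"
      using inner_regular_borel_on[OF P Omb Ai e] .
    obtain K2 where K2: "compact K2" "K2 \<subseteq> A i" "measure N (A i - K2) < e"
      using inner_regular_borel_on[OF N Omb Ai e] .
    obtain K3 where K3: "compact K3" "K3 \<subseteq> A i" "measure R (A i - K3) < e"
      using inner_regular_borel_on[OF R Omb Ai e] .
    \<comment> \<open>A single compact set approximates for both Jordan parts and for Lebesgue measure.\<close>
    define K where "K = K1 \<union> K2 \<union> K3"
    have K: "compact K" "K \<subseteq> A i" using K1 K2 K3 by (auto simp: K_def intro!: compact_Un)
    have small: "measure Q (A i - K) < e"
      if "finite_measure Q" "sets Q = sets ?M" "compact K'" "K' \<subseteq> K" "measure Q (A i - K') < e" for Q K'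
    proof -
      have "A i - K' \<in> sets Q" using that Ai setsM by (auto intro: borel_compact)
      then have "measure Q (A i - K) \<le> measure Q (A i - K')"
        using that by (intro finite_measure.finite_measure_mono) auto
      then show ?thesis using that by simp
    qed
    have KM: "K \<in> sets ?M" "A i - K \<in> sets ?M" using K Ai setsM by (auto intro: borel_compact)
    have "f (A i) - f K = f (A i - K)" using signed_measures_Diff[OF f Ai KM(1) K(2)] by simp
    also have "\<dots> = measure P (A i - K) - measure N (A i - K)"
      unfolding P_def N_def by (rule jordan_decomposition[OF f])
    finally have "f (A i) - f K = measure P (A i - K) - measure N (A i - K)" .
    moreover have "measure P (A i - K) < e" "measure N (A i - K) < e" "measure R (A i - K) < e"
      by (rule small[OF P K1(1) _ K1(3)] small[OF N K2(1) _ K2(3)] small[OF R K3(1) _ K3(3)], force simp: K_def)+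
    note lt = this
    ultimately have "\<bar>f (A i) - f K\<bar> \<le> 2 * e"
      using measure_nonneg[of P "A i - K"] measure_nonneg[of N "A i - K"] by linarith
    moreover have "measure R (A i) - measure R K = measure R (A i - K)"
      using R KM Ai K(2) by (simp add: finite_measure.finite_measure_Diff)
    then have "\<bar>measure lborel (A i) - measure lborel K\<bar> \<le> e"
      using lt(3) mR[OF Ai] mR[OF KM(1)] measure_nonneg[of R "A i - K"] by linarith
    ultimately show ?thesis using K by blast
  qed
  then have "\<forall>l. \<forall>i. \<exists>K. i < n \<longrightarrow> compact K \<and> K \<subseteq> A i \<and> \<bar>f (A i) - f K\<bar> \<le> 2 * (1 / real (Suc l))
      \<and> \<bar>measure lborel (A i) - measure lborel K\<bar> \<le> 1 / real (Suc l)"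
    by (meson zero_less_divide_1_iff of_nat_0_less_iff zero_less_Suc)
  then obtain K where K: "\<And>l i. i < n \<Longrightarrow> compact (K l i)" "\<And>l i. i < n \<Longrightarrow> K l i \<subseteq> A i"
    "\<And>l i. i < n \<Longrightarrow> \<bar>f (A i) - f (K l i)\<bar> \<le> 2 * (1 / real (Suc l))"
    "\<And>l i. i < n \<Longrightarrow> \<bar>measure lborel (A i) - measure lborel (K l i)\<bar> \<le> 1 / real (Suc l)"
    by metis
  have z: "(\<lambda>l. 1 / real (Suc l)) \<longlonglongrightarrow> 0" by (rule LIMSEQ_Suc[OF lim_1_over_n])
  have squeeze: "y \<longlonglongrightarrow> L" if "\<And>l. \<bar>L - y l\<bar> \<le> c * (1 / real (Suc l))" for y and L c :: real
  proof -
    have "(\<lambda>l. L - y l) \<longlonglongrightarrow> 0"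
    proof (rule Lim_null_comparison)
      show "eventually (\<lambda>l. norm (L - y l) \<le> c * (1 / real (Suc l))) sequentially"
        by (intro always_eventually allI) (simp only: real_norm_def that)
      show "(\<lambda>l. c * (1 / real (Suc l))) \<longlonglongrightarrow> 0" by (rule tendsto_mult_right_zero[OF z])
    qed
    from tendsto_diff[OF tendsto_const[of L] this] show ?thesis by simp
  qed
  have 1: "(\<lambda>l. f (K l i)) \<longlonglongrightarrow> f (A i)" if "i < n" for i
    by (rule squeeze[OF K(3)[OF that]])
  have 2: "(\<lambda>l. measure lborel (K l i)) \<longlonglongrightarrow> measure lborel (A i)" if "i < n" for i
    by (rule squeeze[where c=1]) (simp only: mult_1 K(4)[OF that])
  have "(\<lambda>l. \<Sum>i<n. \<alpha> i * f (K l i) + \<beta> i * measure lborel (K l i))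
      \<longlonglongrightarrow> (\<Sum>i<n. \<alpha> i * f (A i) + \<beta> i * measure lborel (A i))"
    using 1 2 by (intro tendsto_intros) auto
  then show "(\<Sum>i<n. \<alpha> i * f (A i) + \<beta> i * measure lborel (A i)) \<le> m"
    using compact_case[OF K(1,2)] by (intro LIMSEQ_le_const2) auto
qed

end

section \<open>Weak* compactness\<close>

lemma continuous_on_digit_series:
  assumes w: "summable w" "\<And>k. 0 \<le> w k"
  shows "continuous_on UNIV (\<lambda>b :: nat \<Rightarrow> bool. \<Sum>k. of_bool (b (e k)) * (w k :: real))"
proof (rule uniform_limit_theorem)
  show "uniform_limit UNIV (\<lambda>n b. \<Sum>k<n. of_bool (b (e k)) * w k) (\<lambda>b. \<Sum>k. of_bool (b (e k)) * w k) sequentially"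
    using w by (intro Weierstrass_m_test[where M=w]) (auto simp: of_bool_def)
  have "continuous_on UNIV (\<lambda>b :: nat \<Rightarrow> bool. of_bool (b k) :: real)" for k
  proof -
    have "continuous_on UNIV (of_bool :: bool \<Rightarrow> real)" by (simp add: continuous_on_def at_discrete)
    from continuous_on_compose2[OF this continuous_on_product_coordinates[of k]] show ?thesis by simp
  qed
  then show "\<forall>\<^sub>F n in sequentially. continuous_on UNIV (\<lambda>b :: nat \<Rightarrow> bool. \<Sum>k<n. of_bool (b (e k)) * w k)"
    by (intro always_eventually allI continuous_intros)
qed simp

lemma binary_expansion:
  assumes x: "0 \<le> (x::real)" "x < 1"
  obtains d :: "nat \<Rightarrow> bool" where "(\<Sum>k. of_bool (d k) * (1/2) ^ Suc k) = x"
proof -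
  define d where "d k = odd \<lfloor>2 ^ Suc k * x\<rfloor>" for k
  have part: "(\<Sum>k<n. of_bool (d k) * (1/2) ^ Suc k) = (of_int \<lfloor>2 ^ n * x\<rfloor> / 2 ^ n :: real)" for n
  proof (induction n)
    case 0
    have "\<lfloor>x\<rfloor> = 0" using x by linarith
    then show ?case by simp
  next
    case (Suc n)
    define y where "y = 2 ^ n * x"
    have "\<lfloor>2 * y\<rfloor> = 2 * \<lfloor>y\<rfloor> \<or> \<lfloor>2 * y\<rfloor> = 2 * \<lfloor>y\<rfloor> + 1" by linarith
    then have "\<lfloor>2 * y\<rfloor> = 2 * \<lfloor>y\<rfloor> + of_bool (odd \<lfloor>2 * y\<rfloor>)" by auto
    moreover have "2 ^ Suc n * x = 2 * y" by (simp add: y_def)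
    ultimately have "\<lfloor>2 ^ Suc n * x\<rfloor> = 2 * \<lfloor>2 ^ n * x\<rfloor> + of_bool (d n)"
      unfolding d_def by (simp only: y_def)
    then have "real_of_int \<lfloor>2 ^ Suc n * x\<rfloor> = 2 * of_int \<lfloor>2 ^ n * x\<rfloor> + of_bool (d n)"
      by simp
    then show ?case using Suc by (simp add: field_simps)
  qed
  have "(\<lambda>n. of_int \<lfloor>2 ^ n * x\<rfloor> / 2 ^ n :: real) \<longlonglongrightarrow> x"
  proof (rule tendsto_sandwich)
    have "(\<lambda>n. x - (1/2) ^ n) \<longlonglongrightarrow> x - 0" by (intro tendsto_intros) auto
    then show "(\<lambda>n. x - (1/2) ^ n) \<longlonglongrightarrow> x" by simp
    show "\<forall>\<^sub>F n in sequentially. x - (1/2) ^ n \<le> of_int \<lfloor>2 ^ n * x\<rfloor> / 2 ^ n"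
    proof (intro always_eventually allI)
      fix n
      have "2 ^ n * x - 1 \<le> of_int \<lfloor>2 ^ n * x\<rfloor>" by linarith
      then have "(2 ^ n * x - 1) / 2 ^ n \<le> of_int \<lfloor>2 ^ n * x\<rfloor> / 2 ^ n" by (intro divide_right_mono) auto
      moreover have "(2 ^ n * x - 1) / 2 ^ n = x - (1/2) ^ n" by (simp add: diff_divide_distrib power_one_over)
      ultimately show "x - (1/2) ^ n \<le> of_int \<lfloor>2 ^ n * x\<rfloor> / 2 ^ n" by simp
    qed
    show "\<forall>\<^sub>F n in sequentially. of_int \<lfloor>2 ^ n * x\<rfloor> / 2 ^ n \<le> x"
    proof (intro always_eventually allI)
      fix n
      have "of_int \<lfloor>2 ^ n * x\<rfloor> \<le> 2 ^ n * x" by linarith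
      then show "of_int \<lfloor>2 ^ n * x\<rfloor> / 2 ^ n \<le> x" by (simp add: field_simps)
    qed
  qed simp
  then have "(\<lambda>k. of_bool (d k) * (1/2) ^ Suc k) sums x" unfolding sums_def part .
  then show thesis using that sums_unique by metis
qed

text \<open>A scaled Cantor set: at the first differing digit the gap exceeds the remaining tail.\<close>

lemma inj_ternary_digits: "inj (\<lambda>b :: nat \<Rightarrow> bool. \<Sum>k. of_bool (b k) * (1/3 :: real) ^ k)"
proof (rule injI)
  fix b b' :: "nat \<Rightarrow> bool"
  have geo: "summable (\<lambda>k. (1/3 :: real) ^ k)" by (intro summable_geometric) simp
  have less: "(\<Sum>k. of_bool (q k) * (1/3 :: real) ^ k) < (\<Sum>k. of_bool (p k) * (1/3) ^ k)"
    if p: "p n" "\<not> q n" and eq: "\<And>k. k < n \<Longrightarrow> p k = q k" for p q :: "nat \<Rightarrow> bool" and n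
  proof -
    have sm: "summable (\<lambda>k. of_bool (r k) * (1/3 :: real) ^ k)" for r :: "nat \<Rightarrow> bool"
      by (rule summable_comparison_test'[OF geo, of 0]) simp
    define f where "f k = (of_bool (p k) - of_bool (q k)) * (1/3 :: real) ^ k" for k
    have f: "(\<Sum>k. f k) = (\<Sum>k. of_bool (p k) * (1/3 :: real) ^ k) - (\<Sum>k. of_bool (q k) * (1/3) ^ k)"
      unfolding f_def left_diff_distrib using sm by (intro suminf_diff[symmetric])
    have fs: "summable f" unfolding f_def left_diff_distrib using sm by (intro summable_diff)
    have "(\<Sum>k<Suc n. f k) = (1/3) ^ n" using p eq by (simp add: f_def)
    moreover have "(\<Sum>k. f k) = (\<Sum>k. f (k + Suc n)) + (\<Sum>k<Suc n. f k)"
      by (rule suminf_split_initial_segment[OF fs])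
    moreover have "(\<Sum>k. - ((1/3) ^ Suc n * (1/3 :: real) ^ k)) \<le> (\<Sum>k. f (k + Suc n))"
    proof (rule suminf_le)
      show "- ((1/3) ^ Suc n * (1/3 :: real) ^ k) \<le> f (k + Suc n)" for k
        by (auto simp: f_def power_add of_bool_def)
      show "summable (\<lambda>k. - ((1/3) ^ Suc n * (1/3 :: real) ^ k))"
        by (intro summable_minus summable_mult geo)
      show "summable (\<lambda>k. f (k + Suc n))" using fs by (rule summable_ignore_initial_segment)
    qed
    moreover have "(\<Sum>k. - ((1/3) ^ Suc n * (1/3 :: real) ^ k)) = - ((1/3) ^ n / 2)"
    proof -
      have "(\<Sum>k. (1/3) ^ Suc n * (1/3 :: real) ^ k) = (1/3) ^ Suc n * (\<Sum>k. (1/3) ^ k)"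
        by (rule suminf_mult[OF geo])
      also have "(\<Sum>k. (1/3 :: real) ^ k) = 3 / 2" by (subst suminf_geometric) auto
      finally show ?thesis using suminf_minus[OF summable_mult[OF geo, of "(1/3) ^ Suc n"]] by simp
    qed
    moreover have "(1/3 :: real) ^ n > 0" by simp
    ultimately show ?thesis unfolding f by linarith
  qed
  assume eq: "(\<Sum>k. of_bool (b k) * (1/3 :: real) ^ k) = (\<Sum>k. of_bool (b' k) * (1/3) ^ k)"
  show "b = b'"
  proof (rule ccontr)
    assume "b \<noteq> b'"
    then have ex: "\<exists>n. b n \<noteq> b' n" by auto
    define n where "n = (LEAST n. b n \<noteq> b' n)"
    have n: "b n \<noteq> b' n" "\<And>k. k < n \<Longrightarrow> b k = b' k"
      unfolding n_def using LeastI_ex[OF ex] not_less_Least by blast+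
    show False
    proof (cases "b n")
      case True
      then have "\<not> b' n" using n(1) by simp
      from less[of b n b', OF True this n(2)] eq show False by simp
    next
      case False
      then have "b' n" using n(1) by simp
      from less[of b' n b, OF this False n(2)[symmetric]] eq show False by simp
    qed
  qed
qed

text \<open>
  The digits of a point of the Cantor set are distributed over the coordinates and read there as
  binary expansions, which fills a cube.
\<close>

lemma bounded_subset_continuous_image_of_compact_real:
  fixes \<Omega> :: "'a::euclidean_space set"
  assumes "bounded \<Omega>"
  obtains T :: "real set" and h :: "real \<Rightarrow> 'a" where "compact T" "continuous_on T h" "\<Omega> \<subseteq> h ` T"
proof -
  obtain R where R: "R > 0" "\<And>x. x \<in> \<Omega> \<Longrightarrow> norm x < R"
    using assms unfolding bounded_pos_less by blast
  have "compact_space (product_topology (\<lambda>i::nat. euclidean :: bool topology) UNIV)"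
  proof -
    have "compact_space (euclidean :: bool topology)" by (simp add: compact_space_def finite_imp_compact)
    then show ?thesis unfolding compact_space_product_topology by blast
  qed
  then have comp: "compact (UNIV :: (nat \<Rightarrow> bool) set)"
    unfolding euclidean_product_topology by (simp add: compact_space_def)
  define c where "c b = (\<Sum>k. of_bool (b k) * (1/3 :: real) ^ k)" for b :: "nat \<Rightarrow> bool"
  have c: "continuous_on UNIV c"
    unfolding c_def by (intro continuous_on_digit_series summable_geometric) auto
  have injc: "inj c" unfolding c_def by (rule inj_ternary_digits)
  define T where "T = range c"
  have T: "compact T" unfolding T_def by (rule compact_continuous_image[OF c comp])
  have ginv: "continuous_on T (the_inv c)"
    unfolding T_def by (rule continuous_on_inv_into[OF c comp injc])
  define e where "e i k = prod_encode (to_nat_on (Basis :: 'a set) i, k)" for i k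
  define H where "H b = (\<Sum>i\<in>Basis. (2 * R * (\<Sum>k. of_bool (b (e i k)) * (1/2) ^ Suc k) - R) *\<^sub>R i)"
    for b :: "nat \<Rightarrow> bool"
  have half: "summable (\<lambda>k. (1/2 :: real) ^ Suc k)"
    using summable_mult[OF summable_geometric[of "1/2 :: real"], of "1/2"] by simp
  have H: "continuous_on UNIV H"
    unfolding H_def
    by (intro continuous_on_sum continuous_on_scaleR continuous_on_diff continuous_on_mult
        continuous_on_const continuous_on_digit_series[OF half]) simp
  have "continuous_on T (H \<circ> the_inv c)"
    by (rule continuous_on_compose[OF ginv continuous_on_subset[OF H]]) simp
  moreover have "\<Omega> \<subseteq> (H \<circ> the_inv c) ` T"
  proof
    fix x assume x: "x \<in> \<Omega>"
    have "\<exists>d :: nat \<Rightarrow> bool. (\<Sum>k. of_bool (d k) * (1/2) ^ Suc k) = (inner x i + R) / (2 * R)" if i: "i \<in> Basis" for i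
    proof -
      have "\<bar>inner x i\<bar> < R" using Basis_le_norm[OF i, of x] R(2)[OF x] by linarith
      then have "0 \<le> (inner x i + R) / (2 * R)" "(inner x i + R) / (2 * R) < 1" using R(1) by auto
      then show ?thesis using binary_expansion by metis
    qed
    then obtain d :: "'a \<Rightarrow> nat \<Rightarrow> bool" where d: "\<And>i. i \<in> Basis \<Longrightarrow>
        (\<Sum>k. of_bool (d i k) * (1/2) ^ Suc k) = (inner x i + R) / (2 * R)" by metis
    define b where "b n = d (from_nat_into Basis (fst (prod_decode n))) (snd (prod_decode n))" for n
    have be: "b (e i k) = d i k" if "i \<in> Basis" for i k
      using that by (simp add: b_def e_def countable_finite)
    have "H b = (\<Sum>i\<in>Basis. inner x i *\<^sub>R i)"
      unfolding H_def using be d R(1) by (intro sum.cong) auto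
    then have "H b = x" by (simp add: euclidean_representation)
    moreover have "the_inv c (c b) = b" using injc by (rule the_inv_f_f)
    ultimately have "(H \<circ> the_inv c) (c b) = x" by simp
    then show "x \<in> (H \<circ> the_inv c) ` T" unfolding T_def by (metis rangeI imageI)
  qed
  ultimately show thesis using that T by blast
qed

text \<open>
  The least preimage is a Borel section of a continuous map on a compact set of reals, since
  \<open>s x \<le> t\<close> holds exactly on the compact image of the part of \<open>T\<close> to the left of \<open>t\<close>.
\<close>

lemma borel_section_of_continuous_image:
  fixes h :: "real \<Rightarrow> 'a::euclidean_space"
  assumes T: "compact T" and h: "continuous_on T h" and sub: "\<Omega> \<subseteq> h ` T" and Om: "\<Omega> \<in> sets borel"
  obtains s where "s \<in> borel_measurable (borel_on \<Omega>)" "\<And>x. x \<in> \<Omega> \<Longrightarrow> s x \<in> T" "\<And>x. x \<in> \<Omega> \<Longrightarrow> h (s x) = x"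
proof -
  define s where "s x = Inf {t \<in> T. h t = x}" for x
  have s: "s x \<in> {t \<in> T. h t = x}" "\<And>t. t \<in> T \<Longrightarrow> h t = x \<Longrightarrow> s x \<le> t" if x: "x \<in> \<Omega>" for x
  proof -
    have "closed {t \<in> T. h t = x}"
      using continuous_closed_preimage_constant[OF h compact_imp_closed[OF T]] by simp
    then have "compact {t \<in> T. h t = x}"
      using compact_Int_closed[OF T, of "{t \<in> T. h t = x}"] by (simp add: Int_absorb1 Collect_conj_eq)
    moreover have "{t \<in> T. h t = x} \<noteq> {}" using sub x by auto
    moreover have bdd: "bdd_below {t \<in> T. h t = x}"
      using calculation(1) by (intro bounded_imp_bdd_below compact_imp_bounded)
    ultimately show "s x \<in> {t \<in> T. h t = x}"
      unfolding s_def by (intro closed_contains_Inf compact_imp_closed)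
    show "s x \<le> t" if "t \<in> T" "h t = x" for t
      unfolding s_def using that by (intro cInf_lower bdd) simp
  qed
  have "s \<in> borel_measurable (borel_on \<Omega>)"
    unfolding borel_measurable_iff_le
  proof
    fix t
    have "{x \<in> space (borel_on \<Omega>). s x \<le> t} = \<Omega> \<inter> h ` (T \<inter> {..t})"
    proof (intro subset_antisym subsetI)
      fix x assume "x \<in> {x \<in> space (borel_on \<Omega>). s x \<le> t}"
      then have x: "x \<in> \<Omega>" "s x \<le> t" by (auto simp: space_restrict_space)
      then have "x = h (s x)" "s x \<in> T \<inter> {..t}" using s(1)[OF x(1)] by auto
      then show "x \<in> \<Omega> \<inter> h ` (T \<inter> {..t})" using x(1) by blast
    next
      fix x assume "x \<in> \<Omega> \<inter> h ` (T \<inter> {..t})"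
      then obtain \<tau> where "x \<in> \<Omega>" "\<tau> \<in> T" "\<tau> \<le> t" "h \<tau> = x" by auto
      then show "x \<in> {x \<in> space (borel_on \<Omega>). s x \<le> t}"
        using s(2)[of x \<tau>] by (auto simp: space_restrict_space)
    qed
    moreover have "compact (h ` (T \<inter> {..t}))"
      using T h by (intro compact_continuous_image compact_Int_closed) (auto intro: continuous_on_subset)
    ultimately show "{x \<in> space (borel_on \<Omega>). s x \<le> t} \<in> sets (borel_on \<Omega>)"
      using Om by (auto simp: sets_restrict_space_iff intro: borel_compact)
  qed
  then show thesis using s by (intro that[of s]) auto
qed

text \<open>A point outside of \<open>\<Omega>\<close> has a neighbourhood missing the compact set where \<open>\<bar>\<phi>\<bar> \<ge> \<epsilon>\<close>.\<close>

lemma C0_zero_extension: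
  fixes \<Omega> :: "'a::euclidean_space set"
  assumes Om: "open \<Omega>" and \<phi>: "\<phi> \<in> C0 \<Omega>"
  shows "continuous_on UNIV (\<lambda>x. if x \<in> \<Omega> then \<phi> x else 0)" (is "continuous_on UNIV ?\<phi>")
proof -
  have c: "continuous_on \<Omega> \<phi>" and K: "\<And>\<epsilon>. \<epsilon> > 0 \<Longrightarrow> compact {x \<in> \<Omega>. \<bar>\<phi> x\<bar> \<ge> \<epsilon>}"
    using \<phi> unfolding C0_def by auto
  have "continuous (at x) ?\<phi>" for x
  proof (cases "x \<in> \<Omega>")
    case True
    have "continuous_on \<Omega> ?\<phi>" using c by (rule continuous_on_eq) simp
    then show ?thesis using True continuous_on_eq_continuous_at[OF Om, of ?\<phi>] by blast
  next
    case False
    have "(?\<phi> \<longlongrightarrow> 0) (at x)"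
    proof (rule tendstoI)
      fix \<epsilon> :: real assume e: "\<epsilon> > 0"
      define S where "S = - {x \<in> \<Omega>. \<bar>\<phi> x\<bar> \<ge> \<epsilon>}"
      have "open S" "x \<in> S" using K[OF e] False by (auto simp: S_def intro: compact_imp_closed)
      moreover have "dist (?\<phi> y) 0 < \<epsilon>" if "y \<in> S" for y
        using that e by (auto simp: S_def)
      ultimately show "eventually (\<lambda>y. dist (?\<phi> y) 0 < \<epsilon>) (at x)"
        unfolding eventually_at_topological by blast
    qed
    then show ?thesis using False by (simp add: continuous_within)
  qed
  then show ?thesis by (intro continuous_at_imp_continuous_on ballI)
qed

lemma C0_bounded_measurable:
  fixes \<Omega> :: "'a::euclidean_space set"
  assumes \<phi>: "\<phi> \<in> C0 \<Omega>"
  shows "\<phi> \<in> bounded_measurable (borel_on \<Omega>)"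
proof -
  have c: "continuous_on \<Omega> \<phi>" and K: "compact {x \<in> \<Omega>. \<bar>\<phi> x\<bar> \<ge> 1}"
    using \<phi> unfolding C0_def by auto
  have "compact (\<phi> ` {x \<in> \<Omega>. \<bar>\<phi> x\<bar> \<ge> 1})"
    using continuous_on_subset[OF c] K by (intro compact_continuous_image) auto
  then obtain B where B: "\<And>x. x \<in> \<Omega> \<Longrightarrow> \<bar>\<phi> x\<bar> \<ge> 1 \<Longrightarrow> \<bar>\<phi> x\<bar> \<le> B"
    by (force dest: compact_imp_bounded simp: bounded_iff)
  show ?thesis
  proof (rule bounded_measurableI)
    show "\<phi> \<in> borel_measurable (borel_on \<Omega>)" by (rule borel_measurable_continuous_on_restrict[OF c])
    show "\<bar>\<phi> x\<bar> \<le> max 1 B" if "x \<in> space (borel_on \<Omega>)" for x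
      using that B[of x] by (force simp: space_restrict_space)
  qed
qed

text \<open>
  Splitting off the total mass as a factor leaves probability measures. For the zero measure
  any of them will do; a Dirac mass in \<open>T\<close> is concentrated on \<open>T\<close> like the others.
\<close>

lemma normalized_image_measure:
  assumes M: "finite_measure M" and s: "s \<in> borel_measurable M" "\<And>x. x \<in> space M \<Longrightarrow> s x \<in> T"
    and T: "(t0::real) \<in> T" "T \<in> sets borel"
  obtains \<nu> where "real_distribution \<nu>" "AE t in \<nu>. t \<in> T"
    "\<And>F. F \<in> borel_measurable borel \<Longrightarrow>
      (LINT x|M. F (s x)) = measure M (space M) * (LINT t|\<nu>. F t :: real)"
proof (cases "measure M (space M) = 0")
  case True
  interpret M: finite_measure M by fact
  have "emeasure M (space M) = 0" using True by (simp add: M.emeasure_eq_measure)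
  then have "AE x in M. F (s x) = 0" for F :: "real \<Rightarrow> real" by (intro AE_I[where N="space M"]) auto
  then have "(LINT x|M. F (s x)) = 0" for F :: "real \<Rightarrow> real" by (rule integral_eq_zero_AE)
  moreover have "real_distribution (return borel t0)"
    by (intro real_distribution.intro real_distribution_axioms.intro prob_space_return) auto
  moreover have "AE t in return borel t0. t \<in> T"
  proof -
    have "AE t in return borel t0. t = t0" by (subst AE_return) auto
    then show ?thesis by eventually_elim (use T in simp)
  qed
  ultimately show thesis using True by (intro that[of "return borel t0"]) auto
next
  case False
  interpret M: finite_measure M by fact
  define c where "c = measure M (space M)"
  have c: "c > 0" using False by (simp add: c_def zero_less_measure_iff)
  define D where "D = density M (\<lambda>_. ennreal (1 / c))"
  define \<nu> where "\<nu> = distr D borel s"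
  have sD: "s \<in> borel_measurable D" using s(1) by (simp add: D_def)
  have "emeasure D (space D) = 1"
    using c by (simp add: D_def emeasure_density_const M.emeasure_eq_measure flip: ennreal_mult' c_def)
  then have "prob_space D" by (rule prob_spaceI)
  then have "prob_space \<nu>" unfolding \<nu>_def using sD by (rule prob_space.prob_space_distr)
  then have "real_distribution \<nu>"
    by (intro real_distribution.intro real_distribution_axioms.intro) (auto simp: \<nu>_def)
  moreover have "AE t in \<nu>. t \<in> T"
  proof -
    have "AE x in D. s x \<in> T" using s(2) by (intro AE_I2) (simp add: D_def)
    then show ?thesis unfolding \<nu>_def using T(2) by (subst AE_distr_iff[OF sD]) auto
  qed
  moreover have "(LINT x|M. F (s x)) = measure M (space M) * (LINT t|\<nu>. F t)"
    if F: "F \<in> borel_measurable borel" for F :: "real \<Rightarrow> real"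
  proof -
    have "(LINT t|\<nu>. F t) = (LINT x|D. F (s x))" unfolding \<nu>_def by (rule integral_distr[OF sD F])
    also have "\<dots> = (LINT x|M. (1 / c) * F (s x))"
      unfolding D_def using c F s(1) by (subst integral_density) auto
    finally show ?thesis using c by (simp add: c_def)
  qed
  ultimately show thesis by (intro that[of \<nu>]) auto
qed

text \<open>
  Helly's selection theorem is transported from the real line: a continuous surjection \<open>h\<close>
  from a compact set of reals onto a superset of \<open>\<Omega>\<close> has a Borel section, along which the
  measures are moved to the line, and the limit is moved back by \<open>h\<close>. Mass that escapes to the
  boundary is discarded, which is harmless for functions vanishing there.
\<close>

lemma finite_measures_weakstar_compact:
  fixes \<Omega> :: "'a::euclidean_space set"
  assumes Om: "open \<Omega>" "bounded \<Omega>" "\<Omega> \<noteq> {}"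
    and M: "\<And>n. finite_measure (M n)" "\<And>n. sets (M n) = sets (borel_on \<Omega>)"
    and C: "\<And>n. measure (M n) \<Omega> \<le> C"
  obtains r \<mu> where "strict_mono (r :: nat \<Rightarrow> nat)" "finite_measure \<mu>" "sets \<mu> = sets (borel_on \<Omega>)"
    "\<And>\<phi>. \<phi> \<in> C0 \<Omega> \<Longrightarrow> (\<lambda>n. integral\<^sup>L (M (r n)) \<phi>) \<longlonglongrightarrow> integral\<^sup>L \<mu> \<phi>"
proof -
  have Omb: "\<Omega> \<in> sets borel" using Om(1) by simp
  have sp: "space (M n) = \<Omega>" for n
    using sets_eq_imp_space_eq[OF M(2)[of n]] by (simp add: space_restrict_space)
  obtain T and h :: "real \<Rightarrow> 'a" where T: "compact T" and h: "continuous_on T h" and sub: "\<Omega> \<subseteq> h ` T"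
    by (rule bounded_subset_continuous_image_of_compact_real[OF Om(2)])
  obtain s where s: "s \<in> borel_measurable (borel_on \<Omega>)" "\<And>x. x \<in> \<Omega> \<Longrightarrow> s x \<in> T" "\<And>x. x \<in> \<Omega> \<Longrightarrow> h (s x) = x"
    by (rule borel_section_of_continuous_image[OF T h sub Omb]) blast
  have sM: "s \<in> borel_measurable (M n)" for n
    using s(1) measurable_cong_sets[OF M(2) refl] by blast
  obtain p where p: "p \<in> \<Omega>" using Om(3) by blast
  have Tc: "closed T" using T by (rule compact_imp_closed)
  have Tb: "T \<in> sets borel" using Tc by simp
  have "\<exists>\<nu>. real_distribution \<nu> \<and> (AE t in \<nu>. t \<in> T) \<and> (\<forall>F. F \<in> borel_measurable borel \<longrightarrow>
      (LINT x|M n. F (s x)) = measure (M n) \<Omega> * (LINT t|\<nu>. F t :: real))" for n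
    using normalized_image_measure[OF M(1) sM _ s(2)[OF p] Tb] s(2) unfolding sp by metis
  then obtain \<nu> where \<nu>: "\<And>n. real_distribution (\<nu> n)" "\<And>n. AE t in \<nu> n. t \<in> T"
    "\<And>n F. F \<in> borel_measurable borel \<Longrightarrow>
      (LINT x|M n. F (s x)) = measure (M n) \<Omega> * (LINT t|\<nu> n. F t :: real)" by metis
  obtain R where R: "R > 0" "\<And>t. t \<in> T \<Longrightarrow> \<bar>t\<bar> \<le> R"
    using compact_imp_bounded[OF T] unfolding bounded_pos by auto
  have "tight \<nu>"
    unfolding tight_def
  proof (intro conjI allI impI)
    fix e :: real assume e: "e > 0"
    have "measure (\<nu> n) {- R - 1<..R} = 1" for n
    proof -
      interpret real_distribution "\<nu> n" by (rule \<nu>(1))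
      have "AE t in \<nu> n. t \<in> {- R - 1<..R}" using \<nu>(2)[of n]
      proof eventually_elim
        case (elim t)
        then show ?case using R(2)[OF elim] by auto
      qed
      then show ?thesis by (intro prob_eq_1[THEN iffD2]) auto
    qed
    then show "\<exists>a b. a < b \<and> (\<forall>n. 1 - e < measure (\<nu> n) {a<..b})"
      using R(1) e by (intro exI[of _ "- R - 1"] exI[of _ R]) auto
  qed (rule \<nu>(1))
  note tight = this
  have "bounded (range (\<lambda>n. measure (M n) \<Omega>))"
    using C by (intro boundedI[where B=C]) (auto simp: C)
  then obtain m r1 where r1: "strict_mono (r1 :: nat \<Rightarrow> nat)" "((\<lambda>n. measure (M n) \<Omega>) \<circ> r1) \<longlonglongrightarrow> m"
    using bounded_imp_convergent_subsequence by blast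
  obtain r2 \<kappa> where r2: "strict_mono (r2 :: nat \<Rightarrow> nat)" "real_distribution \<kappa>" "weak_conv_m (\<nu> \<circ> r1 \<circ> r2) \<kappa>"
    using tight_imp_convergent_subsubsequence[OF tight r1(1)] by blast
  interpret K: real_distribution \<kappa> by (rule r2(2))
  define r where "r = r1 \<circ> r2"
  have r: "strict_mono r" unfolding r_def using r1(1) r2(1) by (rule strict_mono_o)
  have mlim: "(\<lambda>n. measure (M (r n)) \<Omega>) \<longlonglongrightarrow> m"
    using LIMSEQ_subseq_LIMSEQ[OF r1(2) r2(1)] by (simp add: r_def o_def)
  have m0: "m \<ge> 0" by (rule LIMSEQ_le_const[OF mlim]) auto
  have weak: "(\<lambda>n. LINT t|\<nu> (r n). F t) \<longlonglongrightarrow> (LINT t|\<kappa>. F t)"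
    if F: "continuous_on UNIV F" "\<And>t. \<bar>F t\<bar> \<le> B" for F :: "real \<Rightarrow> real" and B
  proof -
    have "weak_conv_m (\<lambda>n. \<nu> (r n)) \<kappa>" using r2(3) by (simp add: r_def o_def)
    then show ?thesis
      using F \<nu>(1) r2(2) by (intro weak_conv_imp_integral_bdd_continuous_conv[where B=B])
        (auto simp: continuous_on_eq_continuous_at)
  qed
  \<comment> \<open>The limit cannot charge the complement of \<open>T\<close>: the truncated distance to \<open>T\<close> has integral 0.\<close>
  have AET: "AE t in \<kappa>. t \<in> T"
  proof -
    define F where "F t = min 1 (infdist t T)" for t
    have F: "continuous_on UNIV F" "\<And>t. \<bar>F t\<bar> \<le> 1" "\<And>t. 0 \<le> F t"
      unfolding F_def by (auto intro!: continuous_intros simp: infdist_nonneg)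
    have Fb: "F \<in> borel_measurable borel" using F(1) by (rule borel_measurable_continuous_onI)
    have "(LINT t|\<nu> n. F t) = 0" for n
    proof (rule integral_eq_zero_AE)
      show "AE t in \<nu> n. F t = 0" using \<nu>(2)[of n] by eventually_elim (simp add: F_def)
    qed
    then have "(\<lambda>_. 0) \<longlonglongrightarrow> (LINT t|\<kappa>. F t)" using weak[OF F(1,2)] by simp
    then have "(LINT t|\<kappa>. F t) = 0" by (simp add: LIMSEQ_const_iff)
    moreover have "integrable \<kappa> F" using F(2) Fb by (intro K.integrable_const_bound[where B=1]) auto
    ultimately have "AE t in \<kappa>. F t = 0" using F(3) by (subst (asm) integral_nonneg_eq_0_iff_AE) auto
    moreover have "T \<noteq> {}" using p s(2) by blast
    then have "F t = 0 \<Longrightarrow> t \<in> T" for t using in_closed_iff_infdist_zero[OF Tc] by (auto simp: F_def min_def split: if_splits)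
    ultimately show ?thesis by auto
  qed
  define E where "E = {t \<in> T. h t \<in> \<Omega>}"
  have hT: "(\<lambda>t. indicator T t *\<^sub>R h t) \<in> borel_measurable borel"
    using Tb h by (rule borel_measurable_continuous_on_indicator)
  have "E = T \<inter> (\<lambda>t. indicator T t *\<^sub>R h t) -` \<Omega>" by (auto simp: E_def)
  then have Eb: "E \<in> sets borel" using Tb measurable_sets[OF hT Omb] by simp
  \<comment> \<open>The value \<open>p\<close> only keeps the range in \<open>\<Omega>\<close>; the density below vanishes off \<open>E\<close>.\<close>
  define h0 where "h0 t = (if t \<in> E then h t else p)" for t
  have "h0 \<in> borel_measurable borel"
  proof -
    have "(\<lambda>t. if t \<in> E then indicator T t *\<^sub>R h t else p) \<in> borel_measurable borel"
      using Eb hT by (intro measurable_If_set) auto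
    moreover have "(\<lambda>t. if t \<in> E then indicator T t *\<^sub>R h t else p) = h0" by (auto simp: h0_def E_def)
    ultimately show ?thesis by simp
  qed
  then have h0: "h0 \<in> measurable borel (borel_on \<Omega>)"
    using p by (intro measurable_restrict_space2) (auto simp: h0_def E_def)
  define D where "D = density \<kappa> (\<lambda>t. ennreal (m * indicator E t))"
  define \<mu> where "\<mu> = distr D (borel_on \<Omega>) h0"
  have h0D: "h0 \<in> measurable D (borel_on \<Omega>)"
    using h0 measurable_cong_sets[of D borel, OF _ refl] by (simp add: D_def)
  have "finite_measure D"
  proof (rule finite_measureI)
    have "emeasure D (space D) = (\<integral>\<^sup>+t. ennreal (m * indicator E t) \<partial>\<kappa>)"
      unfolding D_def using Eb by (subst emeasure_density) (auto intro!: nn_integral_cong)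
    also have "\<dots> \<le> (\<integral>\<^sup>+t. ennreal m \<partial>\<kappa>)"
      using m0 by (intro nn_integral_mono ennreal_leI) (auto simp: indicator_def)
    also have "\<dots> = ennreal m" using K.emeasure_space_1 by simp
    finally show "emeasure D (space D) \<noteq> \<infinity>" by (metis ennreal_neq_top infinity_ennreal_def top.extremum_uniqueI)
  qed
  then have \<mu>fin: "finite_measure \<mu>" unfolding \<mu>_def using h0D by (rule finite_measure.finite_measure_distr)
  have conv: "(\<lambda>n. integral\<^sup>L (M (r n)) \<phi>) \<longlonglongrightarrow> integral\<^sup>L \<mu> \<phi>" if \<phi>: "\<phi> \<in> C0 \<Omega>" for \<phi>
  proof -
    define \<phi>0 where "\<phi>0 x = (if x \<in> \<Omega> then \<phi> x else 0)" for x
    have \<phi>0: "continuous_on UNIV \<phi>0" unfolding \<phi>0_def by (rule C0_zero_extension[OF Om(1) \<phi>])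
    have G: "continuous_on T (\<lambda>t. \<phi>0 (h t))" using continuous_on_compose2[OF \<phi>0 h] by simp
    then have "bounded ((\<lambda>t. \<phi>0 (h t)) ` T)" using T by (intro compact_imp_bounded compact_continuous_image)
    then obtain B where B: "B > 0" "\<And>t. t \<in> T \<Longrightarrow> \<bar>\<phi>0 (h t)\<bar> \<le> B" unfolding bounded_pos by auto
    obtain F where F: "continuous_on UNIV F" "\<And>t. t \<in> T \<Longrightarrow> F t = \<phi>0 (h t)" "\<And>t. \<bar>F t\<bar> \<le> B"
      using Tietze[OF G, of UNIV B] Tc B by auto
    have Fb: "F \<in> borel_measurable borel" using F(1) by (rule borel_measurable_continuous_onI)
    have "integral\<^sup>L (M n) \<phi> = measure (M n) \<Omega> * (LINT t|\<nu> n. F t)" for n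
    proof -
      have "integral\<^sup>L (M n) \<phi> = (LINT x|M n. F (s x))"
        using s F(2) by (intro Bochner_Integration.integral_cong) (auto simp: sp \<phi>0_def)
      then show ?thesis using \<nu>(3)[OF Fb] by simp
    qed
    then have lim: "(\<lambda>n. integral\<^sup>L (M (r n)) \<phi>) \<longlonglongrightarrow> m * (LINT t|\<kappa>. F t)"
      using tendsto_mult[OF mlim weak[OF F(1,3)]] by simp
    have \<phi>m: "\<phi> \<in> borel_measurable (borel_on \<Omega>)"
      using C0_bounded_measurable[OF \<phi>] unfolding bounded_measurable_def by blast
    have \<phi>h: "(\<lambda>t. \<phi> (h0 t)) \<in> borel_measurable borel" using measurable_compose[OF h0 \<phi>m] .
    have "integral\<^sup>L \<mu> \<phi> = (LINT t|D. \<phi> (h0 t))" unfolding \<mu>_def by (rule integral_distr[OF h0D \<phi>m])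
    also have "\<dots> = (LINT t|\<kappa>. (m * indicator E t) * \<phi> (h0 t))"
      unfolding D_def using \<phi>h Eb m0 by (subst integral_density) auto
    also have "\<dots> = (LINT t|\<kappa>. m * F t)"
    proof (rule integral_cong_AE)
      show "AE t in \<kappa>. m * indicator E t * \<phi> (h0 t) = m * F t"
        using AET by eventually_elim (auto simp: F(2) E_def h0_def \<phi>0_def indicator_def)
    qed (use \<phi>h Eb Fb in auto)
    finally show ?thesis using lim by simp
  qed
  show thesis by (rule that[OF r \<mu>fin _ conv]) (simp add: \<mu>_def)
qed

text \<open>
  The limits of the Jordan parts need not be the Jordan parts of their difference, as mass may
  cancel; integrals against the difference are nevertheless the differences of the integrals.
\<close>

lemma signed_measures_weakstar_compact:
  fixes \<Omega> :: "'a::euclidean_space set"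
  assumes Om: "open \<Omega>" "bounded \<Omega>" "\<Omega> \<noteq> {}"
    and F: "\<And>n. F n \<in> measures_on \<Omega>"
    and C: "\<And>n. measure (pos_part (borel_on \<Omega>) (F n)) \<Omega> + measure (neg_part (borel_on \<Omega>) (F n)) \<Omega> \<le> C"
  obtains r f where "strict_mono (r :: nat \<Rightarrow> nat)" "f \<in> measures_on \<Omega>" "weakstar_conv \<Omega> (F \<circ> r) f"
proof -
  let ?M = "borel_on \<Omega>"
  define P N where "P n = pos_part ?M (F n)" and "N n = neg_part ?M (F n)" for n
  have P: "finite_measure (P n)" "sets (P n) = sets ?M" and N: "finite_measure (N n)" "sets (N n) = sets ?M" for n
    using F[of n] by (auto simp: P_def N_def finite_measure_pos_part finite_measure_neg_part)
  have "measure (P n) \<Omega> \<le> C" "measure (N n) \<Omega> \<le> C" for n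
    using C[of n] measure_nonneg[of "P n" \<Omega>] measure_nonneg[of "N n" \<Omega>] unfolding P_def N_def by linarith+
  note bd = this
  obtain r1 \<mu>1 where 1: "strict_mono (r1 :: nat \<Rightarrow> nat)" "finite_measure \<mu>1" "sets \<mu>1 = sets ?M"
    "\<And>\<phi>. \<phi> \<in> C0 \<Omega> \<Longrightarrow> (\<lambda>n. integral\<^sup>L (P (r1 n)) \<phi>) \<longlonglongrightarrow> integral\<^sup>L \<mu>1 \<phi>"
    by (rule finite_measures_weakstar_compact[where M=P, OF Om P bd(1)]) blast
  obtain r2 \<mu>2 where 2: "strict_mono (r2 :: nat \<Rightarrow> nat)" "finite_measure \<mu>2" "sets \<mu>2 = sets ?M"
    "\<And>\<phi>. \<phi> \<in> C0 \<Omega> \<Longrightarrow> (\<lambda>n. integral\<^sup>L (N (r1 (r2 n))) \<phi>) \<longlonglongrightarrow> integral\<^sup>L \<mu>2 \<phi>"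
    by (rule finite_measures_weakstar_compact[where M="\<lambda>n. N (r1 n)", OF Om N bd(2)]) blast
  define f where "f A = measure \<mu>1 A - measure \<mu>2 A" for A
  have f: "f \<in> measures_on \<Omega>"
    unfolding f_def using 1(2,3) 2(2,3) by (intro signed_measures_diff_measure)
  have "weakstar_conv \<Omega> (F \<circ> (r1 \<circ> r2)) f"
    unfolding weakstar_conv_def
  proof
    fix \<phi> assume \<phi>: "\<phi> \<in> C0 \<Omega>"
    have "signed_integral ?M f \<phi> = integral\<^sup>L \<mu>1 \<phi> - integral\<^sup>L \<mu>2 \<phi>"
    proof (rule integration_functional_unique[OF integration_functional_signed[OF f] _ C0_bounded_measurable[OF \<phi>]])
      show "integration_functional ?M f (\<lambda>\<phi>. integral\<^sup>L \<mu>1 \<phi> - integral\<^sup>L \<mu>2 \<phi>)"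
        unfolding f_def using 1(2,3) 2(2,3)
        by (intro integration_functional_diff integration_functional_measure)
    qed
    moreover have "(\<lambda>n. integral\<^sup>L (P (r1 (r2 n))) \<phi> - integral\<^sup>L (N (r1 (r2 n))) \<phi>) \<longlonglongrightarrow> integral\<^sup>L \<mu>1 \<phi> - integral\<^sup>L \<mu>2 \<phi>"
      using LIMSEQ_subseq_LIMSEQ[OF 1(4)[OF \<phi>] 2(1)] 2(4)[OF \<phi>] by (intro tendsto_diff) (auto simp: o_def)
    ultimately show "(\<lambda>n. signed_integral ?M ((F \<circ> (r1 \<circ> r2)) n) \<phi>) \<longlonglongrightarrow> signed_integral ?M f \<phi>"
      by (simp add: signed_integral_def P_def N_def)
  qed
  then show thesis using that strict_mono_o[OF 1(1) 2(1)] f by blast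
qed

section \<open>Existence of an optimal measure\<close>

theorem theorem3p4:
  fixes \<Omega> :: "'a::euclidean_space set"
    and \<psi> :: "real \<Rightarrow> ereal"
    and j :: "'a \<Rightarrow> real \<Rightarrow> real \<Rightarrow> ereal"
    and J :: "('a set \<Rightarrow> real) \<Rightarrow> ereal"
    and a :: "'a \<Rightarrow> real"
    and m c p c0 a0 :: real
  assumes dim: "DIM('a) \<ge> 2"
    and domain: "open \<Omega>" "connected \<Omega>" "\<Omega> \<noteq> {}" "bounded \<Omega>"
    and m: "m > 0"
    and psi_nonneg: "\<forall>s. \<psi> s \<ge> 0"
    and psi_convex: "ereal_convex \<psi>"
    and psi_lsc: "ereal_lsc \<psi>"
    and psi_dom: "interior {s. \<psi> s < \<infinity>} \<noteq> {}"
    and psi_coercive: "(\<psi> \<longlongrightarrow> \<infinity>) at_infinity"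
    and J: "is_integral_cost \<Omega> j J"
    and J_lsc: "weakstar_lsc \<Omega> J"
    and j_growth: "c > 0" "integrable (lebesgue_on \<Omega>) a"
      "DIM('a) > 2 \<Longrightarrow> p < DIM('a) / (DIM('a) - 2)"
      "AE x in lebesgue_on \<Omega>. \<forall>s z. ereal (- c * \<bar>s\<bar> powr p - a x) \<le> j x s z"
    and psi_growth: "c0 > 0" "\<forall>s. ereal (c0 * \<bar>s\<bar> - a0) \<le> \<psi> s"
    and nonempty: "feasible \<Omega> \<psi> m \<noteq> {}"
  shows "\<exists>f_opt\<in>feasible \<Omega> \<psi> m.
           (\<forall>f\<in>feasible \<Omega> \<psi> m. J f_opt \<le> J f) \<and>
           total_variation (borel_on \<Omega>) f_opt < \<infinity>"
proof -
  let ?feas = "feasible \<Omega> \<psi> m"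
  obtain x0 where "x0 \<in> interior {s. \<psi> s < \<infinity>}" using psi_dom by blast
  then have "\<psi> x0 < \<infinity>" using interior_subset by fastforce
  then interpret constraint_integrand \<psi>
    using psi_nonneg psi_convex psi_lsc by unfold_locales blast+
  have Om: "\<Omega> \<in> sets borel" "\<Omega> \<in> lmeasurable"
    using domain(1,4) by (auto intro: lmeasurable_open)
  have feasD: "f \<in> measures_on \<Omega>" "constraint_integral \<Omega> \<psi> f \<le> ereal m" if "f \<in> ?feas" for f
    using that unfolding feasible_def by auto
  have "J ` ?feas \<noteq> {}" using nonempty by simp
  \<comment> \<open>The infimum may be infinite; it is the limit of a decreasing sequence of values all the same.\<close>
  from Inf_countable_INF[OF this]
  obtain v :: "nat \<Rightarrow> ereal" where v: "decseq v" "range v \<subseteq> J ` ?feas" "Inf (J ` ?feas) = (INF n. v n)"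
    by blast
  have "\<exists>f. f \<in> ?feas \<and> J f = v n" for n using v(2) by (metis imageE rangeI subsetD)
  then obtain F where F: "\<And>n. F n \<in> ?feas" "\<And>n. J (F n) = v n" by metis
  obtain r f where r: "strict_mono r" and f: "f \<in> measures_on \<Omega>" and conv: "weakstar_conv \<Omega> (F \<circ> r) f"
    by (rule signed_measures_weakstar_compact[OF domain(1,4,3) feasD(1)[OF F(1)]
          total_mass_le_constraint_integral[OF feasD(1)[OF F(1)] Om psi_growth feasD(2)[OF F(1)]]])
  have "constraint_integral \<Omega> \<psi> f \<le> ereal m"
    by (rule constraint_weakstar_closed[OF domain(1,4) _ f conv]) (simp_all add: feasD F(1))
  with f have feas: "f \<in> ?feas" unfolding feasible_def by simp
  have "v \<longlonglongrightarrow> Inf (J ` ?feas)" unfolding v(3) by (rule LIMSEQ_INF[OF v(1)])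
  then have "(\<lambda>n. J ((F \<circ> r) n)) \<longlonglongrightarrow> Inf (J ` ?feas)"
    using LIMSEQ_subseq_LIMSEQ[OF _ r] by (simp add: F(2) o_def)
  then have "liminf (\<lambda>n. J ((F \<circ> r) n)) = Inf (J ` ?feas)" by (intro lim_imp_Liminf) simp_all
  moreover have "J f \<le> liminf (\<lambda>n. J ((F \<circ> r) n))"
  proof -
    have "\<forall>n. (F \<circ> r) n \<in> measures_on \<Omega>" by (simp add: feasD F(1))
    then show ?thesis using J_lsc f conv unfolding weakstar_lsc_def by blast
  qed
  ultimately have min: "J f \<le> J f'" if "f' \<in> ?feas" for f'
    using that by (metis INF_lower order_trans)
  have "total_variation (borel_on \<Omega>) f < \<infinity>"
    using finite_measure.emeasure_finite[OF finite_measure_pos_part[OF f]]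
      finite_measure.emeasure_finite[OF finite_measure_neg_part[OF f]]
    by (simp add: total_variation_def less_top)
  with feas min show ?thesis by blast
qed

end
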